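(* Let $G$ be a compact, connected Lie group with Lie algebra $\mathfrak{g}$, and let $\mathcal{V} \subset \mathbb{C}TG$ be an involutive, essentially real, left-invariant subbundle of rank $n$. Let $\mathfrak{h} \subset \mathfrak{g}$ be the real Lie subalgebra whose complexification is the Lie algebra $\mathfrak{v}$ of left-invariant sections of $\mathcal{V}$, and let $H \subset G$ be the connected integral subgroup of $\mathfrak{h}$. If $H \subset G$ is closed, then $\mathrm{d}' : C^\infty(G) \to C^\infty(G; \underline{\Lambda}^1)$ has closed range.
   Context: Functions and forms are complex-valued. $\mathfrak{g}$ is the Lie algebra of real left-invariant vector fields on $G$, $\mathbb{C}\mathfrak{g}$ its complexification. $\mathcal{V}$ is involutive if the Lie bracket of any two smooth sections of $\mathcal{V}$ is a section of $\mathcal{V}$; left-invariant if $(\ell_x)_*\mathcal{V}_y \subset \mathcal{V}_{xy}$ for all $x,y \in G$, where $\ell_x$ is left translation by $x$; essentially real if $\overline{\mathcal{V}_x} = \mathcal{V}_x$ for all $x$. $\mathfrak{v} \subset \mathbb{C}\mathfrak{g}$ is the complex Lie subalgebra of left-invariant sections of $\mathcal{V}$; since $\mathcal{V}$ is essentially real, $\mathfrak{v}$ is the complexification of a unique Lie subalgebra $\mathfrak{h} \subset \mathfrak{g}$. The integral subgroup of $\mathfrak{h}$ is the connected Lie subgroup of $G$ with Lie algebra $\mathfrak{h}$. Fix real left-invariant vector fields $L_1, \dots, L_n$ forming a basis of $\mathfrak{v}$, complete them with $M_1, \dots, M_m \in \mathbb{C}\mathfrak{g}$ to a basis of $\mathbb{C}\mathfrak{g}$,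 and let $\tau_1, \dots, \tau_n, \zeta_1, \dots, \zeta_m$ be the dual basis of left-invariant $1$-forms. $C^\infty(G; \underline{\Lambda}^1)$ is the space of $1$-forms $\sum_{j=1}^n u_j \tau_j$ with $u_j \in C^\infty(G)$, with the Fréchet topology of $C^\infty$ convergence of the coefficients, and $\mathrm{d}' f = \sum_{j=1}^n (L_j f)\, \tau_j$ for $f \in C^\infty(G)$. *)

theory Defs
  imports
    "HOL-Analysis.Analysis"
    "HOL-Algebra.Group"
    "HOL-Library.Function_Algebras"
begin

section \<open>Smooth functions on open subsets of Euclidean space\<close>

text \<open>
  The model space of dimension \<open>d\<close> is the library's \<^const>\<open>Euclidean_space\<close> \<open>d\<close>: sequences whose
  coordinates with index \<open>\<ge> d\<close> vanish. This permits \<open>d = 0\<close> and an existentially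
  quantified dimension. A function is smooth if all its iterated partial derivatives exist and
  are continuous.
\<close>

definition partial_deriv :: "nat \<Rightarrow> ((nat \<Rightarrow> real) \<Rightarrow> 'b::real_normed_vector) \<Rightarrow> (nat \<Rightarrow> real) \<Rightarrow> 'b" where
  "partial_deriv i f x = vector_derivative (\<lambda>t. f (x(i := t))) (at (x i))"

fun iter_partial :: "nat list \<Rightarrow> ((nat \<Rightarrow> real) \<Rightarrow> 'b::real_normed_vector) \<Rightarrow> (nat \<Rightarrow> real) \<Rightarrow> 'b" where
  "iter_partial [] f = f"
| "iter_partial (i # ks) f = partial_deriv i (iter_partial ks f)"

definition smooth_on_open :: "nat \<Rightarrow> (nat \<Rightarrow> real) set \<Rightarrow> ((nat \<Rightarrow> real) \<Rightarrow> 'b::real_normed_vector) \<Rightarrow> bool" where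
  "smooth_on_open d W f \<longleftrightarrow>
     (\<forall>ks. set ks \<subseteq> {..<d} \<longrightarrow>
        continuous_map (subtopology (Euclidean_space d) W) euclidean (iter_partial ks f) \<and>
        (\<forall>x\<in>W. \<forall>i<d. (\<lambda>t. iter_partial ks f (x(i := t))) differentiable (at (x i))))"


section \<open>Smooth manifolds\<close>

text \<open>
  A chart is a pair of its domain and its coordinate map. The atlas
  determines the smooth structure and need not be maximal.
\<close>

record 'a manifold =
  mdim :: nat
  mtop :: "'a topology"
  atlas :: "('a set \<times> ('a \<Rightarrow> nat \<Rightarrow> real)) set"

locale smooth_manifold =
  fixes M :: "'a manifold"
  assumes hausdorff: "Hausdorff_space (mtop M)"
    and second_countable: "second_countable (mtop M)"
    and atlas_cover: "(\<Union>(U, \<phi>)\<in>atlas M. U) = topspace (mtop M)"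
    and chart_domain: "(U, \<phi>) \<in> atlas M \<Longrightarrow> openin (mtop M) U"
    and chart_image: "(U, \<phi>) \<in> atlas M \<Longrightarrow> openin (Euclidean_space (mdim M)) (\<phi> ` U)"
    and chart_homeomorphic: "(U, \<phi>) \<in> atlas M \<Longrightarrow>
          homeomorphic_map (subtopology (mtop M) U)
            (subtopology (Euclidean_space (mdim M)) (\<phi> ` U)) \<phi>"
    and chart_compatible: "(U, \<phi>) \<in> atlas M \<Longrightarrow> (V, \<psi>) \<in> atlas M \<Longrightarrow> i < mdim M \<Longrightarrow>
          smooth_on_open (mdim M) (\<phi> ` (U \<inter> V)) (\<lambda>y. \<psi> (inv_into U \<phi> y) i)"

definition smooth_map :: "'a manifold \<Rightarrow> 'b manifold \<Rightarrow> ('a \<Rightarrow> 'b) \<Rightarrow> bool" where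
  "smooth_map M N F \<longleftrightarrow>
     continuous_map (mtop M) (mtop N) F \<and>
     (\<forall>(U, \<phi>)\<in>atlas M. \<forall>(V, \<psi>)\<in>atlas N. \<forall>i<mdim N.
        smooth_on_open (mdim M) (\<phi> ` {x \<in> U. F x \<in> V}) (\<lambda>y. \<psi> (F (inv_into U \<phi> y)) i))"

definition prod_manifold :: "'a manifold \<Rightarrow> 'b manifold \<Rightarrow> ('a \<times> 'b) manifold" where
  "prod_manifold M N =
     \<lparr> mdim = mdim M + mdim N,
       mtop = prod_topology (mtop M) (mtop N),
       atlas = {(U \<times> V, \<lambda>(x, y) k. if k < mdim M then \<phi> x k else \<psi> y (k - mdim M)) | U \<phi> V \<psi>.
                  (U, \<phi>) \<in> atlas M \<and> (V, \<psi>) \<in> atlas N} \<rparr>"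

definition smooth_fun_on :: "'a manifold \<Rightarrow> 'a set \<Rightarrow> ('a \<Rightarrow> complex) \<Rightarrow> bool" where
  "smooth_fun_on M W f \<longleftrightarrow>
     (\<forall>(U, \<phi>)\<in>atlas M. smooth_on_open (mdim M) (\<phi> ` (U \<inter> W)) (\<lambda>y. f (inv_into U \<phi> y)))"

text \<open>
  Functions on a manifold are represented by functions on the ambient type that vanish outside
  the manifold, so that equality on the manifold is equality.
\<close>

definition restrict0 :: "'a set \<Rightarrow> ('a \<Rightarrow> complex) \<Rightarrow> 'a \<Rightarrow> complex" where
  "restrict0 S f = (\<lambda>x. if x \<in> S then f x else 0)"

definition C_inf :: "'a manifold \<Rightarrow> ('a \<Rightarrow> complex) set" where
  "C_inf M = {f. smooth_fun_on M (topspace (mtop M)) f \<and> (\<forall>x. x \<notin> topspace (mtop M) \<longrightarrow> f x = 0)}"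

text \<open>
  The usual Frechet topology, given by the seminorms \<open>sup\<^sub>K \<bar>\<partial>\<^sup>\<alpha> (f \<circ> \<phi>\<^sup>-\<^sup>1)\<bar>\<close>,
  where \<open>\<phi>\<close> is a chart and \<open>K\<close> is a compact subset of its image. The sets below are the
  balls of these seminorms (the supremum is attained).
\<close>

definition C_inf_topology :: "'a manifold \<Rightarrow> ('a \<Rightarrow> complex) topology" where
  "C_inf_topology M = topology_generated_by
     {{g \<in> C_inf M. \<forall>y\<in>K. norm (iter_partial ks (\<lambda>z. g (inv_into U \<phi> z) - f (inv_into U \<phi> z)) y) < \<epsilon>}
       | f U \<phi> K ks \<epsilon>.
         f \<in> C_inf M \<and> (U, \<phi>) \<in> atlas M \<and> compactin (Euclidean_space (mdim M)) K \<and> K \<subseteq> \<phi> ` U \<and>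
         set ks \<subseteq> {..<mdim M} \<and> \<epsilon> > 0}"


section \<open>Complexified tangent vectors, vector fields, 1-forms\<close>

type_synonym 'a ctangent = "('a \<Rightarrow> complex) \<Rightarrow> complex"
type_synonym 'a vfield = "'a \<Rightarrow> 'a ctangent"
type_synonym 'a form1 = "'a \<Rightarrow> 'a ctangent \<Rightarrow> complex"

text \<open>
  The complexified tangent space at \<open>x\<close> consists of the complex-linear derivations at \<open>x\<close> of the
  algebra of smooth complex-valued functions (extended by \<open>0\<close> to nonsmooth functions).
\<close>

definition ctangent_space :: "'a manifold \<Rightarrow> 'a \<Rightarrow> 'a ctangent set" where
  "ctangent_space M x = {D.
     (\<forall>f\<in>C_inf M. \<forall>g\<in>C_inf M. D (\<lambda>y. f y + g y) = D f + D g) \<and>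
     (\<forall>f\<in>C_inf M. \<forall>c. D (\<lambda>y. c * f y) = c * D f) \<and>
     (\<forall>f\<in>C_inf M. \<forall>g\<in>C_inf M. D (\<lambda>y. f y * g y) = f x * D g + g x * D f) \<and>
     (\<forall>f. f \<notin> C_inf M \<longrightarrow> D f = 0)}"

definition conj_tangent :: "'a ctangent \<Rightarrow> 'a ctangent" where
  "conj_tangent D = (\<lambda>f. cnj (D (\<lambda>y. cnj (f y))))"

definition pushforward :: "'a manifold \<Rightarrow> 'b manifold \<Rightarrow> ('a \<Rightarrow> 'b) \<Rightarrow> 'a ctangent \<Rightarrow> 'b ctangent" where
  "pushforward M N F D =
     (\<lambda>f. if f \<in> C_inf N then D (restrict0 (topspace (mtop M)) (\<lambda>y. f (F y))) else 0)"

definition smooth_vfield_on :: "'a manifold \<Rightarrow> 'a set \<Rightarrow> 'a vfield \<Rightarrow> bool" where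
  "smooth_vfield_on M W X \<longleftrightarrow>
     (\<forall>x\<in>W. X x \<in> ctangent_space M x) \<and> (\<forall>f\<in>C_inf M. smooth_fun_on M W (\<lambda>x. X x f))"

definition vfields :: "'a manifold \<Rightarrow> 'a vfield set" where
  "vfields M = {X. smooth_vfield_on M (topspace (mtop M)) X \<and>
     (\<forall>x. x \<notin> topspace (mtop M) \<longrightarrow> X x = (\<lambda>f. 0))}"

definition real_vfields :: "'a manifold \<Rightarrow> 'a vfield set" where
  "real_vfields M = {X \<in> vfields M. \<forall>x\<in>topspace (mtop M). conj_tangent (X x) = X x}"

definition lie_bracket :: "'a vfield \<Rightarrow> 'a vfield \<Rightarrow> 'a vfield" where
  "lie_bracket X Y = (\<lambda>x f. X x (\<lambda>y. Y y f) - Y x (\<lambda>y. X y f))"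

definition forms1 :: "'a manifold \<Rightarrow> 'a form1 set" where
  "forms1 M = {\<omega>.
     (\<forall>x\<in>topspace (mtop M).
        (\<forall>D\<in>ctangent_space M x. \<forall>E\<in>ctangent_space M x. \<omega> x (\<lambda>f. D f + E f) = \<omega> x D + \<omega> x E) \<and>
        (\<forall>D\<in>ctangent_space M x. \<forall>c. \<omega> x (\<lambda>f. c * D f) = c * \<omega> x D) \<and>
        (\<forall>D. D \<notin> ctangent_space M x \<longrightarrow> \<omega> x D = 0)) \<and>
     (\<forall>x. x \<notin> topspace (mtop M) \<longrightarrow> \<omega> x = (\<lambda>D. 0)) \<and>
     (\<forall>X\<in>vfields M. (\<lambda>x. \<omega> x (X x)) \<in> C_inf M)}"

text \<open>
  The complex scalar multiplications on tangent vectors and on vector fields, to be used as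
  arguments of the library's \<^const>\<open>module.span\<close> etc.
\<close>

definition tscale :: "complex \<Rightarrow> 'a ctangent \<Rightarrow> 'a ctangent" where
  "tscale c D = (\<lambda>f. c * D f)"

definition vscale :: "complex \<Rightarrow> 'a vfield \<Rightarrow> 'a vfield" where
  "vscale c X = (\<lambda>x f. c * X x f)"

lemma vector_space_tscale: "vector_space tscale"
  by unfold_locales (auto simp: tscale_def fun_eq_iff algebra_simps)

lemma vector_space_vscale: "vector_space vscale"
  by unfold_locales (auto simp: vscale_def fun_eq_iff algebra_simps)

definition is_basis ::
    "(complex \<Rightarrow> 'v::ab_group_add \<Rightarrow> 'v) \<Rightarrow> nat \<Rightarrow> (nat \<Rightarrow> 'v) \<Rightarrow> 'v set \<Rightarrow> bool" where
  "is_basis s n E S \<longleftrightarrow>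
     inj_on E {..<n} \<and> \<not> module.dependent s (E ` {..<n}) \<and>
     module.span s (E ` {..<n}) = S"


section \<open>Subbundles of the complexified tangent bundle\<close>

definition subbundle :: "'a manifold \<Rightarrow> nat \<Rightarrow> ('a \<Rightarrow> 'a ctangent set) \<Rightarrow> bool" where
  "subbundle M n V \<longleftrightarrow>
     (\<forall>x\<in>topspace (mtop M). V x \<subseteq> ctangent_space M x) \<and>
     (\<forall>p\<in>topspace (mtop M). \<exists>U E. openin (mtop M) U \<and> p \<in> U \<and>
        (\<forall>j<n. smooth_vfield_on M U (E j)) \<and>
        (\<forall>x\<in>U. is_basis tscale n (\<lambda>j. E j x) (V x)))"

definition sections :: "'a manifold \<Rightarrow> ('a \<Rightarrow> 'a ctangent set) \<Rightarrow> 'a vfield set" where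
  "sections M V = {X \<in> vfields M. \<forall>x\<in>topspace (mtop M). X x \<in> V x}"

definition involutive :: "'a manifold \<Rightarrow> ('a \<Rightarrow> 'a ctangent set) \<Rightarrow> bool" where
  "involutive M V \<longleftrightarrow> (\<forall>X\<in>sections M V. \<forall>Y\<in>sections M V. lie_bracket X Y \<in> sections M V)"

definition essentially_real :: "'a manifold \<Rightarrow> ('a \<Rightarrow> 'a ctangent set) \<Rightarrow> bool" where
  "essentially_real M V \<longleftrightarrow> (\<forall>x\<in>topspace (mtop M). conj_tangent ` V x = V x)"


section \<open>Lie groups\<close>

locale lie_group = group G + smooth_manifold M
  for G (structure) and M :: "'a manifold" +
  assumes topspace_carrier: "topspace (mtop M) = carrier G"
    and smooth_mult: "smooth_map (prod_manifold M M) M (\<lambda>(x, y). x \<otimes> y)"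
    and smooth_inv: "smooth_map M M (\<lambda>x. inv x)"

definition left_translate ::
    "('a, 'b) monoid_scheme \<Rightarrow> 'a manifold \<Rightarrow> 'a \<Rightarrow> 'a ctangent \<Rightarrow> 'a ctangent" where
  "left_translate G M x = pushforward M M (\<lambda>y. x \<otimes>\<^bsub>G\<^esub> y)"

definition left_invariant_bundle ::
    "('a, 'b) monoid_scheme \<Rightarrow> 'a manifold \<Rightarrow> ('a \<Rightarrow> 'a ctangent set) \<Rightarrow> bool" where
  "left_invariant_bundle G M V \<longleftrightarrow>
     (\<forall>x\<in>carrier G. \<forall>y\<in>carrier G. left_translate G M x ` V y \<subseteq> V (x \<otimes>\<^bsub>G\<^esub> y))"

definition complex_lie_algebra :: "('a, 'b) monoid_scheme \<Rightarrow> 'a manifold \<Rightarrow> 'a vfield set" where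
  "complex_lie_algebra G M = {X \<in> vfields M.
     \<forall>x\<in>carrier G. \<forall>y\<in>carrier G. left_translate G M x (X y) = X (x \<otimes>\<^bsub>G\<^esub> y)}"

definition lie_algebra :: "('a, 'b) monoid_scheme \<Rightarrow> 'a manifold \<Rightarrow> 'a vfield set" where
  "lie_algebra G M = complex_lie_algebra G M \<inter> real_vfields M"

definition left_invariant_sections ::
    "('a, 'b) monoid_scheme \<Rightarrow> 'a manifold \<Rightarrow> ('a \<Rightarrow> 'a ctangent set) \<Rightarrow> 'a vfield set" where
  "left_invariant_sections G M V = complex_lie_algebra G M \<inter> sections M V"

definition left_invariant_forms :: "('a, 'b) monoid_scheme \<Rightarrow> 'a manifold \<Rightarrow> 'a form1 set" where
  "left_invariant_forms G M = {\<omega> \<in> forms1 M.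
     \<forall>x\<in>carrier G. \<forall>y\<in>carrier G. \<forall>D\<in>ctangent_space M y.
       \<omega> (x \<otimes>\<^bsub>G\<^esub> y) (left_translate G M x D) = \<omega> y D}"

definition real_lie_subalgebra ::
    "('a, 'b) monoid_scheme \<Rightarrow> 'a manifold \<Rightarrow> 'a vfield set \<Rightarrow> bool" where
  "real_lie_subalgebra G M h \<longleftrightarrow>
     h \<subseteq> lie_algebra G M \<and> 0 \<in> h \<and>
     (\<forall>X\<in>h. \<forall>Y\<in>h. X + Y \<in> h) \<and>
     (\<forall>X\<in>h. \<forall>r::real. vscale (complex_of_real r) X \<in> h) \<and>
     (\<forall>X\<in>h. \<forall>Y\<in>h. lie_bracket X Y \<in> h)"

definition complexification :: "'a vfield set \<Rightarrow> 'a vfield set" where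
  "complexification h = {X + vscale \<i> Y | X Y. X \<in> h \<and> Y \<in> h}"

text \<open>
  The connected (immersed) Lie subgroup with Lie algebra \<open>h\<close>. Its own Lie group structure \<open>N\<close>
  may have a finer topology than the subspace topology. The Lie algebra of \<open>H\<close>
  is identified with a subalgebra of that of \<open>G\<close> by the differential of the inclusion, each
  left-invariant field on \<open>H\<close> corresponding to the left-invariant field on \<open>G\<close> extending it.
\<close>

definition connected_integral_subgroup ::
    "('a, 'b) monoid_scheme \<Rightarrow> 'a manifold \<Rightarrow> 'a vfield set \<Rightarrow> 'a set \<Rightarrow> bool" where
  "connected_integral_subgroup G M h H \<longleftrightarrow>
     subgroup H G \<and>
     (\<exists>N. lie_group (G\<lparr>carrier := H\<rparr>) N \<and> connected_space (mtop N) \<and>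
        smooth_map N M (\<lambda>x. x) \<and>
        (\<forall>x\<in>H. inj_on (pushforward N M (\<lambda>x. x)) (ctangent_space N x)) \<and>
        h = {X \<in> lie_algebra G M. \<exists>Y\<in>lie_algebra (G\<lparr>carrier := H\<rparr>) N.
               \<forall>x\<in>H. pushforward N M (\<lambda>x. x) (Y x) = X x})"


section \<open>The operator on functions\<close>

text \<open>
  \<open>\<tau>\<^sub>0, \<dots>, \<tau>\<^sub>n\<^sub>-\<^sub>1, \<zeta>\<^sub>0, \<dots>, \<zeta>\<^sub>m\<^sub>-\<^sub>1\<close> is the basis of left-invariant 1-forms dual to
  \<open>L\<^sub>0, \<dots>, L\<^sub>n\<^sub>-\<^sub>1, P\<^sub>0, \<dots>, P\<^sub>m\<^sub>-\<^sub>1\<close>.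
\<close>

definition dual_frame ::
    "('a, 'b) monoid_scheme \<Rightarrow> 'a manifold \<Rightarrow> nat \<Rightarrow> nat \<Rightarrow> (nat \<Rightarrow> 'a vfield) \<Rightarrow> (nat \<Rightarrow> 'a vfield) \<Rightarrow>
     (nat \<Rightarrow> 'a form1) \<Rightarrow> (nat \<Rightarrow> 'a form1) \<Rightarrow> bool" where
  "dual_frame G M n m L P \<tau> \<zeta> \<longleftrightarrow>
     (\<forall>j<n. \<tau> j \<in> left_invariant_forms G M) \<and> (\<forall>j<m. \<zeta> j \<in> left_invariant_forms G M) \<and>
     (\<forall>x\<in>carrier G.
        (\<forall>j<n. \<forall>k<n. \<tau> j x (L k x) = (if j = k then 1 else 0)) \<and>
        (\<forall>j<n. \<forall>k<m. \<tau> j x (P k x) = 0) \<and>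
        (\<forall>j<m. \<forall>k<n. \<zeta> j x (L k x) = 0) \<and>
        (\<forall>j<m. \<forall>k<m. \<zeta> j x (P k x) = (if j = k then 1 else 0)))"

definition combine_forms :: "nat \<Rightarrow> (nat \<Rightarrow> 'a form1) \<Rightarrow> (nat \<Rightarrow> 'a \<Rightarrow> complex) \<Rightarrow> 'a form1" where
  "combine_forms n \<tau> u = (\<lambda>x D. \<Sum>j<n. u j x * \<tau> j x D)"

definition underline_forms :: "'a manifold \<Rightarrow> nat \<Rightarrow> (nat \<Rightarrow> 'a form1) \<Rightarrow> 'a form1 set" where
  "underline_forms M n \<tau> = {combine_forms n \<tau> u | u. \<forall>j<n. u j \<in> C_inf M}"

text \<open>
  The coefficients of \<open>\<omega> = \<Sum>\<^sub>j u\<^sub>j \<tau>\<^sub>j\<close> are recovered as \<open>u\<^sub>j = \<omega>(L\<^sub>j)\<close>.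
  The topology is that of \<open>C\<^sup>\<infinity>\<close> convergence of the coefficients.
\<close>

definition underline_topology ::
    "'a manifold \<Rightarrow> nat \<Rightarrow> (nat \<Rightarrow> 'a vfield) \<Rightarrow> (nat \<Rightarrow> 'a form1) \<Rightarrow> 'a form1 topology" where
  "underline_topology M n L \<tau> =
     pullback_topology (underline_forms M n \<tau>) (\<lambda>\<omega>. \<lambda>j\<in>{..<n}. \<lambda>x. \<omega> x (L j x))
       (product_topology (\<lambda>_. C_inf_topology M) {..<n})"

definition d_prime ::
    "nat \<Rightarrow> (nat \<Rightarrow> 'a vfield) \<Rightarrow> (nat \<Rightarrow> 'a form1) \<Rightarrow> ('a \<Rightarrow> complex) \<Rightarrow> 'a form1" where
  "d_prime n L \<tau> f = combine_forms n \<tau> (\<lambda>j x. L j x f)"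

end

theory Submission
  imports Defs
begin

text \<open>
  Let \<open>\<kappa>\<close> be the inverse of a chart of \<open>H\<close> at the identity and \<open>X\<^sub>i\<close> the left-invariant field
  \<open>X\<^sub>i f x = \<partial>\<^sub>i (f (x \<kappa>(q)))\<close>. Every \<open>X\<^sub>i\<close> is a combination of the \<open>L\<^sub>j\<close> because it lies in \<open>h\<close>, and every
  \<open>L\<^sub>j\<close> is a combination of the \<open>X\<^sub>i\<close> because derivations are combinations of partial derivatives.
  If \<open>d' f\<^sub>k\<close> converges, then so does \<open>X\<^sub>i f\<^sub>k\<close>, uniformly and with smooth limits \<open>v\<^sub>i\<close>.

  By the mean value inequality and compactness of \<open>H\<close>, the increments \<open>f\<^sub>k (x h) - f\<^sub>k x\<close> with
  \<open>h \<in> H\<close> are bounded by a fixed multiple of \<open>X\<^sub>i f\<^sub>k\<close>. Subtract from \<open>f\<^sub>k\<close> its average over the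
  right translates by a fine finite net of \<open>H\<close>. For nets of minimal cardinality the marriage theorem
  makes this average almost constant along the cosets \<open>x H\<close>, so that no Haar measure is needed. The
  normalised functions are bounded, hence have a pointwise cluster point \<open>g\<close>, and
  \<open>g (x h) - g x = lim (f\<^sub>k (x h) - f\<^sub>k x)\<close>.

  Smoothness of \<open>g\<close> comes for free: every finite linear combination of values of \<open>g\<close> is bounded by
  a constant times the supremum of the same combination for the right translates of the \<open>v\<^sub>i\<close> by \<open>H\<close>.
  These translates have locally uniform bounds for all derivatives. Applied to difference quotients,
  the domination passes to all derivatives of \<open>g\<close>. So \<open>X\<^sub>i g = v\<^sub>i\<close> with \<open>g\<close> smooth.
\<close>

section \<open>Calculus on Euclidean space\<close>

abbreviation ES :: "nat \<Rightarrow> (nat \<Rightarrow> real) set" where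
  "ES d \<equiv> topspace (Euclidean_space d)"

abbreviation open_ES :: "nat \<Rightarrow> (nat \<Rightarrow> real) set \<Rightarrow> bool" where
  "open_ES d W \<equiv> openin (Euclidean_space d) W"

definition ebox :: "nat \<Rightarrow> (nat \<Rightarrow> real) \<Rightarrow> real \<Rightarrow> (nat \<Rightarrow> real) set" where
  "ebox d x r = {y \<in> ES d. \<forall>i<d. \<bar>y i - x i\<bar> < r}"

lemma in_ES_iff: "x \<in> ES d \<longleftrightarrow> (\<forall>i\<ge>d. x i = 0)"
  by (simp add: topspace_Euclidean_space)

lemma ebox_subset_ES: "ebox d x r \<subseteq> ES d"
  by (auto simp: ebox_def)

lemma ebox_mono: "r \<le> s \<Longrightarrow> ebox d x r \<subseteq> ebox d x s"
  by (force simp: ebox_def)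

lemma centre_in_ebox: "x \<in> ES d \<Longrightarrow> 0 < r \<Longrightarrow> x \<in> ebox d x r"
  by (simp add: ebox_def)

lemma finite_min_pos:
  fixes f :: "'i \<Rightarrow> real"
  assumes "finite I" "\<And>i. i \<in> I \<Longrightarrow> 0 < f i"
  obtains r where "0 < r" "\<And>i. i \<in> I \<Longrightarrow> r \<le> f i"
proof
  show "0 < Min (insert 1 (f ` I))" using assms by (subst Min_gr_iff) auto
  show "\<And>i. i \<in> I \<Longrightarrow> Min (insert 1 (f ` I)) \<le> f i" using assms by (intro Min_le) auto
qed

lemma open_ES_alt: "open_ES d W \<longleftrightarrow> (\<exists>T. openin (powertop_real UNIV) T \<and> W = T \<inter> ES d)"
  by (simp add: Euclidean_space_def openin_subtopology)

lemma open_ES_ebox: "open_ES d (ebox d x r)"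
proof -
  define U where "U = (\<lambda>i. if i < d then {x i - r<..<x i + r} else UNIV)"
  have "finite {i. U i \<noteq> UNIV}"
    by (rule finite_subset[of _ "{..<d}"]) (auto simp: U_def)
  then have "openin (powertop_real UNIV) (Pi\<^sub>E UNIV U)"
    by (auto simp: openin_PiE_gen U_def)
  moreover have "ebox d x r = Pi\<^sub>E UNIV U \<inter> ES d"
  proof (intro Set.set_eqI iffI)
    fix y assume "y \<in> ebox d x r"
    then show "y \<in> Pi\<^sub>E UNIV U \<inter> ES d" by (auto simp: ebox_def U_def abs_less_iff algebra_simps)
  next
    fix y assume y: "y \<in> Pi\<^sub>E UNIV U \<inter> ES d"
    have "\<bar>y i - x i\<bar> < r" if "i < d" for i
      using PiE_mem[of y UNIV U i] y that by (simp add: U_def abs_less_iff)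
    then show "y \<in> ebox d x r" using y by (simp add: ebox_def)
  qed
  ultimately show ?thesis
    unfolding open_ES_alt by blast
qed

lemma open_ES_iff:
  "open_ES d W \<longleftrightarrow> W \<subseteq> ES d \<and> (\<forall>x\<in>W. \<exists>r>0. ebox d x r \<subseteq> W)"
proof (intro iffI conjI ballI)
  assume W: "open_ES d W"
  then show "W \<subseteq> ES d" by (rule openin_subset)
  fix x assume x: "x \<in> W"
  obtain T where T: "openin (powertop_real UNIV) T" "W = T \<inter> ES d"
    using W unfolding open_ES_alt by blast
  have "x \<in> T" using T(2) x by blast
  then obtain U where U': "\<forall>i\<in>UNIV. openin euclideanreal (U i)" "x \<in> Pi\<^sub>E UNIV U" "Pi\<^sub>E UNIV U \<subseteq> T"
    using T(1) unfolding openin_product_topology_alt by metis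
  then have U: "\<And>i. open (U i)" "x \<in> Pi\<^sub>E UNIV U" "Pi\<^sub>E UNIV U \<subseteq> T" by auto
  have "\<exists>e>0. ball (x i) e \<subseteq> U i" for i
    using U(1)[of i] U(2) by (meson PiE_mem UNIV_I openE)
  then obtain e where e: "\<And>i. 0 < e i" "\<And>i. ball (x i) (e i) \<subseteq> U i" by metis
  obtain r where r: "0 < r" "\<And>i. i \<in> {..<d} \<Longrightarrow> r \<le> e i"
    using finite_min_pos[of "{..<d}" e] e by blast
  have "ebox d x r \<subseteq> W"
  proof
    fix y assume y: "y \<in> ebox d x r"
    have "y i \<in> U i" for i
    proof (cases "i < d")
      case True
      then have "\<bar>y i - x i\<bar> < e i" using y r(2)[of i] by (force simp: ebox_def)
      then show ?thesis using e(2)[of i] by (force simp: dist_real_def)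
    next
      case False
      then have "y i = x i" using y x T(2) by (auto simp: ebox_def in_ES_iff)
      then show ?thesis using U(2) by auto
    qed
    then show "y \<in> W" using y U(3) T(2) ebox_subset_ES by fastforce
  qed
  with r(1) show "\<exists>r>0. ebox d x r \<subseteq> W" by (intro exI[of _ r] conjI)
next
  assume W: "W \<subseteq> ES d \<and> (\<forall>x\<in>W. \<exists>r>0. ebox d x r \<subseteq> W)"
  show "open_ES d W"
  proof (subst openin_subopen, rule ballI)
    fix x assume x: "x \<in> W"
    then obtain r where r: "r > 0" "ebox d x r \<subseteq> W" using W by meson
    have "x \<in> ebox d x r" using W x r by (auto intro: centre_in_ebox)
    with r open_ES_ebox[of d x r] show "\<exists>T. open_ES d T \<and> x \<in> T \<and> T \<subseteq> W"
      by (intro exI[of _ "ebox d x r"] conjI)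
  qed
qed

lemma upd_in_ES: "x \<in> ES d \<Longrightarrow> i < d \<Longrightarrow> x(i := t) \<in> ES d"
  by (auto simp: in_ES_iff)

lemma upd_in_ebox: "x \<in> ES d \<Longrightarrow> i < d \<Longrightarrow> 0 < r \<Longrightarrow> \<bar>t - x i\<bar> < r \<Longrightarrow> x(i := t) \<in> ebox d x r"
  by (auto simp: ebox_def upd_in_ES)

lemma upd_in_open:
  assumes "open_ES d W" "x \<in> W" "i < d"
  obtains r where "0 < r" "\<And>t. \<bar>t - x i\<bar> < r \<Longrightarrow> x(i := t) \<in> W"
  using assms upd_in_ebox unfolding open_ES_iff by (metis subsetD)

definition cont_ES :: "nat \<Rightarrow> (nat \<Rightarrow> real) set \<Rightarrow> ((nat \<Rightarrow> real) \<Rightarrow> 'b::metric_space) \<Rightarrow> bool" where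
  "cont_ES d W f \<longleftrightarrow> (\<forall>x\<in>W. \<forall>e>0. \<exists>r>0. \<forall>y\<in>ebox d x r. y \<in> W \<and> dist (f y) (f x) < e)"

lemma continuous_map_ES_iff:
  fixes f :: "(nat \<Rightarrow> real) \<Rightarrow> 'b::metric_space"
  assumes W: "open_ES d W"
  shows "continuous_map (subtopology (Euclidean_space d) W) euclidean f \<longleftrightarrow> cont_ES d W f"
proof
  assume c: "continuous_map (subtopology (Euclidean_space d) W) euclidean f"
  show "cont_ES d W f"
    unfolding cont_ES_def
  proof (intro ballI allI impI)
    fix x and e :: real assume x: "x \<in> W" and e: "0 < e"
    have "openin (subtopology (Euclidean_space d) W) {y \<in> topspace (subtopology (Euclidean_space d) W). f y \<in> ball (f x) e}"
      by (rule openin_continuous_map_preimage[OF c]) simp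
    moreover have "topspace (subtopology (Euclidean_space d) W) = W"
      using openin_subset[OF W] by auto
    ultimately have "open_ES d {y \<in> W. f y \<in> ball (f x) e}"
      using W by (simp del: topspace_subtopology add: openin_open_subtopology)
    moreover have "x \<in> {y \<in> W. f y \<in> ball (f x) e}" using x e by simp
    ultimately obtain r where "r > 0" "ebox d x r \<subseteq> {y \<in> W. f y \<in> ball (f x) e}"
      unfolding open_ES_iff by meson
    then show "\<exists>r>0. \<forall>y\<in>ebox d x r. y \<in> W \<and> dist (f y) (f x) < e"
      by (intro exI[of _ r]) (auto simp: dist_commute)
  qed
next
  assume c: "cont_ES d W f"
  have ts: "topspace (subtopology (Euclidean_space d) W) = W"
      using openin_subset[OF W] by auto
  show "continuous_map (subtopology (Euclidean_space d) W) euclidean f"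
    unfolding continuous_map_def
  proof (intro conjI allI impI)
    fix U :: "'b set" assume "openin euclidean U"
    then have U: "open U" by simp
    have "open_ES d {x \<in> W. f x \<in> U}"
      unfolding open_ES_iff
    proof (intro conjI ballI)
      show "{x \<in> W. f x \<in> U} \<subseteq> ES d" using openin_subset[OF W] by auto
      fix x assume x: "x \<in> {x \<in> W. f x \<in> U}"
      then obtain e where e: "e > 0" "ball (f x) e \<subseteq> U" using U openE by auto
      then obtain r where "r > 0" "\<forall>y\<in>ebox d x r. y \<in> W \<and> dist (f y) (f x) < e"
        using c x unfolding cont_ES_def by blast
      then show "\<exists>r>0. ebox d x r \<subseteq> {x \<in> W. f x \<in> U}"
        using e by (intro exI[of _ r]) (auto simp: dist_commute subset_iff)
    qed
    then show "openin (subtopology (Euclidean_space d) W) {x \<in> topspace (subtopology (Euclidean_space d) W). f x \<in> U}"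
      unfolding ts using W by (simp del: topspace_subtopology add: openin_open_subtopology)
  qed auto
qed

lemma cont_ES_D:
  assumes "cont_ES d W f" "x \<in> W" "0 < e"
  obtains r where "0 < r" "\<And>y. y \<in> ebox d x r \<Longrightarrow> y \<in> W" "\<And>y. y \<in> ebox d x r \<Longrightarrow> dist (f y) (f x) < e"
  using assms unfolding cont_ES_def by blast

lemma iter_partial_append: "iter_partial (ks @ ls) f = iter_partial ks (iter_partial ls f)"
  by (induction ks) auto

abbreviation has_partial :: "nat \<Rightarrow> ((nat \<Rightarrow> real) \<Rightarrow> 'b::real_normed_vector) \<Rightarrow> 'b \<Rightarrow> (nat \<Rightarrow> real) \<Rightarrow> bool" where
  "has_partial i f D x \<equiv> ((\<lambda>t. f (x(i := t))) has_vector_derivative D) (at (x i))"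

lemma has_partial_imp: "has_partial i f D x \<Longrightarrow> partial_deriv i f x = D"
  by (simp add: partial_deriv_def vector_derivative_at)

lemma has_partial_partial_deriv:
  "(\<lambda>t. f (x(i := t))) differentiable (at (x i)) \<Longrightarrow> has_partial i f (partial_deriv i f x) x"
  by (simp add: partial_deriv_def vector_derivative_works)

lemma has_partial_differentiable:
  "has_partial i f D x \<Longrightarrow> (\<lambda>t. f (x(i := t))) differentiable (at (x i))"
  by (simp add: differentiableI_vector)

lemma has_partial_cong:
  assumes W: "open_ES d W" "x \<in> W" "i < d" and eq: "\<And>y. y \<in> W \<Longrightarrow> f y = g y"
  shows "has_partial i f D x \<longleftrightarrow> has_partial i g D x"
proof -
  obtain r where r: "0 < r" "\<And>t. \<bar>t - x i\<bar> < r \<Longrightarrow> x(i := t) \<in> W"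
    using upd_in_open[OF W] by blast
  have ev: "\<And>t. t \<in> ball (x i) r \<Longrightarrow> f (x(i := t)) = g (x(i := t))"
    using r(2) eq by (metis dist_commute dist_real_def mem_ball)
  show ?thesis
    using has_vector_derivative_transform_within_open[OF _ open_ball, of "\<lambda>t. f (x(i := t))" D "x i" "x i" r "\<lambda>t. g (x(i := t))"]
      has_vector_derivative_transform_within_open[OF _ open_ball, of "\<lambda>t. g (x(i := t))" D "x i" "x i" r "\<lambda>t. f (x(i := t))"]
      ev r(1) by auto
qed

lemma partial_deriv_cong:
  assumes W: "open_ES d W" "x \<in> W" "i < d" and eq: "\<And>y. y \<in> W \<Longrightarrow> f y = g y"
  shows "partial_deriv i f x = partial_deriv i g x"
  using has_partial_cong[OF W, where f = f and g = g, OF eq] unfolding partial_deriv_def vector_derivative_def by simp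

lemma iter_partial_cong:
  assumes W: "open_ES d W" and "set ks \<subseteq> {..<d}" and eq: "\<And>y. y \<in> W \<Longrightarrow> f y = g y" and "x \<in> W"
  shows "iter_partial ks f x = iter_partial ks g x"
  using assms(2,4)
proof (induction ks arbitrary: x)
  case (Cons i ks)
  then show ?case using partial_deriv_cong[OF W, of x i "iter_partial ks f" "iter_partial ks g"] by auto
qed (use eq in simp)

fun Ck_on :: "nat \<Rightarrow> (nat \<Rightarrow> real) set \<Rightarrow> nat \<Rightarrow> ((nat \<Rightarrow> real) \<Rightarrow> 'b::real_normed_vector) \<Rightarrow> bool" where
  "Ck_on d W 0 f \<longleftrightarrow> cont_ES d W f"
| "Ck_on d W (Suc k) f \<longleftrightarrow> cont_ES d W f \<and> (\<forall>i<d. \<exists>g. Ck_on d W k g \<and> (\<forall>x\<in>W. has_partial i f (g x) x))"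

lemma cont_ES_cong: "(\<And>y. y \<in> W \<Longrightarrow> f y = g y) \<Longrightarrow> cont_ES d W f \<longleftrightarrow> cont_ES d W g"
  unfolding cont_ES_def by (metis (no_types, lifting))

lemma Ck_on_cong:
  assumes W: "open_ES d W" and eq: "\<And>y. y \<in> W \<Longrightarrow> f y = g y" and f: "Ck_on d W k f"
  shows "Ck_on d W k g"
proof (cases k)
  case 0
  then show ?thesis using f eq cont_ES_cong[of W f g d] by simp
next
  case (Suc n)
  have "has_partial i f D x \<longleftrightarrow> has_partial i g D x" if "i < d" "x \<in> W" for i x D
    by (rule has_partial_cong[OF W that(2,1) eq])
  then show ?thesis using f eq cont_ES_cong[of W f g d] Suc by auto
qed

lemma Ck_on_SucD: "Ck_on d W (Suc k) f \<Longrightarrow> Ck_on d W k f"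
proof (induction k arbitrary: f)
  case (Suc k)
  then show ?case by (metis Ck_on.simps(2))
qed simp

lemma Ck_on_cont: "Ck_on d W k f \<Longrightarrow> cont_ES d W f"
  by (cases k) auto

lemma smooth_on_open_unfold:
  "smooth_on_open d W f \<longleftrightarrow> continuous_map (subtopology (Euclidean_space d) W) euclidean f \<and>
    (\<forall>i<d. (\<forall>x\<in>W. (\<lambda>t. f (x(i := t))) differentiable (at (x i))) \<and> smooth_on_open d W (partial_deriv i f))"
    (is "?L \<longleftrightarrow> ?R")
proof
  assume ?L
  have "continuous_map (subtopology (Euclidean_space d) W) euclidean f \<and>
        (\<forall>x\<in>W. \<forall>i<d. (\<lambda>t. f (x(i := t))) differentiable (at (x i)))"
    using \<open>?L\<close>[unfolded smooth_on_open_def, rule_format, of "[]"] by simp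
  moreover have "smooth_on_open d W (partial_deriv i f)" if "i < d" for i
    unfolding smooth_on_open_def
    using \<open>?L\<close>[unfolded smooth_on_open_def, rule_format, of "_ @ [i]"] that
    by (simp add: iter_partial_append)
  ultimately show ?R by blast
next
  assume R: ?R
  show ?L
    unfolding smooth_on_open_def
  proof (intro allI impI)
    fix ks assume ks: "set ks \<subseteq> {..<d}"
    show "continuous_map (subtopology (Euclidean_space d) W) euclidean (iter_partial ks f) \<and>
        (\<forall>x\<in>W. \<forall>i<d. (\<lambda>t. iter_partial ks f (x(i := t))) differentiable (at (x i)))"
    proof (cases ks rule: rev_cases)
      case Nil
      then show ?thesis using R by simp
    next
      case (snoc ls i)
      then have "smooth_on_open d W (partial_deriv i f)" "set ls \<subseteq> {..<d}" using R ks by auto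
      then show ?thesis unfolding smooth_on_open_def snoc by (simp add: iter_partial_append)
    qed
  qed
qed

lemma smooth_has_partial:
  "smooth_on_open d W f \<Longrightarrow> i < d \<Longrightarrow> x \<in> W \<Longrightarrow> has_partial i f (partial_deriv i f x) x"
  by (intro has_partial_partial_deriv) (subst (asm) smooth_on_open_unfold, blast)

lemma smooth_partial_deriv: "smooth_on_open d W f \<Longrightarrow> i < d \<Longrightarrow> smooth_on_open d W (partial_deriv i f)"
  by (subst (asm) smooth_on_open_unfold, blast)

lemma smooth_iter_partial:
  "smooth_on_open d W f \<Longrightarrow> set ks \<subseteq> {..<d} \<Longrightarrow> smooth_on_open d W (iter_partial ks f)"
  by (induction ks) (auto intro: smooth_partial_deriv)

lemma smooth_cont: "open_ES d W \<Longrightarrow> smooth_on_open d W f \<Longrightarrow> cont_ES d W f"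
  by (subst (asm) smooth_on_open_unfold) (simp add: continuous_map_ES_iff)

lemma Ck_on_iter_partial:
  assumes W: "open_ES d W"
  shows "Ck_on d W (length ks + n) f \<Longrightarrow> set ks \<subseteq> {..<d} \<Longrightarrow> Ck_on d W n (iter_partial ks f)"
proof (induction ks arbitrary: n)
  case (Cons i ks)
  then have "Ck_on d W (length ks + Suc n) f" "set ks \<subseteq> {..<d}" by auto
  then have "Ck_on d W (Suc n) (iter_partial ks f)" by (rule Cons.IH)
  then obtain g where g: "Ck_on d W n g" "\<forall>x\<in>W. has_partial i (iter_partial ks f) (g x) x"
    using Cons by auto
  have "\<And>x. x \<in> W \<Longrightarrow> g x = partial_deriv i (iter_partial ks f) x"
    using g(2) has_partial_imp by metis
  then show ?case using Ck_on_cong[OF W _ g(1)] by simp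
qed simp

lemma smooth_on_open_iff_Ck:
  assumes W: "open_ES d W"
  shows "smooth_on_open d W f \<longleftrightarrow> (\<forall>k. Ck_on d W k f)"
proof
  assume "smooth_on_open d W f"
  then show "\<forall>k. Ck_on d W k f"
  proof (intro allI)
    fix k assume "smooth_on_open d W f"
    then show "Ck_on d W k f"
    proof (induction k arbitrary: f)
      case (Suc k)
      then show ?case
        using smooth_cont[OF W] smooth_partial_deriv smooth_has_partial by (metis Ck_on.simps(2))
    qed (use smooth_cont[OF W] in simp)
  qed
next
  assume *: "\<forall>k. Ck_on d W k f"
  show "smooth_on_open d W f"
    unfolding smooth_on_open_def
  proof (intro allI impI)
    fix ks assume "set ks \<subseteq> {..<d}"
    then have "Ck_on d W (Suc 0) (iter_partial ks f)"
      using Ck_on_iter_partial[OF W, of ks "Suc 0" f] * by blast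
    then show "continuous_map (subtopology (Euclidean_space d) W) euclidean (iter_partial ks f) \<and>
        (\<forall>x\<in>W. \<forall>i<d. (\<lambda>t. iter_partial ks f (x(i := t))) differentiable (at (x i)))"
      using continuous_map_ES_iff[OF W] has_partial_differentiable by (metis Ck_on.simps(2))
  qed
qed

lemma smooth_on_open_cong:
  assumes "open_ES d W" "\<And>y. y \<in> W \<Longrightarrow> f y = g y" "smooth_on_open d W f"
  shows "smooth_on_open d W g"
  using assms smooth_on_open_iff_Ck Ck_on_cong by metis

lemma cont_ES_local:
  assumes "\<And>x. x \<in> W \<Longrightarrow> \<exists>V. x \<in> V \<and> V \<subseteq> W \<and> cont_ES d V f"
  shows "cont_ES d W f"
  unfolding cont_ES_def
proof (intro ballI allI impI)
  fix x and e :: real assume "x \<in> W" "0 < e"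
  then obtain V where V: "x \<in> V" "V \<subseteq> W" "cont_ES d V f" using assms by blast
  then obtain r where "0 < r" "\<forall>y\<in>ebox d x r. y \<in> V \<and> dist (f y) (f x) < e"
    using \<open>0 < e\<close> unfolding cont_ES_def by blast
  then show "\<exists>r>0. \<forall>y\<in>ebox d x r. y \<in> W \<and> dist (f y) (f x) < e"
    using V(2) by blast
qed

lemma cont_ES_subset: "cont_ES d W f \<Longrightarrow> open_ES d V \<Longrightarrow> V \<subseteq> W \<Longrightarrow> cont_ES d V f"
  unfolding cont_ES_def
proof (intro ballI allI impI)
  fix x and e :: real assume *: "\<forall>x\<in>W. \<forall>e>0. \<exists>r>0. \<forall>y\<in>ebox d x r. y \<in> W \<and> dist (f y) (f x) < e"
    "open_ES d V" "V \<subseteq> W" "x \<in> V" "0 < e"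
  then obtain r where r: "0 < r" "\<forall>y\<in>ebox d x r. y \<in> W \<and> dist (f y) (f x) < e" by blast
  obtain s where s: "0 < s" "ebox d x s \<subseteq> V" using * unfolding open_ES_iff by blast
  show "\<exists>r>0. \<forall>y\<in>ebox d x r. y \<in> V \<and> dist (f y) (f x) < e"
    using r s ebox_mono[of "min r s" r d x] ebox_mono[of "min r s" s d x] by (intro exI[of _ "min r s"]) auto
qed

lemma smooth_on_open_subset:
  assumes "open_ES d W" "open_ES d V" "V \<subseteq> W" "smooth_on_open d W f"
  shows "smooth_on_open d V f"
proof -
  have "Ck_on d V k f" if "Ck_on d W k f" for k
    using that by (induction k arbitrary: f) (use cont_ES_subset[OF _ assms(2,3)] assms(3) in \<open>auto simp: subset_iff\<close>, meson)
  then show ?thesis using assms smooth_on_open_iff_Ck by metis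
qed

lemma smooth_on_open_local:
  assumes W: "open_ES d W" and loc: "\<And>x. x \<in> W \<Longrightarrow> \<exists>V. open_ES d V \<and> x \<in> V \<and> V \<subseteq> W \<and> smooth_on_open d V f"
  shows "smooth_on_open d W f"
  unfolding smooth_on_open_def
proof (intro allI impI)
  fix ks assume ks: "set ks \<subseteq> {..<d}"
  have "cont_ES d W (iter_partial ks f)"
    using cont_ES_local loc smooth_cont smooth_iter_partial[OF _ ks] by meson
  moreover have "(\<lambda>t. iter_partial ks f (x(i := t))) differentiable (at (x i))" if "x \<in> W" "i < d" for x i
    using loc[OF that(1)] ks that unfolding smooth_on_open_def by blast
  ultimately show "continuous_map (subtopology (Euclidean_space d) W) euclidean (iter_partial ks f) \<and>
        (\<forall>x\<in>W. \<forall>i<d. (\<lambda>t. iter_partial ks f (x(i := t))) differentiable (at (x i)))"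
    using continuous_map_ES_iff[OF W] by blast
qed

text \<open>Coordinates are changed one at a time; each change is controlled by the mean value inequality.\<close>

lemma partial_increment_bound:
  fixes f :: "(nat \<Rightarrow> real) \<Rightarrow> 'b::real_normed_vector"
  assumes x: "x \<in> ES d" and y: "y \<in> ebox d x r"
    and D: "\<And>z k. z \<in> ebox d x r \<Longrightarrow> k < d \<Longrightarrow> has_partial k f (f' k z) z"
    and B: "\<And>z k. z \<in> ebox d x r \<Longrightarrow> k < d \<Longrightarrow> norm (f' k z - a k) \<le> M"
  shows "norm (f y - f x - (\<Sum>k<d. (y k - x k) *\<^sub>R a k)) \<le> M * (\<Sum>k<d. \<bar>y k - x k\<bar>)"
proof -
  define z where "z = (\<lambda>m i. if i < m then y i else x i)"
  have zd: "z d = y"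
    using x y by (auto simp: z_def ebox_def in_ES_iff fun_eq_iff)
  have z0: "z 0 = x" by (simp add: z_def)
  have zS: "z (Suc m) = (z m)(m := y m)" for m
    by (auto simp: z_def fun_eq_iff less_Suc_eq)
  have "norm (f (z m) - f x - (\<Sum>k<m. (y k - x k) *\<^sub>R a k)) \<le> M * (\<Sum>k<m. \<bar>y k - x k\<bar>)" if "m \<le> d" for m
    using that
  proof (induction m)
    case 0
    then show ?case by (simp add: z0)
  next
    case (Suc m)
    let ?S = "closed_segment (x m) (y m)"
    have in_box: "(z m)(m := t) \<in> ebox d x r" if t: "t \<in> ?S" for t
    proof -
      have "\<bar>t - x m\<bar> \<le> \<bar>y m - x m\<bar>"
        using t by (auto simp: closed_segment_eq_real_ivl split: if_splits)
      then show ?thesis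
        using x y Suc.prems by (auto simp: ebox_def z_def in_ES_iff intro: le_less_trans)
    qed
    have der: "((\<lambda>s. f ((z m)(m := s)) - s *\<^sub>R a m) has_derivative (\<lambda>h. h *\<^sub>R (f' m ((z m)(m := t)) - a m))) (at t within ?S)"
      if t: "t \<in> ?S" for t
    proof -
      have "((\<lambda>s. f ((z m)(m := s))) has_vector_derivative f' m ((z m)(m := t))) (at t)"
        using D[OF in_box[OF t], of m] Suc.prems by simp
      then have "((\<lambda>s. f ((z m)(m := s)) - s *\<^sub>R a m) has_vector_derivative (f' m ((z m)(m := t)) - a m)) (at t)"
        by (auto intro!: derivative_eq_intros)
      then show ?thesis
        unfolding has_vector_derivative_def by (rule has_derivative_at_withinI)
    qed
    have "norm ((f ((z m)(m := y m)) - y m *\<^sub>R a m) - (f ((z m)(m := x m)) - x m *\<^sub>R a m)) \<le> M * norm (y m - x m)"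
    proof (rule differentiable_bound[OF convex_closed_segment der])
      fix t assume "t \<in> ?S"
      then show "onorm (\<lambda>h. h *\<^sub>R (f' m ((z m)(m := t)) - a m)) \<le> M"
        using B[OF in_box] Suc.prems
        by (subst onorm_scaleR_left) (auto simp: onorm_id bounded_linear_ident)
    qed auto
    moreover have "(z m)(m := x m) = z m" by (auto simp: z_def)
    ultimately have "norm (f (z (Suc m)) - f (z m) - (y m - x m) *\<^sub>R a m) \<le> M * \<bar>y m - x m\<bar>"
      by (simp add: zS algebra_simps)
    moreover have "f (z (Suc m)) - f x - (\<Sum>k<Suc m. (y k - x k) *\<^sub>R a k) =
       (f (z m) - f x - (\<Sum>k<m. (y k - x k) *\<^sub>R a k)) + (f (z (Suc m)) - f (z m) - (y m - x m) *\<^sub>R a m)"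
      by simp
    ultimately show ?case
      using Suc.IH Suc.prems norm_triangle_ineq[of "f (z m) - f x - (\<Sum>k<m. (y k - x k) *\<^sub>R a k)"
          "f (z (Suc m)) - f (z m) - (y m - x m) *\<^sub>R a m"]
      by (simp add: algebra_simps)
  qed
  then show ?thesis using zd by blast
qed

lemma chain_rule_ES:
  fixes f :: "(nat \<Rightarrow> real) \<Rightarrow> 'b::real_normed_vector" and \<gamma> :: "real \<Rightarrow> nat \<Rightarrow> real"
  assumes W: "open_ES m W"
    and D: "\<And>z k. z \<in> W \<Longrightarrow> k < m \<Longrightarrow> has_partial k f (f' k z) z"
    and c: "\<And>k. k < m \<Longrightarrow> cont_ES m W (f' k)"
    and p: "\<gamma> t0 \<in> W" and near: "0 < \<delta>" "\<And>t. \<bar>t - t0\<bar> < \<delta> \<Longrightarrow> \<gamma> t \<in> ES m"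
    and d\<gamma>: "\<And>k. k < m \<Longrightarrow> ((\<lambda>t. \<gamma> t k) has_real_derivative \<gamma>' k) (at t0)"
  shows "((\<lambda>t. f (\<gamma> t)) has_vector_derivative (\<Sum>k<m. \<gamma>' k *\<^sub>R f' k (\<gamma> t0))) (at t0)"
proof -
  let ?x = "\<gamma> t0"
  define Lin where "Lin = (\<lambda>t. \<Sum>k<m. (\<gamma> t k - ?x k) *\<^sub>R f' k ?x)"
  define E where "E = (\<lambda>t. f (\<gamma> t) - f ?x - Lin t)"
  have xES: "?x \<in> ES m" using p openin_subset[OF W] by blast
  have dLin: "(Lin has_vector_derivative (\<Sum>k<m. \<gamma>' k *\<^sub>R f' k ?x)) (at t0)"
    unfolding Lin_def using d\<gamma>
    by (auto intro!: derivative_eq_intros sum.cong)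
  define K where "K = (\<Sum>k<m. \<bar>\<gamma>' k\<bar> + 1)"
  have "\<exists>s>0. \<forall>t. norm (t - t0) < s \<longrightarrow> \<bar>\<gamma> t k - ?x k\<bar> \<le> (\<bar>\<gamma>' k\<bar> + 1) * \<bar>t - t0\<bar>" if k: "k < m" for k
  proof -
    obtain s where s: "s > 0" "\<And>t. norm (t - t0) < s \<Longrightarrow> norm (\<gamma> t k - \<gamma> t0 k - \<gamma>' k * (t - t0)) \<le> 1 * norm (t - t0)"
      using d\<gamma>[OF k] unfolding has_field_derivative_def has_derivative_at_alt by (metis zero_less_one)
    have "\<bar>\<gamma> t k - ?x k\<bar> \<le> (\<bar>\<gamma>' k\<bar> + 1) * \<bar>t - t0\<bar>" if "norm (t - t0) < s" for t
    proof -
      have "\<bar>\<gamma> t k - ?x k\<bar> \<le> \<bar>\<gamma> t k - \<gamma> t0 k - \<gamma>' k * (t - t0)\<bar> + \<bar>\<gamma>' k * (t - t0)\<bar>" by linarith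
      also have "\<dots> \<le> (\<bar>\<gamma>' k\<bar> + 1) * \<bar>t - t0\<bar>" using s(2)[OF that] unfolding abs_mult distrib_right by simp
      finally show ?thesis .
    qed
    then show ?thesis using s(1) by (intro exI[of _ s]) auto
  qed
  then obtain s where s: "\<And>k. k < m \<Longrightarrow> 0 < s k"
    "\<And>k t. k < m \<Longrightarrow> norm (t - t0) < s k \<Longrightarrow> \<bar>\<gamma> t k - ?x k\<bar> \<le> (\<bar>\<gamma>' k\<bar> + 1) * \<bar>t - t0\<bar>" by metis
  obtain s0 where s0: "0 < s0" "\<And>k. k \<in> {..<m} \<Longrightarrow> s0 \<le> s k"
    using finite_min_pos[of "{..<m}" s] s(1) by auto
  have gb: "\<bar>\<gamma> t k - ?x k\<bar> \<le> (\<bar>\<gamma>' k\<bar> + 1) * \<bar>t - t0\<bar>" if "k < m" "\<bar>t - t0\<bar> < s0" for k t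
    using s(2)[of k t] s0(2)[of k] that by auto
  have K0: "0 \<le> K" unfolding K_def by (intro sum_nonneg) auto
  have "(E has_vector_derivative 0) (at t0)"
    unfolding has_vector_derivative_def has_derivative_at_alt
  proof (intro conjI allI impI)
    fix e :: real assume e: "0 < e"
    define e' where "e' = e / (K + 1)"
    have e': "0 < e'" using e K0 by (simp add: e'_def)
    have "\<exists>r>0. \<forall>y\<in>ebox m ?x r. y \<in> W \<and> dist (f' k y) (f' k ?x) < e'" if "k < m" for k
      using c[OF that] p e' unfolding cont_ES_def by blast
    then obtain r where r: "\<And>k. k < m \<Longrightarrow> 0 < r k"
       "\<And>k y. k < m \<Longrightarrow> y \<in> ebox m ?x (r k) \<Longrightarrow> dist (f' k y) (f' k ?x) < e'" by metis
    obtain rW where rW: "0 < rW" "ebox m ?x rW \<subseteq> W" using W p unfolding open_ES_iff by meson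
    obtain r0 where r0: "0 < r0" "\<And>k. k \<in> {..<m} \<Longrightarrow> r0 \<le> r k"
      using finite_min_pos[of "{..<m}" r] r(1) by auto
    define r1 where "r1 = min rW r0"
    have r1: "0 < r1" "ebox m ?x r1 \<subseteq> W" "\<And>k y. k < m \<Longrightarrow> y \<in> ebox m ?x r1 \<Longrightarrow> norm (f' k y - f' k ?x) \<le> e'"
      using rW r0(1) apply (simp add: r1_def)
      using rW ebox_mono[of r1 rW m ?x] apply (simp add: r1_def)
      subgoal for k y
        using r(2)[of k y] r0(2)[of k] ebox_mono[of r1 "r k" m ?x] by (force simp: r1_def dist_norm)
      done
    define d1 where "d1 = min (min s0 \<delta>) (r1 / (K + 1))"
    have d1: "0 < d1" using s0 near r1 K0 by (simp add: d1_def)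
    show "\<exists>d>0. \<forall>y. norm (y - t0) < d \<longrightarrow> norm (E y - E t0 - (y - t0) *\<^sub>R 0) \<le> e * norm (y - t0)"
    proof (intro exI[of _ d1] conjI d1 allI impI)
      fix t assume t: "norm (t - t0) < d1"
      have sumb: "(\<Sum>k<m. \<bar>\<gamma> t k - ?x k\<bar>) \<le> K * \<bar>t - t0\<bar>"
        unfolding K_def sum_distrib_right by (intro sum_mono gb) (use t in \<open>auto simp: d1_def\<close>)
      have "\<bar>\<gamma> t k - ?x k\<bar> < r1" if k: "k < m" for k
      proof -
        have "\<bar>\<gamma> t k - ?x k\<bar> \<le> (\<Sum>k<m. \<bar>\<gamma> t k - ?x k\<bar>)"
          by (rule member_le_sum) (use k in auto)
        also have "\<dots> \<le> (K + 1) * \<bar>t - t0\<bar>" using sumb by (simp add: algebra_simps)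
        also have "\<dots> < r1" using t K0 by (simp add: d1_def field_simps)
        finally show ?thesis .
      qed
      then have "\<gamma> t \<in> ebox m ?x r1" using near(2)[of t] t by (auto simp: ebox_def d1_def)
      then have "norm (f (\<gamma> t) - f ?x - (\<Sum>k<m. (\<gamma> t k - ?x k) *\<^sub>R f' k ?x)) \<le> e' * (\<Sum>k<m. \<bar>\<gamma> t k - ?x k\<bar>)"
        using r1 D by (intro partial_increment_bound[OF xES, where r = r1 and f' = f']) (simp_all add: subset_iff del: fun_upd_apply)
      also have "\<dots> \<le> e' * (K * \<bar>t - t0\<bar>)" using sumb e' by (intro mult_left_mono) auto
      also have "\<dots> \<le> e' * ((K + 1) * \<bar>t - t0\<bar>)" using e' by (intro mult_left_mono mult_right_mono) auto
      also have "\<dots> = e * \<bar>t - t0\<bar>" using K0 by (simp add: e'_def field_simps)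
      finally show "norm (E t - E t0 - (t - t0) *\<^sub>R 0) \<le> e * norm (t - t0)"
        by (simp add: E_def Lin_def)
    qed
  qed simp
  then have "((\<lambda>t. E t + Lin t + f ?x) has_vector_derivative (0 + (\<Sum>k<m. \<gamma>' k *\<^sub>R f' k ?x) + 0)) (at t0)"
    using dLin by (intro derivative_intros)
  then show ?thesis by (simp add: E_def)
qed

lemma cont_ES_compose:
  assumes W: "open_ES d W" and W': "open_ES m W'" and f: "cont_ES m W' f"
    and g: "\<And>j. j < m \<Longrightarrow> cont_ES d W (\<lambda>x. g x j)" and gW: "\<And>x. x \<in> W \<Longrightarrow> g x \<in> W'"
  shows "cont_ES d W (\<lambda>x. f (g x))"
  unfolding cont_ES_def
proof (intro ballI allI impI)
  fix x and e :: real assume x: "x \<in> W" and e: "0 < e"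
  obtain r where r: "0 < r" "\<And>y. y \<in> ebox m (g x) r \<Longrightarrow> dist (f y) (f (g x)) < e"
    using cont_ES_D[OF f gW[OF x] e] by metis
  have "\<exists>s>0. \<forall>y\<in>ebox d x s. y \<in> W \<and> dist (g y j) (g x j) < r" if "j < m" for j
    using g[OF that] x r(1) unfolding cont_ES_def by blast
  then obtain s where s: "\<And>j. j < m \<Longrightarrow> 0 < s j" "\<And>j y. j < m \<Longrightarrow> y \<in> ebox d x (s j) \<Longrightarrow> dist (g y j) (g x j) < r"
    by metis
  obtain s0 where s0: "0 < s0" "\<And>k. k \<in> {..<m} \<Longrightarrow> s0 \<le> s k"
    using finite_min_pos[of "{..<m}" s] s(1) by auto
  obtain sW where sW: "0 < sW" "ebox d x sW \<subseteq> W" using W x unfolding open_ES_iff by meson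
  show "\<exists>r>0. \<forall>y\<in>ebox d x r. y \<in> W \<and> dist (f (g y)) (f (g x)) < e"
  proof (intro exI[of _ "min s0 sW"] conjI ballI)
    fix y assume y: "y \<in> ebox d x (min s0 sW)"
    show yW: "y \<in> W" using y sW(2) ebox_mono[of "min s0 sW" sW d x] by auto
    have "dist (g y j) (g x j) < r" if "j < m" for j
    proof (rule s(2)[OF that])
      show "y \<in> ebox d x (s j)" using y s0(2)[of j] that by (auto simp: ebox_def intro: less_le_trans)
    qed
    then have "g y \<in> ebox m (g x) r"
      using gW[OF yW] openin_subset[OF W'] by (auto simp: ebox_def dist_real_def)
    then show "dist (f (g y)) (f (g x)) < e" by (rule r(2))
  qed (use s0 sW in auto)
qed

lemma cont_ES_tendsto:
  "cont_ES d W f \<longleftrightarrow> (\<forall>x\<in>W. (f \<longlongrightarrow> f x) (INF r\<in>{0<..}. principal (ebox d x r)) \<and> (\<exists>r>0. ebox d x r \<subseteq> W))"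
proof -
  have ev: "eventually P (INF r\<in>{0<..}. principal (ebox d x r)) \<longleftrightarrow> (\<exists>r>0. \<forall>y\<in>ebox d x r. P y)" for P x
  proof (subst eventually_INF_base)
    show "{0::real<..} \<noteq> {}" by auto
    fix a b :: real assume "a \<in> {0<..}" "b \<in> {0<..}"
    then show "\<exists>c\<in>{0<..}. principal (ebox d x c) \<le> inf (principal (ebox d x a)) (principal (ebox d x b))"
      using ebox_mono[of "min a b" a d x] ebox_mono[of "min a b" b d x]
      by (intro bexI[of _ "min a b"]) auto
  qed (auto simp: eventually_principal)
  show ?thesis
    unfolding cont_ES_def tendsto_iff ev subset_iff
  proof (intro ball_cong refl iffI conjI allI impI)
    fix x and e :: real assume "\<forall>e>0. \<exists>r>0. \<forall>y\<in>ebox d x r. y \<in> W \<and> dist (f y) (f x) < e" "0 < e"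
    then show "\<exists>r>0. \<forall>y\<in>ebox d x r. dist (f y) (f x) < e" by blast
  next
    fix x assume "\<forall>e>0. \<exists>r>0. \<forall>y\<in>ebox d x r. y \<in> W \<and> dist (f y) (f x) < e"
    then show "\<exists>r>0. \<forall>y. y \<in> ebox d x r \<longrightarrow> y \<in> W" using zero_less_one by blast
  next
    fix x and e :: real
    assume *: "(\<forall>e>0. \<exists>r>0. \<forall>y\<in>ebox d x r. dist (f y) (f x) < e) \<and> (\<exists>r>0. \<forall>y. y \<in> ebox d x r \<longrightarrow> y \<in> W)" "0 < e"
    then obtain r s where "r > 0" "s > 0" "\<forall>y\<in>ebox d x r. dist (f y) (f x) < e" "\<forall>y. y \<in> ebox d x s \<longrightarrow> y \<in> W"
      by blast
    then show "\<exists>r>0. \<forall>y\<in>ebox d x r. y \<in> W \<and> dist (f y) (f x) < e"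
      using ebox_mono[of "min r s" r d x] ebox_mono[of "min r s" s d x] by (intro exI[of _ "min r s"]) auto
  qed
qed

lemma cont_ES_bilinear:
  assumes "bounded_bilinear bop" "cont_ES d W f" "cont_ES d W g"
  shows "cont_ES d W (\<lambda>x. bop (f x) (g x))"
  using assms(2,3) bounded_bilinear.tendsto[OF assms(1)] unfolding cont_ES_tendsto by blast

lemma cont_ES_add:
  fixes f g :: "(nat \<Rightarrow> real) \<Rightarrow> 'b::real_normed_vector"
  shows "cont_ES d W f \<Longrightarrow> cont_ES d W g \<Longrightarrow> cont_ES d W (\<lambda>x. f x + g x)"
  using tendsto_add unfolding cont_ES_tendsto by blast

lemma cont_ES_const: "open_ES d W \<Longrightarrow> cont_ES d W (\<lambda>x. c)"
  unfolding cont_ES_tendsto open_ES_iff by simp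

lemma cont_ES_coord:
  assumes "open_ES d W" shows "cont_ES d W (\<lambda>x. x i)"
  unfolding cont_ES_def
proof (intro ballI allI impI)
  fix x and e :: real assume x: "x \<in> W" and e: "0 < e"
  obtain s where s: "0 < s" "ebox d x s \<subseteq> W" using assms x unfolding open_ES_iff by meson
  have "x \<in> ES d" using x openin_subset[OF assms] by blast
  then have "dist (y i) (x i) < e" if "y \<in> ebox d x (min e s)" for y
    using that e by (cases "i < d") (auto simp: ebox_def dist_real_def in_ES_iff)
  then show "\<exists>r>0. \<forall>y\<in>ebox d x r. y \<in> W \<and> dist (y i) (x i) < e"
    using e s ebox_mono[of "min e s" s d x] by (intro exI[of _ "min e s"]) auto
qed

lemma Ck_on_SucI:
  assumes "cont_ES d W f" "\<And>i. i < d \<Longrightarrow> Ck_on d W k (g i)" "\<And>i x. i < d \<Longrightarrow> x \<in> W \<Longrightarrow> has_partial i f (g i x) x"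
  shows "Ck_on d W (Suc k) f"
  using assms by auto

lemma Ck_on_SucE:
  assumes "Ck_on d W (Suc k) f"
  obtains g where "cont_ES d W f" "\<And>i. i < d \<Longrightarrow> Ck_on d W k (g i)"
    "\<And>i x. i < d \<Longrightarrow> x \<in> W \<Longrightarrow> has_partial i f (g i x) x"
proof -
  have "\<forall>i. \<exists>g. i < d \<longrightarrow> Ck_on d W k g \<and> (\<forall>x\<in>W. has_partial i f (g x) x)"
    using assms by (simp del: fun_upd_apply)
  then obtain g where "\<forall>i. i < d \<longrightarrow> Ck_on d W k (g i) \<and> (\<forall>x\<in>W. has_partial i f (g i x) x)"
    by (rule choice[THEN exE])
  then show thesis using assms by (intro that[of g]) (auto simp del: fun_upd_apply)
qed

lemma Ck_on_const: "open_ES d W \<Longrightarrow> Ck_on d W k (\<lambda>x. c)"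
  by (induction k arbitrary: c) (auto intro!: cont_ES_const exI[of _ "\<lambda>x. 0"])

lemma Ck_on_add:
  assumes "open_ES d W" shows "Ck_on d W k f \<Longrightarrow> Ck_on d W k g \<Longrightarrow> Ck_on d W k (\<lambda>x. f x + g x)"
proof (induction k arbitrary: f g)
  case (Suc k)
  obtain f' where f': "cont_ES d W f" "\<And>i. i < d \<Longrightarrow> Ck_on d W k (f' i)"
    "\<And>i x. i < d \<Longrightarrow> x \<in> W \<Longrightarrow> has_partial i f (f' i x) x" using Ck_on_SucE[OF Suc.prems(1)] by blast
  obtain g' where g': "cont_ES d W g" "\<And>i. i < d \<Longrightarrow> Ck_on d W k (g' i)"
    "\<And>i x. i < d \<Longrightarrow> x \<in> W \<Longrightarrow> has_partial i g (g' i x) x" using Ck_on_SucE[OF Suc.prems(2)] by blast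
  show ?case
    by (rule Ck_on_SucI[where g = "\<lambda>i x. f' i x + g' i x"])
       (use f' g' Suc.IH in \<open>auto intro!: cont_ES_add has_vector_derivative_add simp del: fun_upd_apply\<close>)
qed (simp add: cont_ES_add)

lemma Ck_on_sum:
  assumes "open_ES d W" "finite I" "\<And>i. i \<in> I \<Longrightarrow> Ck_on d W k (f i)"
  shows "Ck_on d W k (\<lambda>x. \<Sum>i\<in>I. f i x)"
  using assms(2,3) by (induction I rule: finite_induct) (auto intro!: Ck_on_const Ck_on_add assms(1))

lemma Ck_on_bilinear:
  assumes "open_ES d W" "bounded_bilinear bop"
  shows "Ck_on d W k f \<Longrightarrow> Ck_on d W k g \<Longrightarrow> Ck_on d W k (\<lambda>x. bop (f x) (g x))"
proof (induction k arbitrary: f g)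
  case (Suc k)
  obtain f' where f': "cont_ES d W f" "\<And>i. i < d \<Longrightarrow> Ck_on d W k (f' i)"
    "\<And>i x. i < d \<Longrightarrow> x \<in> W \<Longrightarrow> has_partial i f (f' i x) x" using Ck_on_SucE[OF Suc.prems(1)] by blast
  obtain g' where g': "cont_ES d W g" "\<And>i. i < d \<Longrightarrow> Ck_on d W k (g' i)"
    "\<And>i x. i < d \<Longrightarrow> x \<in> W \<Longrightarrow> has_partial i g (g' i x) x" using Ck_on_SucE[OF Suc.prems(2)] by blast
  show ?case
  proof (rule Ck_on_SucI[where g = "\<lambda>i x. bop (f x) (g' i x) + bop (f' i x) (g x)"])
    show "cont_ES d W (\<lambda>x. bop (f x) (g x))" by (rule cont_ES_bilinear[OF assms(2) f'(1) g'(1)])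
    fix i assume i: "i < d"
    show "Ck_on d W k (\<lambda>x. bop (f x) (g' i x) + bop (f' i x) (g x))"
      by (intro Ck_on_add assms Suc.IH f'(2) g'(2) i Suc.prems[THEN Ck_on_SucD])
    fix x assume x: "x \<in> W"
    show "has_partial i (\<lambda>x. bop (f x) (g x)) (bop (f x) (g' i x) + bop (f' i x) (g x)) x"
      using bounded_bilinear.has_vector_derivative[OF assms(2) f'(3)[OF i x] g'(3)[OF i x]] by simp
  qed
qed (simp add: cont_ES_bilinear[OF assms(2)])

lemma Ck_on_coord: assumes "open_ES d W" shows "Ck_on d W k (\<lambda>x. x i)"
proof (cases k)
  case (Suc n)
  show ?thesis unfolding Suc
  proof (rule Ck_on_SucI[where g = "\<lambda>j x. if j = i then 1 else 0"])
    show "has_partial j (\<lambda>x. x i) (if j = i then 1 else 0) x" for j and x :: "nat \<Rightarrow> real"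
      by (auto simp: fun_upd_def has_vector_derivative_id)
  qed (auto intro: cont_ES_coord Ck_on_const assms)
qed (simp add: cont_ES_coord assms)

lemma has_partial_compose:
  fixes f :: "(nat \<Rightarrow> real) \<Rightarrow> 'b::real_normed_vector"
  assumes W: "open_ES d W" and W': "open_ES m W'"
    and D: "\<And>z k. z \<in> W' \<Longrightarrow> k < m \<Longrightarrow> has_partial k f (f' k z) z"
    and c: "\<And>k. k < m \<Longrightarrow> cont_ES m W' (f' k)"
    and g: "\<And>j. j < m \<Longrightarrow> has_partial i (\<lambda>x. g x j) (g' j) x"
    and gW: "\<And>x. x \<in> W \<Longrightarrow> g x \<in> W'" and x: "x \<in> W" and i: "i < d"
  shows "has_partial i (\<lambda>x. f (g x)) (\<Sum>j<m. g' j *\<^sub>R f' j (g x)) x"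
proof -
  obtain r where r: "0 < r" "\<And>t. \<bar>t - x i\<bar> < r \<Longrightarrow> x(i := t) \<in> W"
    using upd_in_open[OF W x i] by blast
  have "((\<lambda>t. f (g (x(i := t)))) has_vector_derivative (\<Sum>j<m. g' j *\<^sub>R f' j (g (x(i := x i))))) (at (x i))"
  proof (rule chain_rule_ES[OF W' D c, where \<delta> = r])
    show "g (x(i := t)) \<in> ES m" if "\<bar>t - x i\<bar> < r" for t
      using gW[OF r(2)[OF that]] openin_subset[OF W'] by blast
    show "((\<lambda>t. g (x(i := t)) k) has_real_derivative g' k) (at (x i))" if "k < m" for k
      using g[OF that] by (simp add: has_real_derivative_iff_has_vector_derivative)
  qed (use gW[OF x] r(1) in auto)
  then show ?thesis by simp
qed

lemma Ck_on_compose: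
  fixes f :: "(nat \<Rightarrow> real) \<Rightarrow> 'b::real_normed_vector"
  assumes W: "open_ES d W" and W': "open_ES m W'" and gW: "\<And>x. x \<in> W \<Longrightarrow> g x \<in> W'"
  shows "Ck_on m W' k f \<Longrightarrow> (\<And>j. j < m \<Longrightarrow> Ck_on d W k (\<lambda>x. g x j)) \<Longrightarrow> Ck_on d W k (\<lambda>x. f (g x))"
proof (induction k arbitrary: f)
  case 0
  then show ?case using cont_ES_compose[OF W W', of f g] gW by simp
next
  case (Suc k)
  obtain f' where f': "cont_ES m W' f" "\<And>i. i < m \<Longrightarrow> Ck_on m W' k (f' i)"
    "\<And>i x. i < m \<Longrightarrow> x \<in> W' \<Longrightarrow> has_partial i f (f' i x) x" using Ck_on_SucE[OF Suc.prems(1)] by blast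
  have "\<exists>g'. \<forall>i<d. Ck_on d W k (g' i) \<and> (\<forall>x\<in>W. has_partial i (\<lambda>x. g x j) (g' i x) x)" if "j < m" for j
    by (rule Ck_on_SucE[OF Suc.prems(2)[OF that]]) blast
  then obtain g' where g': "\<And>i j. j < m \<Longrightarrow> i < d \<Longrightarrow> Ck_on d W k (g' j i)"
    "\<And>i j x. j < m \<Longrightarrow> i < d \<Longrightarrow> x \<in> W \<Longrightarrow> has_partial i (\<lambda>x. g x j) (g' j i x) x" by metis
  show ?case
  proof (rule Ck_on_SucI[where g = "\<lambda>i x. \<Sum>j<m. g' j i x *\<^sub>R f' j (g x)"])
    show "cont_ES d W (\<lambda>x. f (g x))"
      by (rule cont_ES_compose[OF W W' f'(1) _ gW]) (use Suc.prems(2) Ck_on_cont in blast)+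
    fix i assume i: "i < d"
    show "Ck_on d W k (\<lambda>x. \<Sum>j<m. g' j i x *\<^sub>R f' j (g x))"
      using i by (intro Ck_on_sum Ck_on_bilinear[OF W bounded_bilinear_scaleR] W Suc.IH f'(2) g'(1)
          Suc.prems(2)[THEN Ck_on_SucD] finite_lessThan) auto
    fix x assume x: "x \<in> W"
    show "has_partial i (\<lambda>x. f (g x)) (\<Sum>j<m. g' j i x *\<^sub>R f' j (g x)) x"
      by (rule has_partial_compose[OF W W' f'(3) Ck_on_cont[OF f'(2)] g'(2)[OF _ i x] gW x i])
  qed
qed

lemma smooth_compose:
  assumes "open_ES d W" "open_ES m W'" "\<And>x. x \<in> W \<Longrightarrow> g x \<in> W'" "smooth_on_open m W' f"
    "\<And>j. j < m \<Longrightarrow> smooth_on_open d W (\<lambda>x. g x j)"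
  shows "smooth_on_open d W (\<lambda>x. f (g x))"
proof -
  have 1: "Ck_on m W' k f" for k
    using assms(4) smooth_on_open_iff_Ck[OF assms(2), of f] by simp
  have 2: "Ck_on d W k (\<lambda>x. g x j)" if "j < m" for k j
    using assms(5)[OF that] smooth_on_open_iff_Ck[OF assms(1), of "\<lambda>x. g x j"] by simp
  have "Ck_on d W k (\<lambda>x. f (g x))" for k
    by (rule Ck_on_compose[where W' = W' and m = m]) (fact assms(1-3) 1 2 | assumption)+
  then show ?thesis
    unfolding smooth_on_open_iff_Ck[OF assms(1)] by (rule allI)
qed

lemma smooth_const: "open_ES d W \<Longrightarrow> smooth_on_open d W (\<lambda>x. c)"
  by (simp add: smooth_on_open_iff_Ck Ck_on_const)

lemma smooth_coord: "open_ES d W \<Longrightarrow> smooth_on_open d W (\<lambda>x. x i)"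
  by (simp add: smooth_on_open_iff_Ck Ck_on_coord)

lemma smooth_add: "open_ES d W \<Longrightarrow> smooth_on_open d W f \<Longrightarrow> smooth_on_open d W g \<Longrightarrow> smooth_on_open d W (\<lambda>x. f x + g x)"
  by (simp add: smooth_on_open_iff_Ck Ck_on_add)

lemma smooth_sum:
  "open_ES d W \<Longrightarrow> finite I \<Longrightarrow> (\<And>i. i \<in> I \<Longrightarrow> smooth_on_open d W (f i)) \<Longrightarrow> smooth_on_open d W (\<lambda>x. \<Sum>i\<in>I. f i x)"
  by (simp add: smooth_on_open_iff_Ck Ck_on_sum)

lemma smooth_bilinear:
  "open_ES d W \<Longrightarrow> bounded_bilinear bop \<Longrightarrow> smooth_on_open d W f \<Longrightarrow> smooth_on_open d W g \<Longrightarrow>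
    smooth_on_open d W (\<lambda>x. bop (f x) (g x))"
  by (simp add: smooth_on_open_iff_Ck Ck_on_bilinear)

lemmas smooth_mult = smooth_bilinear[OF _ bounded_bilinear_mult]
lemmas smooth_scaleR = smooth_bilinear[OF _ bounded_bilinear_scaleR]

lemma smooth_cmult:
  fixes c :: "'b::real_normed_algebra"
  shows "open_ES d W \<Longrightarrow> smooth_on_open d W f \<Longrightarrow> smooth_on_open d W (\<lambda>x. c * f x)"
  by (intro smooth_mult smooth_const)

lemma smooth_diff:
  fixes f g :: "(nat \<Rightarrow> real) \<Rightarrow> 'b::real_normed_vector"
  assumes "open_ES d W" "smooth_on_open d W f" "smooth_on_open d W g"
  shows "smooth_on_open d W (\<lambda>x. f x - g x)"
  using smooth_add[OF assms(1,2) smooth_scaleR[OF assms(1) smooth_const[OF assms(1), of "-1 :: real"] assms(3)]] by simp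

lemma smooth_of_real:
  assumes "open_ES d W" "smooth_on_open d W f"
  shows "smooth_on_open d W (\<lambda>x. of_real (f x) :: 'b::real_normed_algebra_1)"
  using smooth_scaleR[OF assms smooth_const[OF assms(1), of "1 :: 'b"]] by (simp add: of_real_def)

lemma smooth_bounded_linear:
  assumes "open_ES d W" "bounded_linear h" "smooth_on_open d W f"
  shows "smooth_on_open d W (\<lambda>x. h (f x))"
proof -
  have "bounded_bilinear (\<lambda>(a::real) b. a *\<^sub>R h b)"
    by (rule bounded_bilinear.comp[OF bounded_bilinear_scaleR bounded_linear_ident assms(2)])
  from smooth_bilinear[OF assms(1) this smooth_const[OF assms(1), of 1] assms(3)] show ?thesis by simp
qed

lemma ex_pos_ex_nonnegI: "(0::real) < r \<Longrightarrow> (0::real) \<le> K \<Longrightarrow> P r K \<Longrightarrow> \<exists>r>0. \<exists>K\<ge>0. P r K"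
  by blast

section \<open>Domination by a family of smooth functions\<close>

definition lcomb :: "(complex \<times> 'a) list \<Rightarrow> ('a \<Rightarrow> complex) \<Rightarrow> complex" where
  "lcomb xs g = (\<Sum>(c, s)\<leftarrow>xs. c * g s)"

lemma lcomb_simps [simp]:
  "lcomb [] g = 0" "lcomb ((c, s) # xs) g = c * g s + lcomb xs g"
  by (simp_all add: lcomb_def)

lemma lcomb_append [simp]: "lcomb (xs @ ys) g = lcomb xs g + lcomb ys g"
  by (simp add: lcomb_def)

text \<open>
  Domination is stable under pointwise limits, averages and, by finite differences, under
  differentiation.
\<close>

definition dominated :: "'a set \<Rightarrow> real \<Rightarrow> ('a \<Rightarrow> complex) set \<Rightarrow> ('a \<Rightarrow> complex) \<Rightarrow> bool" where
  "dominated W C BB g \<longleftrightarrow> (\<forall>xs B. snd ` set xs \<subseteq> W \<longrightarrow> 0 \<le> B \<longrightarrow>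
      (\<forall>b\<in>BB. norm (lcomb xs b) \<le> B) \<longrightarrow> norm (lcomb xs g) \<le> C * B)"

lemma dominatedD:
  "dominated W C BB g \<Longrightarrow> snd ` set xs \<subseteq> W \<Longrightarrow> 0 \<le> B \<Longrightarrow> (\<And>b. b \<in> BB \<Longrightarrow> norm (lcomb xs b) \<le> B) \<Longrightarrow>
    norm (lcomb xs g) \<le> C * B"
  unfolding dominated_def by blast

definition locally_bounded_family :: "nat \<Rightarrow> (nat \<Rightarrow> real) set \<Rightarrow> ((nat \<Rightarrow> real) \<Rightarrow> complex) set \<Rightarrow> bool" where
  "locally_bounded_family d W BB \<longleftrightarrow> (\<forall>b\<in>BB. smooth_on_open d W b) \<and>
     (\<forall>ks x. set ks \<subseteq> {..<d} \<longrightarrow> x \<in> W \<longrightarrow>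
        (\<exists>r>0. \<exists>M. ebox d x r \<subseteq> W \<and> (\<forall>b\<in>BB. \<forall>y\<in>ebox d x r. norm (iter_partial ks b y) \<le> M)))"

lemma locally_bounded_family_partial_deriv:
  assumes "locally_bounded_family d W BB" "i < d"
  shows "locally_bounded_family d W (partial_deriv i ` BB)"
  unfolding locally_bounded_family_def
proof (intro conjI ballI allI impI)
  show "smooth_on_open d W b" if "b \<in> partial_deriv i ` BB" for b
    using that assms by (auto simp: locally_bounded_family_def intro: smooth_partial_deriv)
  fix ks x assume ks: "set ks \<subseteq> {..<d}" and x: "x \<in> W"
  have eq: "iter_partial ks (partial_deriv i b) = iter_partial (ks @ [i]) b" for b :: "(nat \<Rightarrow> real) \<Rightarrow> complex"
    by (simp add: iter_partial_append)
  have ks': "set (ks @ [i]) \<subseteq> {..<d}" using ks assms(2) by simp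
  show "\<exists>r>0. \<exists>M. ebox d x r \<subseteq> W \<and> (\<forall>b\<in>partial_deriv i ` BB. \<forall>y\<in>ebox d x r. norm (iter_partial ks b y) \<le> M)"
    unfolding ball_simps(9) eq
    by (rule assms(1)[unfolded locally_bounded_family_def, THEN conjunct2, rule_format, OF ks' x])
qed

lemma locally_bounded_family_finite:
  assumes "locally_bounded_family d W BB" "finite KS" "\<And>ks. ks \<in> KS \<Longrightarrow> set ks \<subseteq> {..<d}" "x \<in> W"
  obtains r M where "0 < r" "0 \<le> M" "ebox d x r \<subseteq> W"
    "\<And>ks b y. ks \<in> KS \<Longrightarrow> b \<in> BB \<Longrightarrow> y \<in> ebox d x r \<Longrightarrow> norm (iter_partial ks b y) \<le> M"
proof -
  obtain r0 where r0: "0 < r0" "ebox d x r0 \<subseteq> W"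
    using assms(1)[unfolded locally_bounded_family_def, THEN conjunct2, rule_format, of "[]" x] assms(4) by auto
  have "\<forall>ks. \<exists>p. ks \<in> KS \<longrightarrow> 0 < fst p \<and> (\<forall>b\<in>BB. \<forall>y\<in>ebox d x (fst p). norm (iter_partial ks b y) \<le> snd p)"
    using assms(1)[unfolded locally_bounded_family_def, THEN conjunct2, rule_format, OF assms(3) assms(4)]
    by (metis fst_conv snd_conv)
  then obtain p where p: "\<forall>ks. ks \<in> KS \<longrightarrow> 0 < fst (p ks) \<and> (\<forall>b\<in>BB. \<forall>y\<in>ebox d x (fst (p ks)). norm (iter_partial ks b y) \<le> snd (p ks))"
    by (rule choice[THEN exE])
  obtain r1 where r1: "0 < r1" "\<And>ks. ks \<in> KS \<Longrightarrow> r1 \<le> fst (p ks)"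
    using finite_min_pos[OF assms(2), of "\<lambda>ks. fst (p ks)"] p by auto
  define M where "M = (\<Sum>ks\<in>KS. \<bar>snd (p ks)\<bar>)"
  show thesis
  proof (rule that[of "min r0 r1" M])
    show "ebox d x (min r0 r1) \<subseteq> W" using r0 ebox_mono[of "min r0 r1" r0 d x] by auto
    fix ks b y assume *: "ks \<in> KS" "b \<in> BB" "y \<in> ebox d x (min r0 r1)"
    then have "y \<in> ebox d x (fst (p ks))" using r1(2)[of ks] by (auto simp: ebox_def intro: less_le_trans)
    then have "norm (iter_partial ks b y) \<le> snd (p ks)" using p * by blast
    also have "\<dots> \<le> \<bar>snd (p ks)\<bar>" by simp
    also have "\<dots> \<le> M" unfolding M_def by (rule member_le_sum) (use * assms(2) in auto)
    finally show "norm (iter_partial ks b y) \<le> M" .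
  qed (use r0 r1 in \<open>auto simp: M_def intro: sum_nonneg\<close>)
qed

lemma dominated_cont:
  assumes W: "open_ES d W" and BB: "locally_bounded_family d W BB" and C: "0 \<le> C" and g: "dominated W C BB g"
  shows "cont_ES d W g"
  unfolding cont_ES_def
proof (intro ballI allI impI)
  fix x and e :: real assume x: "x \<in> W" and e: "0 < e"
  obtain r M where r: "0 < r" "0 \<le> M" "ebox d x r \<subseteq> W"
    "\<And>ks b y. ks \<in> (\<lambda>k. [k]) ` {..<d} \<Longrightarrow> b \<in> BB \<Longrightarrow> y \<in> ebox d x r \<Longrightarrow> norm (iter_partial ks b y) \<le> M"
    by (rule locally_bounded_family_finite[OF BB _ _ x, of "(\<lambda>k. [k]) ` {..<d}"]) (auto intro: that)
  define K where "K = C * (M * real d) + 1"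
  have K: "0 < K" using C r by (simp add: K_def add_nonneg_pos)
  define s where "s = min r (e / K)"
  have s0: "0 < s" using r K e by (simp add: s_def)
  have xES: "x \<in> ES d" using x openin_subset[OF W] by blast
  have "dist (g y) (g x) < e" if y: "y \<in> ebox d x s" for y
  proof -
    have yr: "y \<in> ebox d x r" using y by (auto simp: ebox_def s_def)
    have sm: "(\<Sum>k<d. \<bar>y k - x k\<bar>) \<le> real d * s"
      using sum_bounded_above[of "{..<d}" "\<lambda>k. \<bar>y k - x k\<bar>" s] y by (auto simp: ebox_def intro: less_imp_le)
    have "norm (lcomb [(1, y), (-1, x)] b) \<le> M * (real d * s)" if b: "b \<in> BB" for b
    proof -
      have "norm (b y - b x - (\<Sum>k<d. (y k - x k) *\<^sub>R 0)) \<le> M * (\<Sum>k<d. \<bar>y k - x k\<bar>)"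
      proof (rule partial_increment_bound[OF xES yr])
        fix z k assume z: "z \<in> ebox d x r" "k < d"
        show "has_partial k b (partial_deriv k b z) z"
          using BB b z r(3) unfolding locally_bounded_family_def by (intro smooth_has_partial[of d W]) auto
        show "norm (partial_deriv k b z - 0) \<le> M" using r(4)[of "[k]" b z] b z by simp
      qed
      also have "\<dots> \<le> M * (real d * s)" using sm r(2) by (intro mult_left_mono)
      finally show ?thesis by simp
    qed
    moreover have "0 \<le> M * (real d * s)"
      using s0 r(2) by simp
    ultimately have "norm (lcomb [(1, y), (-1, x)] g) \<le> C * (M * (real d * s))"
      using x yr r(3) by (intro dominatedD[OF g]) auto
    then have "dist (g y) (g x) \<le> C * (M * real d) * s" by (simp add: dist_norm mult.assoc)
    also have "\<dots> \<le> C * (M * real d) * (e / K)"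
      using C r(2) by (intro mult_left_mono) (auto simp: s_def)
    also have "\<dots> < e" using K e by (simp add: K_def field_simps)
    finally show ?thesis .
  qed
  moreover have "y \<in> W" if "y \<in> ebox d x s" for y
    using that r(3) ebox_mono[of s r d x] by (auto simp: s_def)
  ultimately show "\<exists>r>0. \<forall>y\<in>ebox d x r. y \<in> W \<and> dist (g y) (g x) < e"
    using s0 by (intro exI[of _ s]) auto
qed

lemma family_second_order:
  assumes W: "open_ES d W" and BB: "locally_bounded_family d W BB" and x: "x \<in> W" and i: "i < d"
  obtains r K where "0 < r" "0 \<le> K" "ebox d x r \<subseteq> W"
    "\<And>b t. b \<in> BB \<Longrightarrow> \<bar>t\<bar> < r \<Longrightarrow> norm (b (x(i := x i + t)) - b x - t *\<^sub>R partial_deriv i b x) \<le> K * t\<^sup>2"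
proof -
  let ?KS = "(\<lambda>(k, l). [k, l]) ` ({..<d} \<times> {..<d})"
  obtain r M where r: "0 < r" "0 \<le> M" "ebox d x r \<subseteq> W"
    "\<And>ks b y. ks \<in> ?KS \<Longrightarrow> b \<in> BB \<Longrightarrow> y \<in> ebox d x r \<Longrightarrow> norm (iter_partial ks b y) \<le> M"
    by (rule locally_bounded_family_finite[OF BB _ _ x, of ?KS]) (auto intro: that)
  have xES: "x \<in> ES d" using x openin_subset[OF W] by blast
  define K where "K = 2 * M * real d"
  show thesis
  proof (rule that[of "r/2" K])
    show "ebox d x (r/2) \<subseteq> W" using r(1,3) ebox_mono[of "r/2" r d x] by auto
    fix b t assume b: "b \<in> BB" and t: "\<bar>t\<bar> < r / 2"
    have sb: "smooth_on_open d W b" using BB b by (auto simp: locally_bounded_family_def)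
    show "norm (b (x(i := x i + t)) - b x - t *\<^sub>R partial_deriv i b x) \<le> K * t\<^sup>2"
    proof (cases "t = 0")
      case False
      let ?y = "x(i := x i + t)" and ?\<rho> = "2 * \<bar>t\<bar>"
      have y: "?y \<in> ebox d x ?\<rho>" using False by (intro upd_in_ebox xES i) auto
      have sub: "ebox d x ?\<rho> \<subseteq> ebox d x r" using t by (intro ebox_mono) auto
      have sum_y: "(\<Sum>k<d. \<bar>?y k - x k\<bar>) = \<bar>t\<bar>" "(\<Sum>k<d. (?y k - x k) *\<^sub>R partial_deriv k b x) = t *\<^sub>R partial_deriv i b x"
        using i by (simp_all add: if_distrib[of "\<lambda>u. \<bar>u - _\<bar>"] sum.remove[of "{..<d}" i])
      have "norm (b ?y - b x - (\<Sum>k<d. (?y k - x k) *\<^sub>R partial_deriv k b x)) \<le> (M * (real d * ?\<rho>)) * (\<Sum>k<d. \<bar>?y k - x k\<bar>)"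
      proof (rule partial_increment_bound[OF xES y])
        fix z l assume z: "z \<in> ebox d x ?\<rho>" and l: "l < d"
        then have zW: "z \<in> W" using sub r(3) by blast
        then show "has_partial l b (partial_deriv l b z) z" using sb l by (intro smooth_has_partial)
        have sm: "(\<Sum>k<d. \<bar>z k - x k\<bar>) \<le> real d * ?\<rho>"
          using sum_bounded_above[of "{..<d}" "\<lambda>k. \<bar>z k - x k\<bar>" ?\<rho>] z by (auto simp: ebox_def intro: less_imp_le)
        have "norm (partial_deriv l b z - partial_deriv l b x - (\<Sum>k<d. (z k - x k) *\<^sub>R 0)) \<le> M * (\<Sum>k<d. \<bar>z k - x k\<bar>)"
        proof (rule partial_increment_bound[OF xES subsetD[OF sub z]])
          fix w k assume w: "w \<in> ebox d x r" "k < d"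
          show "has_partial k (partial_deriv l b) (partial_deriv k (partial_deriv l b) w) w"
            using w r(3) sb l by (intro smooth_has_partial[of d W] smooth_partial_deriv) auto
          show "norm (partial_deriv k (partial_deriv l b) w - 0) \<le> M"
            using r(4)[OF image_eqI[of _ _ "(k, l)"], of "[k, l]" b w] w l b by simp
        qed
        also have "\<dots> \<le> M * (real d * ?\<rho>)" using sm r(2) by (intro mult_left_mono)
        finally show "norm (partial_deriv l b z - partial_deriv l b x) \<le> M * (real d * ?\<rho>)" by simp
      qed
      then show ?thesis unfolding sum_y by (simp add: K_def power2_eq_square mult.assoc mult.left_commute)
    qed simp
  qed (use r in \<open>auto simp: K_def\<close>)
qed

lemma dominated_has_partial:
  assumes W: "open_ES d W" and BB: "locally_bounded_family d W BB" and C: "0 \<le> C" and g: "dominated W C BB g"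
    and x: "x \<in> W" and i: "i < d"
  obtains l r K where "0 < r" "0 \<le> K" "\<And>t. \<bar>t\<bar> < r \<Longrightarrow> norm (g (x(i := x i + t)) - g x - t *\<^sub>R l) \<le> K * t\<^sup>2"
proof -
  obtain r K where r: "0 < r" "0 \<le> K" "ebox d x r \<subseteq> W"
    "\<And>b t. b \<in> BB \<Longrightarrow> \<bar>t\<bar> < r \<Longrightarrow> norm (b (x(i := x i + t)) - b x - t *\<^sub>R partial_deriv i b x) \<le> K * t\<^sup>2"
    by (rule family_second_order[OF W BB x i]) (use that in blast)
  have xES: "x \<in> ES d" using x openin_subset[OF W] by blast
  have inW: "x(i := x i + t) \<in> W" if "\<bar>t\<bar> < r" for t
    using upd_in_ebox[OF xES i r(1)] that r(3) by auto
  define dq where "dq = (\<lambda>t f. (f (x(i := x i + t)) - f x) / complex_of_real t)"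
  have dqb: "norm (dq t b - partial_deriv i b x) \<le> K * \<bar>t\<bar>" if "b \<in> BB" "\<bar>t\<bar> < r" "t \<noteq> 0" for b t
  proof -
    have "dq t b - partial_deriv i b x = (b (x(i := x i + t)) - b x - t *\<^sub>R partial_deriv i b x) / complex_of_real t"
      using that(3) by (simp add: dq_def field_simps scaleR_conv_of_real)
    then have "norm (dq t b - partial_deriv i b x) = norm (b (x(i := x i + t)) - b x - t *\<^sub>R partial_deriv i b x) / \<bar>t\<bar>"
      by (simp add: norm_divide)
    also have "\<dots> \<le> K * t\<^sup>2 / \<bar>t\<bar>" using r(4)[OF that(1,2)] by (intro divide_right_mono) auto
    also have "\<dots> = K * \<bar>t\<bar>" using that(3) by (simp add: power2_eq_square abs_if)
    finally show ?thesis .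
  qed
  have dqg: "norm (dq t g - dq s g) \<le> C * (K * (\<bar>t\<bar> + \<bar>s\<bar>))"
    if t: "\<bar>t\<bar> < r" "t \<noteq> 0" and s: "\<bar>s\<bar> < r" "s \<noteq> 0" for t s
  proof -
    let ?xs = "[(1 / complex_of_real t, x(i := x i + t)), (- 1 / complex_of_real t, x),
       (- 1 / complex_of_real s, x(i := x i + s)), (1 / complex_of_real s, x)]"
    have lc: "lcomb ?xs f = dq t f - dq s f" for f
      by (simp add: dq_def diff_divide_distrib)
    have "norm (lcomb ?xs b) \<le> K * (\<bar>t\<bar> + \<bar>s\<bar>)" if b: "b \<in> BB" for b
      unfolding lc using dqb[OF b t] dqb[OF b s] norm_triangle_ineq4[of "dq t b - partial_deriv i b x" "dq s b - partial_deriv i b x"]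
      by (simp add: distrib_left)
    then have "norm (lcomb ?xs g) \<le> C * (K * (\<bar>t\<bar> + \<bar>s\<bar>))"
      using x inW t s r(2) by (intro dominatedD[OF g]) auto
    then show ?thesis unfolding lc .
  qed
  define tn where "tn = (\<lambda>n. r / (real n + 2))"
  have tn: "\<bar>tn n\<bar> < r" "tn n \<noteq> 0" "0 < tn n" for n
  proof -
    show pos: "0 < tn n" using r(1) by (simp add: tn_def add_nonneg_pos)
    then show "tn n \<noteq> 0" by simp
    have "tn n \<le> r / 2" unfolding tn_def using r(1) by (intro divide_left_mono) auto
    then show "\<bar>tn n\<bar> < r" using pos r(1) by simp
  qed
  have tn0: "tn \<longlonglongrightarrow> 0"
    using LIMSEQ_ignore_initial_segment[OF lim_const_over_n[of r], of 2] by (simp add: tn_def add.commute)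
  have "Cauchy (\<lambda>n. dq (tn n) g)"
    unfolding Cauchy_iff
  proof (intro allI impI)
    fix e :: real assume e: "0 < e"
    have "(\<lambda>n. C * (K * (2 * tn n))) \<longlonglongrightarrow> C * (K * (2 * 0))" by (intro tendsto_intros tn0)
    then have "\<forall>\<^sub>F n in sequentially. C * (K * (2 * tn n)) < e" using e by (simp add: order_tendstoD)
    then obtain N where N: "\<And>n. n \<ge> N \<Longrightarrow> C * (K * (2 * tn n)) < e" by (auto simp: eventually_sequentially)
    have mono: "tn n \<le> tn N" if "n \<ge> N" for n
      using that r(1) by (auto simp: tn_def intro!: divide_left_mono)
    show "\<exists>M. \<forall>m\<ge>M. \<forall>n\<ge>M. norm (dq (tn m) g - dq (tn n) g) < e"
    proof (intro exI[of _ N] allI impI)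
      fix m n assume mn: "N \<le> m" "N \<le> n"
      have "norm (dq (tn m) g - dq (tn n) g) \<le> C * (K * (\<bar>tn m\<bar> + \<bar>tn n\<bar>))" by (rule dqg) (rule tn)+
      also have "\<dots> \<le> C * (K * (2 * tn N))"
        using mono[OF mn(1)] mono[OF mn(2)] tn(3)[of m] tn(3)[of n] C r(2) by (intro mult_left_mono) auto
      also have "\<dots> < e" by (rule N) simp
      finally show "norm (dq (tn m) g - dq (tn n) g) < e" .
    qed
  qed
  then obtain l where l: "(\<lambda>n. dq (tn n) g) \<longlonglongrightarrow> l" using Cauchy_convergent convergent_def by blast
  have dl: "norm (dq t g - l) \<le> C * K * \<bar>t\<bar>" if t: "\<bar>t\<bar> < r" "t \<noteq> 0" for t
  proof (rule LIMSEQ_le)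
    show "(\<lambda>n. norm (dq t g - dq (tn n) g)) \<longlonglongrightarrow> norm (dq t g - l)" by (intro tendsto_intros l)
    have "(\<lambda>n. C * (K * (\<bar>t\<bar> + \<bar>tn n\<bar>))) \<longlonglongrightarrow> C * (K * (\<bar>t\<bar> + \<bar>0\<bar>))" by (intro tendsto_intros tn0)
    then show "(\<lambda>n. C * (K * (\<bar>t\<bar> + \<bar>tn n\<bar>))) \<longlonglongrightarrow> C * K * \<bar>t\<bar>" by (simp add: mult.assoc)
    show "\<exists>N. \<forall>n\<ge>N. norm (dq t g - dq (tn n) g) \<le> C * (K * (\<bar>t\<bar> + \<bar>tn n\<bar>))"
      using dqg[OF t tn(1,2)] by blast
  qed
  show thesis
  proof (rule that[of r "C * K" l])
    fix t assume t: "\<bar>t\<bar> < r"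
    show "norm (g (x(i := x i + t)) - g x - t *\<^sub>R l) \<le> C * K * t\<^sup>2"
    proof (cases "t = 0")
      case False
      have "g (x(i := x i + t)) - g x - t *\<^sub>R l = complex_of_real t * (dq t g - l)"
        using False by (simp add: dq_def field_simps scaleR_conv_of_real)
      then have "norm (g (x(i := x i + t)) - g x - t *\<^sub>R l) = \<bar>t\<bar> * norm (dq t g - l)"
        by (simp add: norm_mult)
      also have "\<dots> \<le> \<bar>t\<bar> * (C * K * \<bar>t\<bar>)" using dl[OF t False] by (intro mult_left_mono) auto
      also have "\<dots> = C * K * t\<^sup>2" by (simp add: power2_eq_square abs_mult_self_eq mult.left_commute)
      finally show ?thesis .
    qed simp
  qed (use r C in auto)
qed

lemma has_partial_of_quadratic_bound:
  fixes g :: "(nat \<Rightarrow> real) \<Rightarrow> 'b::real_normed_vector"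
  assumes "0 < r" "0 \<le> K" "\<And>t. \<bar>t\<bar> < r \<Longrightarrow> norm (g (x(i := x i + t)) - g x - t *\<^sub>R l) \<le> K * t\<^sup>2"
  shows "has_partial i g l x"
  unfolding has_vector_derivative_def has_derivative_at_alt
proof (intro conjI allI impI)
  fix e :: real assume e: "0 < e"
  show "\<exists>d>0. \<forall>y. norm (y - x i) < d \<longrightarrow> norm (g (x(i := y)) - g (x(i := x i)) - (y - x i) *\<^sub>R l) \<le> e * norm (y - x i)"
  proof (intro exI[of _ "min r (e / (K + 1))"] conjI allI impI)
    fix y assume y: "norm (y - x i) < min r (e / (K + 1))"
    have "norm (g (x(i := y)) - g (x(i := x i)) - (y - x i) *\<^sub>R l) \<le> K * (y - x i)\<^sup>2"
      using assms(3)[of "y - x i"] y by simp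
    also have "\<dots> = (K * \<bar>y - x i\<bar>) * \<bar>y - x i\<bar>" by (simp add: power2_eq_square)
    also have "\<dots> \<le> e * \<bar>y - x i\<bar>"
    proof (rule mult_right_mono)
      have "K * \<bar>y - x i\<bar> \<le> (K + 1) * \<bar>y - x i\<bar>" by (simp add: distrib_right)
      also have "\<dots> \<le> e" using y assms(2) by (simp add: field_simps)
      finally show "K * \<bar>y - x i\<bar> \<le> e" .
    qed simp
    finally show "norm (g (x(i := y)) - g (x(i := x i)) - (y - x i) *\<^sub>R l) \<le> e * norm (y - x i)" by simp
  qed (use assms e in auto)
qed (simp add: bounded_linear_scaleR_left)

lemma lcomb_difference_quotient:
  assumes W: "open_ES d W" and i: "i < d" and xs: "snd ` set xs \<subseteq> W"
    and F: "\<And>s. s \<in> W \<Longrightarrow> \<exists>r>0. \<exists>K\<ge>0. \<forall>b\<in>F. \<forall>t. \<bar>t\<bar> < r \<longrightarrow>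
       norm (b (s(i := s i + t)) - b s - t *\<^sub>R D b s) \<le> K * t\<^sup>2"
  obtains r K where "0 < r" "0 \<le> K" "\<And>t. 0 < t \<Longrightarrow> t < r \<Longrightarrow> \<exists>ys. snd ` set ys \<subseteq> W \<and>
     (\<forall>b\<in>F. norm (lcomb ys b - lcomb xs (D b)) \<le> K * t)"
proof -
  have "\<exists>r>0. \<exists>K\<ge>0. \<forall>t. 0 < t \<longrightarrow> t < r \<longrightarrow> (\<exists>ys. snd ` set ys \<subseteq> W \<and>
     (\<forall>b\<in>F. norm (lcomb ys b - lcomb xs (D b)) \<le> K * t))"
    using xs
  proof (induction xs)
    case Nil
    show ?case
      by (rule ex_pos_ex_nonnegI[of 1 0]) (auto intro!: exI[of _ "[]"])
  next
    case (Cons cs xs)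
    obtain c s where cs: "cs = (c, s)" by (cases cs)
    have s: "s \<in> W" using Cons.prems cs by simp
    obtain r1 K1 where 1: "0 < r1" "0 \<le> K1" "\<And>t. 0 < t \<Longrightarrow> t < r1 \<Longrightarrow> \<exists>ys. snd ` set ys \<subseteq> W \<and>
     (\<forall>b\<in>F. norm (lcomb ys b - lcomb xs (D b)) \<le> K1 * t)" using Cons.IH Cons.prems by auto
    obtain r2 K2 where 2: "0 < r2" "0 \<le> K2" "\<And>b t. b \<in> F \<Longrightarrow> \<bar>t\<bar> < r2 \<Longrightarrow>
       norm (b (s(i := s i + t)) - b s - t *\<^sub>R D b s) \<le> K2 * t\<^sup>2" using F[OF s] by blast
    obtain r3 where 3: "0 < r3" "\<And>t. \<bar>t - s i\<bar> < r3 \<Longrightarrow> s(i := t) \<in> W" using upd_in_open[OF W s i] by blast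
    show ?case
    proof (rule ex_pos_ex_nonnegI[of "min r1 (min r2 r3)" "norm c * K2 + K1"]; (intro allI impI)?)
      fix t assume t: "0 < t" "t < min r1 (min r2 r3)"
      obtain ys where ys: "snd ` set ys \<subseteq> W" "\<And>b. b \<in> F \<Longrightarrow> norm (lcomb ys b - lcomb xs (D b)) \<le> K1 * t"
        using 1(3)[of t] t by auto
      let ?ys = "(c / complex_of_real t, s(i := s i + t)) # (- c / complex_of_real t, s) # ys"
      show "\<exists>ys. snd ` set ys \<subseteq> W \<and> (\<forall>b\<in>F. norm (lcomb ys b - lcomb (cs # xs) (D b)) \<le> (norm c * K2 + K1) * t)"
      proof (intro exI[of _ ?ys] conjI ballI)
        show "snd ` set ?ys \<subseteq> W" using ys s 3(2)[of "s i + t"] t by auto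
        fix b assume b: "b \<in> F"
        have eq: "lcomb ?ys b - lcomb (cs # xs) (D b) =
          c / complex_of_real t * (b (s(i := s i + t)) - b s - t *\<^sub>R D b s) + (lcomb ys b - lcomb xs (D b))"
          using t by (simp add: cs field_simps scaleR_conv_of_real)
        have "norm (c / complex_of_real t * (b (s(i := s i + t)) - b s - t *\<^sub>R D b s)) \<le> norm c / t * (K2 * t\<^sup>2)"
          unfolding norm_mult using 2(3)[OF b, of t] t by (intro mult_mono) (auto simp: norm_divide)
        also have "\<dots> = norm c * K2 * t" using t by (simp add: power2_eq_square)
        finally have "norm (c / complex_of_real t * (b (s(i := s i + t)) - b s - t *\<^sub>R D b s)) \<le> norm c * K2 * t" .
        then show "norm (lcomb ?ys b - lcomb (cs # xs) (D b)) \<le> (norm c * K2 + K1) * t"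
          unfolding eq using norm_triangle_le[OF add_mono[OF _ ys(2)[OF b]]] by (simp add: distrib_right)
      qed
    qed (use 1 2 3 in auto)
  qed
  then show thesis using that by blast
qed

lemma dominated_partial_deriv:
  assumes W: "open_ES d W" and BB: "locally_bounded_family d W BB" and C: "0 \<le> C" and g: "dominated W C BB g"
    and i: "i < d"
  obtains g' where "\<And>x. x \<in> W \<Longrightarrow> has_partial i g (g' x) x" "dominated W C (partial_deriv i ` BB) g'"
proof -
  have "\<forall>x. \<exists>l. x \<in> W \<longrightarrow> (\<exists>r>0. \<exists>K\<ge>0. \<forall>t. \<bar>t\<bar> < r \<longrightarrow> norm (g (x(i := x i + t)) - g x - t *\<^sub>R l) \<le> K * t\<^sup>2)"
    using dominated_has_partial[OF W BB C g _ i] by metis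
  then obtain g' where g': "\<forall>x. x \<in> W \<longrightarrow> (\<exists>r>0. \<exists>K\<ge>0. \<forall>t. \<bar>t\<bar> < r \<longrightarrow> norm (g (x(i := x i + t)) - g x - t *\<^sub>R g' x) \<le> K * t\<^sup>2)"
    by (rule choice[THEN exE])
  have hp: "has_partial i g (g' x) x" if "x \<in> W" for x
    using g'[rule_format, OF that] has_partial_of_quadratic_bound by blast
  have "dominated W C (partial_deriv i ` BB) g'"
    unfolding dominated_def
  proof (intro allI impI)
    fix xs :: "(complex \<times> (nat \<Rightarrow> real)) list" and B :: real
    assume xs: "snd ` set xs \<subseteq> W" and B: "0 \<le> B" "\<forall>b\<in>partial_deriv i ` BB. norm (lcomb xs b) \<le> B"
    have F: "\<exists>r>0. \<exists>K\<ge>0. \<forall>b\<in>insert g BB. \<forall>t. \<bar>t\<bar> < r \<longrightarrow>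
       norm (b (s(i := s i + t)) - b s - t *\<^sub>R partial_deriv i b s) \<le> K * t\<^sup>2" if s: "s \<in> W" for s
    proof -
      obtain r1 K1 where 1: "0 < r1" "0 \<le> K1" "\<And>t. \<bar>t\<bar> < r1 \<Longrightarrow> norm (g (s(i := s i + t)) - g s - t *\<^sub>R g' s) \<le> K1 * t\<^sup>2"
        using g' s by blast
      have pg: "partial_deriv i g s = g' s" by (rule has_partial_imp[OF hp[OF s]])
      obtain r2 K2 where 2: "0 < r2" "0 \<le> K2"
        "\<And>b t. b \<in> BB \<Longrightarrow> \<bar>t\<bar> < r2 \<Longrightarrow> norm (b (s(i := s i + t)) - b s - t *\<^sub>R partial_deriv i b s) \<le> K2 * t\<^sup>2"
        by (rule family_second_order[OF W BB s i]) (use that in blast)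
      have "norm (b (s(i := s i + t)) - b s - t *\<^sub>R partial_deriv i b s) \<le> (K1 + K2) * t\<^sup>2"
        if "b \<in> insert g BB" "\<bar>t\<bar> < min r1 r2" for b t
      proof -
        have "norm (b (s(i := s i + t)) - b s - t *\<^sub>R partial_deriv i b s) \<le> max K1 K2 * t\<^sup>2"
        proof (cases "b \<in> BB")
          case True
          have "norm (b (s(i := s i + t)) - b s - t *\<^sub>R partial_deriv i b s) \<le> K2 * t\<^sup>2"
            using 2(3)[OF True] that(2) by simp
          also have "\<dots> \<le> max K1 K2 * t\<^sup>2" by (intro mult_right_mono) auto
          finally show ?thesis .
        next
          case False
          then have bg: "b = g" using that(1) by simp
          have "norm (g (s(i := s i + t)) - g s - t *\<^sub>R g' s) \<le> K1 * t\<^sup>2" using 1(3) that(2) by simp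
          also have "\<dots> \<le> max K1 K2 * t\<^sup>2" by (intro mult_right_mono) auto
          finally show ?thesis unfolding bg pg .
        qed
        also have "\<dots> \<le> (K1 + K2) * t\<^sup>2" using 1 2 by (intro mult_right_mono) auto
        finally show ?thesis .
      qed
      then show ?thesis using 1 2 by (intro ex_pos_ex_nonnegI[of "min r1 r2" "K1 + K2"]) auto
    qed
    obtain r K where r: "0 < r" "0 \<le> K" "\<And>t. 0 < t \<Longrightarrow> t < r \<Longrightarrow> \<exists>ys. snd ` set ys \<subseteq> W \<and>
     (\<forall>b\<in>insert g BB. norm (lcomb ys b - lcomb xs (partial_deriv i b)) \<le> K * t)"
      by (rule lcomb_difference_quotient[OF W i xs F]) (use that in blast)+
    have main: "norm (lcomb xs (partial_deriv i g)) \<le> C * (B + K * t) + K * t" if t: "0 < t" "t < r" for t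
    proof -
      obtain ys where ys: "snd ` set ys \<subseteq> W" "\<And>b. b \<in> insert g BB \<Longrightarrow> norm (lcomb ys b - lcomb xs (partial_deriv i b)) \<le> K * t"
        using r(3)[OF t] by blast
      have "norm (lcomb ys b) \<le> B + K * t" if b: "b \<in> BB" for b
        using ys(2)[of b] B(2) b norm_triangle_sub[of "lcomb ys b" "lcomb xs (partial_deriv i b)"] by force
      then have "norm (lcomb ys g) \<le> C * (B + K * t)"
        using ys(1) B r(2) t by (intro dominatedD[OF g]) auto
      then show ?thesis
        using ys(2)[of g] norm_triangle_sub[of "lcomb xs (partial_deriv i g)" "lcomb ys g"] by (simp add: norm_minus_commute)
    qed
    have "norm (lcomb xs (partial_deriv i g)) \<le> C * B"
    proof (rule tendsto_lowerbound)
      have "((\<lambda>t. C * (B + K * t) + K * t) \<longlongrightarrow> C * (B + K * 0) + K * 0) (at_right 0)"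
        by (intro tendsto_intros)
      then show "((\<lambda>t. C * (B + K * t) + K * t) \<longlongrightarrow> C * B) (at_right 0)" by simp
      show "\<forall>\<^sub>F t in at_right 0. norm (lcomb xs (partial_deriv i g)) \<le> C * (B + K * t) + K * t"
        unfolding eventually_at_right_field using r(1) main by blast
    qed simp
    moreover have "lcomb xs (partial_deriv i g) = lcomb xs g'"
      using xs hp has_partial_imp by (induction xs) fastforce+
    ultimately show "norm (lcomb xs g') \<le> C * B" by simp
  qed
  then show thesis using that hp by blast
qed

theorem dominated_smooth:
  assumes W: "open_ES d W" and BB: "locally_bounded_family d W BB" and C: "0 \<le> C" and g: "dominated W C BB g"
  shows "smooth_on_open d W g"
proof -
  have "Ck_on d W k g" for k
    using BB g
  proof (induction k arbitrary: BB g)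
    case 0
    then show ?case using dominated_cont[OF W 0(1) C 0(2)] by simp
  next
    case (Suc k)
    have "\<exists>g'. Ck_on d W k g' \<and> (\<forall>x\<in>W. has_partial i g (g' x) x)" if i: "i < d" for i
    proof -
      obtain g' where g': "\<And>x. x \<in> W \<Longrightarrow> has_partial i g (g' x) x" "dominated W C (partial_deriv i ` BB) g'"
        by (rule dominated_partial_deriv[OF W Suc.prems(1) C Suc.prems(2) i]) (rule that)
      have "Ck_on d W k g'"
        by (rule Suc.IH[OF locally_bounded_family_partial_deriv[OF Suc.prems(1) i] g'(2)])
      with g'(1) show ?thesis by (intro exI[of _ g'] conjI ballI)
    qed
    then show ?case using dominated_cont[OF W Suc.prems(1) C Suc.prems(2)] by (simp del: fun_upd_apply)
  qed
  then show ?thesis by (simp add: smooth_on_open_iff_Ck[OF W])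
qed

section \<open>Hadamard's lemma and bump functions\<close>

definition ecbox :: "nat \<Rightarrow> (nat \<Rightarrow> real) \<Rightarrow> real \<Rightarrow> (nat \<Rightarrow> real) set" where
  "ecbox d x r = {y \<in> ES d. \<forall>i<d. \<bar>y i - x i\<bar> \<le> r}"

lemma ecbox_subset_ebox: "r < s \<Longrightarrow> ecbox d x r \<subseteq> ebox d x s"
  by (force simp: ebox_def ecbox_def)

lemma ebox_subset_ecbox: "ebox d x r \<subseteq> ecbox d x r"
  by (force simp: ebox_def ecbox_def)

lemma compactin_ecbox: "compactin (Euclidean_space d) (ecbox d x r)"
proof -
  define S where "S = (\<lambda>i. if i < d then {x i - r..x i + r} else {0})"
  have "compactin (powertop_real UNIV) (Pi\<^sub>E UNIV S)"
    by (subst compactin_PiE) (auto simp: S_def)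
  moreover have "ecbox d x r = Pi\<^sub>E UNIV S"
  proof (intro Set.set_eqI iffI)
    fix y assume "y \<in> ecbox d x r"
    then show "y \<in> Pi\<^sub>E UNIV S" by (auto simp: ecbox_def S_def in_ES_iff abs_le_iff algebra_simps)
  next
    fix y assume y: "y \<in> Pi\<^sub>E UNIV S"
    have 1: "\<bar>y i - x i\<bar> \<le> r" if "i < d" for i
      using PiE_mem[of y UNIV S i] y that by (simp add: S_def abs_le_iff)
    have "y i = 0" if "d \<le> i" for i
      using PiE_mem[of y UNIV S i] y that by (simp add: S_def)
    with 1 show "y \<in> ecbox d x r" by (simp add: ecbox_def in_ES_iff)
  qed
  moreover have "ecbox d x r \<subseteq> ES d" by (auto simp: ecbox_def)
  ultimately show ?thesis
    unfolding Euclidean_space_def by (simp add: compactin_subtopology topspace_Euclidean_space)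
qed

lemma cont_ES_bounded_on_compact:
  fixes f :: "(nat \<Rightarrow> real) \<Rightarrow> 'b::real_normed_vector"
  assumes "open_ES d W" "cont_ES d W f" "compactin (Euclidean_space d) K" "K \<subseteq> W"
  obtains M where "0 \<le> M" "\<And>y. y \<in> K \<Longrightarrow> norm (f y) \<le> M"
proof -
  have "compactin (subtopology (Euclidean_space d) W) K"
    using assms(3,4) by (simp add: compactin_subtopology)
  then have "compactin euclidean (f ` K)"
    by (rule image_compactin) (use assms continuous_map_ES_iff in blast)
  then have "bounded (f ` K)" by (simp add: compact_imp_bounded)
  then show thesis using that unfolding bounded_pos by (metis imageI less_imp_le)
qed

lemma ebox_shrink:
  assumes "x \<in> ebox d p R" "0 < R"
  obtains r R' where "0 < r" "R' < R" "ebox d x r \<subseteq> ecbox d p R'"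
proof -
  obtain r where r: "0 < r" "\<And>i. i \<in> {..<d} \<Longrightarrow> r \<le> R - \<bar>x i - p i\<bar>"
    using finite_min_pos[of "{..<d}" "\<lambda>i. R - \<bar>x i - p i\<bar>"] assms by (auto simp: ebox_def)
  show thesis
  proof (rule that[of "r/2" "R - r/2"])
    show "ebox d x (r/2) \<subseteq> ecbox d p (R - r/2)"
    proof
      fix y assume y: "y \<in> ebox d x (r / 2)"
      have "\<bar>y i - p i\<bar> \<le> R - r / 2" if "i < d" for i
      proof -
        have "\<bar>y i - x i\<bar> < r / 2" using y that by (simp add: ebox_def)
        moreover have "r \<le> R - \<bar>x i - p i\<bar>" using r(2) that by simp
        ultimately show ?thesis by linarith
      qed
      then show "y \<in> ecbox d p (R - r / 2)" using y by (simp add: ebox_def ecbox_def)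
    qed
  qed (use r in auto)
qed

lemma cont_ES_along_curve:
  fixes f :: "(nat \<Rightarrow> real) \<Rightarrow> 'b::metric_space" and \<gamma> :: "real \<Rightarrow> nat \<Rightarrow> real"
  assumes W: "open_ES d W" and f: "cont_ES d W f" and \<gamma>: "\<And>i. i < d \<Longrightarrow> continuous_on T (\<lambda>t. \<gamma> t i)"
    and "\<And>t. t \<in> T \<Longrightarrow> \<gamma> t \<in> W"
  shows "continuous_on T (\<lambda>t. f (\<gamma> t))"
  unfolding continuous_on_iff
proof (intro ballI allI impI)
  fix t and e :: real assume t: "t \<in> T" and e: "0 < e"
  obtain r where r: "0 < r" "\<And>y. y \<in> ebox d (\<gamma> t) r \<Longrightarrow> dist (f y) (f (\<gamma> t)) < e"
    using cont_ES_D[OF f assms(4)[OF t] e] by metis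
  have "\<exists>s>0. \<forall>t'\<in>T. dist t' t < s \<longrightarrow> dist (\<gamma> t' i) (\<gamma> t i) < r" if "i < d" for i
    using \<gamma>[OF that] t r(1) unfolding continuous_on_iff by blast
  then obtain s where s: "\<And>i. i < d \<Longrightarrow> 0 < s i" "\<And>i t'. i < d \<Longrightarrow> t' \<in> T \<Longrightarrow> dist t' t < s i \<Longrightarrow> dist (\<gamma> t' i) (\<gamma> t i) < r"
    by metis
  obtain s0 where s0: "0 < s0" "\<And>i. i \<in> {..<d} \<Longrightarrow> s0 \<le> s i"
    using finite_min_pos[of "{..<d}" s] s(1) by auto
  show "\<exists>s>0. \<forall>t'\<in>T. dist t' t < s \<longrightarrow> dist (f (\<gamma> t')) (f (\<gamma> t)) < e"
  proof (intro exI[of _ s0] conjI ballI impI s0)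
    fix t' assume t': "t' \<in> T" "dist t' t < s0"
    have "\<gamma> t' \<in> ES d" using assms(4)[OF t'(1)] openin_subset[OF W] by blast
    then have "\<gamma> t' \<in> ebox d (\<gamma> t) r"
      using s(2)[OF _ t'(1)] s0(2) t'(2) by (force simp: ebox_def dist_real_def)
    then show "dist (f (\<gamma> t')) (f (\<gamma> t)) < e" by (rule r(2))
  qed
qed

definition homothety :: "(nat \<Rightarrow> real) \<Rightarrow> real \<Rightarrow> (nat \<Rightarrow> real) \<Rightarrow> nat \<Rightarrow> real" where
  "homothety p t q = (\<lambda>i. p i + t * (q i - p i))"

lemma homothety_simps [simp]: "homothety p 0 q = p" "homothety p 1 q = q" "homothety p t p = p"
  by (auto simp: homothety_def)

lemma homothety_upd: "homothety p t (q(i := s)) = (homothety p t q)(i := p i + t * (s - p i))"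
  by (auto simp: homothety_def)

lemma homothety_ES: "p \<in> ES d \<Longrightarrow> q \<in> ES d \<Longrightarrow> homothety p t q \<in> ES d"
  by (auto simp: homothety_def in_ES_iff)

lemma homothety_contract: "t \<in> {0..1} \<Longrightarrow> \<bar>homothety p t q i - p i\<bar> \<le> \<bar>q i - p i\<bar>"
  by (simp add: homothety_def abs_mult mult_left_le_one_le)

lemma homothety_ebox: "p \<in> ES d \<Longrightarrow> t \<in> {0..1} \<Longrightarrow> q \<in> ebox d p R \<Longrightarrow> homothety p t q \<in> ebox d p R"
  using homothety_contract[of t p q] homothety_ES[of p d q t] by (auto simp: ebox_def intro: le_less_trans)

lemma homothety_ecbox: "p \<in> ES d \<Longrightarrow> t \<in> {0..1} \<Longrightarrow> q \<in> ecbox d p R \<Longrightarrow> homothety p t q \<in> ecbox d p R"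
  using homothety_contract[of t p q] homothety_ES[of p d q t] by (auto simp: ecbox_def intro: order_trans)

lemma iter_partial_homothety:
  fixes v :: "(nat \<Rightarrow> real) \<Rightarrow> complex"
  assumes p: "p \<in> ES d" and v: "smooth_on_open d (ebox d p R) v" and t: "t \<in> {0..1}"
  shows "set ks \<subseteq> {..<d} \<Longrightarrow> q \<in> ebox d p R \<Longrightarrow>
    iter_partial ks (\<lambda>q. v (homothety p t q)) q = complex_of_real (t ^ length ks) * iter_partial ks v (homothety p t q)"
proof (induction ks arbitrary: q)
  case (Cons i ks)
  let ?F = "iter_partial ks v" and ?h = "homothety p t"
  have i: "i < d" and ks: "set ks \<subseteq> {..<d}" using Cons.prems by auto
  have hq: "?h q \<in> ebox d p R" using homothety_ebox[OF p t Cons.prems(2)] .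
  have "has_partial i ?F (partial_deriv i ?F (?h q)) (?h q)"
    by (rule smooth_has_partial[OF smooth_iter_partial[OF v ks] i hq])
  then have F: "((\<lambda>s. ?F ((?h q)(i := s))) has_vector_derivative partial_deriv i ?F (?h q)) (at (p i + t * (q i - p i)))"
    by (simp add: homothety_def)
  have "((\<lambda>s. p i + t * (s - p i)) has_vector_derivative t) (at (q i))"
    by (auto intro!: derivative_eq_intros simp: has_real_derivative_iff_has_vector_derivative[symmetric])
  from vector_diff_chain_at[OF this F]
  have "((\<lambda>s. ?F (?h (q(i := s)))) has_vector_derivative t *\<^sub>R partial_deriv i ?F (?h q)) (at (q i))"
    by (simp add: o_def homothety_upd)
  then have "has_partial i (\<lambda>q. complex_of_real (t ^ length ks) * ?F (?h q))
       (complex_of_real (t ^ length ks) * (t *\<^sub>R partial_deriv i ?F (?h q))) q"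
    by (rule bounded_linear.has_vector_derivative[OF bounded_linear_mult_right])
  then have "partial_deriv i (\<lambda>q. complex_of_real (t ^ length ks) * ?F (?h q)) q =
       complex_of_real (t ^ length ks) * (t *\<^sub>R partial_deriv i ?F (?h q))"
    by (rule has_partial_imp)
  moreover have "partial_deriv i (iter_partial ks (\<lambda>q. v (?h q))) q = partial_deriv i (\<lambda>q. complex_of_real (t ^ length ks) * ?F (?h q)) q"
    by (rule partial_deriv_cong[OF open_ES_ebox Cons.prems(2) i]) (rule Cons.IH[OF ks])
  ultimately show ?case by (simp add: scaleR_conv_of_real)
qed simp

lemma locally_bounded_family_homothety:
  fixes v :: "(nat \<Rightarrow> real) \<Rightarrow> complex"
  assumes p: "p \<in> ES d" and R: "0 < R" and v: "smooth_on_open d (ebox d p R) v"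
  shows "locally_bounded_family d (ebox d p R) ((\<lambda>t q. v (homothety p t q)) ` {0..1})"
  unfolding locally_bounded_family_def
proof (intro conjI ballI allI impI)
  fix b assume "b \<in> (\<lambda>t q. v (homothety p t q)) ` {0..1}"
  then obtain t where t: "t \<in> {0..1}" and b: "b = (\<lambda>q. v (homothety p t q))" by auto
  show "smooth_on_open d (ebox d p R) b"
    unfolding b
  proof (rule smooth_compose[OF open_ES_ebox open_ES_ebox _ v])
    show "smooth_on_open d (ebox d p R) (\<lambda>x. homothety p t x j)" for j
      unfolding homothety_def
      by (intro smooth_add smooth_cmult smooth_diff smooth_const smooth_coord open_ES_ebox)
  qed (use homothety_ebox p t in blast)
next
  fix ks x assume ks: "set ks \<subseteq> {..<d}" and x: "x \<in> ebox d p R"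
  obtain r R' where r: "0 < r" "R' < R" "ebox d x r \<subseteq> ecbox d p R'"
    by (rule ebox_shrink[OF x R])
  have sub: "ecbox d p R' \<subseteq> ebox d p R" by (rule ecbox_subset_ebox[OF r(2)])
  obtain M where M: "0 \<le> M" "\<And>y. y \<in> ecbox d p R' \<Longrightarrow> norm (iter_partial ks v y) \<le> M"
    using cont_ES_bounded_on_compact[OF open_ES_ebox smooth_cont[OF open_ES_ebox smooth_iter_partial[OF v ks]] compactin_ecbox sub] by blast
  show "\<exists>r>0. \<exists>M. ebox d x r \<subseteq> ebox d p R \<and>
      (\<forall>b\<in>(\<lambda>t q. v (homothety p t q)) ` {0..1}. \<forall>y\<in>ebox d x r. norm (iter_partial ks b y) \<le> M)"
  proof (rule exI[of _ r], intro conjI r(1), rule exI[of _ M], intro conjI ballI)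
    show "ebox d x r \<subseteq> ebox d p R" using r(3) sub by blast
    fix b y assume "b \<in> (\<lambda>t q. v (homothety p t q)) ` {0..1}" and y: "y \<in> ebox d x r"
    then obtain t where t: "t \<in> {0..1}" and b: "b = (\<lambda>q. v (homothety p t q))" by auto
    have yc: "y \<in> ecbox d p R'" using y r(3) by blast
    have "norm (iter_partial ks b y) = \<bar>t ^ length ks\<bar> * norm (iter_partial ks v (homothety p t y))"
      using iter_partial_homothety[OF p v t ks] yc sub unfolding b by (auto simp: norm_mult norm_power power_abs)
    also have "\<dots> \<le> 1 * M"
      using t M homothety_ecbox[OF p t yc] by (intro mult_mono) (auto simp: power_le_one)
    finally show "norm (iter_partial ks b y) \<le> M" by simp
  qed
qed

lemma hadamard:
  fixes v :: "(nat \<Rightarrow> real) \<Rightarrow> complex"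
  assumes p: "p \<in> ES d" and R: "0 < R" and v: "smooth_on_open d (ebox d p R) v"
  obtains g where "\<And>i. i < d \<Longrightarrow> smooth_on_open d (ebox d p R) (g i)"
    "\<And>q. q \<in> ebox d p R \<Longrightarrow> v q = v p + (\<Sum>i<d. (q i - p i) *\<^sub>R g i q)"
    "\<And>i. i < d \<Longrightarrow> g i p = partial_deriv i v p"
proof -
  let ?W = "ebox d p R"
  define g where "g = (\<lambda>i q. integral {0..1} (\<lambda>t. partial_deriv i v (homothety p t q)))"
  have sm: "smooth_on_open d ?W (partial_deriv i v)" if "i < d" for i
    by (rule smooth_partial_deriv[OF v that])
  have cont: "continuous_on {0..1} (\<lambda>t. w (homothety p t q))" if "smooth_on_open d ?W w" "q \<in> ?W"
    for w :: "(nat \<Rightarrow> real) \<Rightarrow> complex" and q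
  proof (rule cont_ES_along_curve[OF open_ES_ebox smooth_cont[OF open_ES_ebox that(1)]])
    show "continuous_on {0..1} (\<lambda>t. homothety p t q i)" for i
      unfolding homothety_def by (intro continuous_intros)
  qed (use homothety_ebox[OF p _ that(2)] in blast)
  have int: "((\<lambda>t. partial_deriv i v (homothety p t q)) has_integral g i q) {0..1}" if "i < d" "q \<in> ?W" for i q
    unfolding g_def by (rule integrable_integral[OF integrable_continuous_interval[OF cont[OF sm[OF that(1)] that(2)]]])
  have "smooth_on_open d ?W (g i)" if i: "i < d" for i
  proof (rule dominated_smooth[OF open_ES_ebox locally_bounded_family_homothety[OF p R sm[OF i]], of 1])
    show "dominated ?W 1 ((\<lambda>t q. partial_deriv i v (homothety p t q)) ` {0..1}) (g i)"
      unfolding dominated_def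
    proof (intro allI impI)
      fix xs :: "(complex \<times> (nat \<Rightarrow> real)) list" and B :: real
      assume xs: "snd ` set xs \<subseteq> ?W" and B: "0 \<le> B"
        "\<forall>b\<in>(\<lambda>t q. partial_deriv i v (homothety p t q)) ` {0..1}. norm (lcomb xs b) \<le> B"
      have "((\<lambda>t. lcomb xs (\<lambda>q. partial_deriv i v (homothety p t q))) has_integral lcomb xs (g i)) {0..1}"
        using xs
      proof (induction xs)
        case (Cons cs xs)
        obtain c s where cs: "cs = (c, s)" by (cases cs)
        have "((\<lambda>t. partial_deriv i v (homothety p t s)) has_integral g i s) {0..1}"
          using Cons.prems cs by (intro int i) auto
        then have "((\<lambda>t. c * partial_deriv i v (homothety p t s)) has_integral c * g i s) {0..1}"
          by (rule has_integral_mult_right)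
        from has_integral_add[OF this Cons.IH] Cons.prems show ?case by (simp add: cs)
      qed simp
      then have "norm (lcomb xs (g i)) \<le> B * measure lborel (cbox (0::real) 1)"
        using B by (intro has_integral_bound[of B "\<lambda>t. lcomb xs (\<lambda>q. partial_deriv i v (homothety p t q))"]) auto
      then show "norm (lcomb xs (g i)) \<le> 1 * B" by simp
    qed
  qed simp
  moreover have "v q = v p + (\<Sum>i<d. (q i - p i) *\<^sub>R g i q)" if q: "q \<in> ?W" for q
  proof -
    have qES: "q \<in> ES d" using q by (simp add: ebox_def)
    have ftc: "((\<lambda>t. \<Sum>i<d. (q i - p i) *\<^sub>R partial_deriv i v (homothety p t q)) has_integral
        (v (homothety p 1 q) - v (homothety p 0 q))) {0..1}"
    proof (rule fundamental_theorem_of_calculus)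
      fix t :: real assume t: "t \<in> {0..1}"
      have "((\<lambda>t. v (homothety p t q)) has_vector_derivative (\<Sum>i<d. (q i - p i) *\<^sub>R partial_deriv i v (homothety p t q))) (at t)"
      proof (rule chain_rule_ES[OF open_ES_ebox, where \<delta> = 1])
        show "cont_ES d (ebox d p R) (partial_deriv k v)" if "k < d" for k
          by (rule smooth_cont[OF open_ES_ebox sm[OF that]])
        show "((\<lambda>t. homothety p t q k) has_real_derivative q k - p k) (at t)" for k
          unfolding homothety_def by (auto intro!: derivative_eq_intros)
      qed (use smooth_has_partial[OF v] homothety_ebox[OF p t q] homothety_ES[OF p qES] in \<open>simp_all del: fun_upd_apply\<close>)
      then show "((\<lambda>t. v (homothety p t q)) has_vector_derivative (\<Sum>i<d. (q i - p i) *\<^sub>R partial_deriv i v (homothety p t q))) (at t within {0..1})"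
        by (rule has_vector_derivative_at_within)
    qed simp
    have "((\<lambda>t. \<Sum>i<d. (q i - p i) *\<^sub>R partial_deriv i v (homothety p t q)) has_integral (\<Sum>i<d. (q i - p i) *\<^sub>R g i q)) {0..1}"
      by (intro has_integral_sum finite_lessThan has_integral_cmul int q) auto
    from has_integral_unique[OF ftc this] have "v q - v p = (\<Sum>i<d. (q i - p i) *\<^sub>R g i q)"
      by simp
    then show ?thesis by (simp add: algebra_simps)
  qed
  moreover have "g i p = partial_deriv i v p" if "i < d" for i
    by (simp add: g_def)
  ultimately show thesis using that by blast
qed

definition flat_exp :: "nat \<Rightarrow> real \<Rightarrow> real" where
  "flat_exp k t = (if 0 < t then exp (- (1 / t)) / t ^ k else 0)"

lemma flat_exp_right_tendsto: "(flat_exp k \<longlongrightarrow> 0) (at_right 0)"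
proof -
  have "((\<lambda>t. (inverse t) ^ k / exp (inverse t)) \<longlongrightarrow> 0) (at_right (0::real))"
    by (rule filterlim_compose[OF tendsto_power_div_exp_0 filterlim_inverse_at_top_right])
  moreover have "\<forall>\<^sub>F t in at_right (0::real). (inverse t) ^ k / exp (inverse t) = flat_exp k t"
    unfolding eventually_at_right_field
    by (intro exI[of _ 1]) (auto simp: flat_exp_def exp_minus field_simps)
  ultimately show ?thesis by (rule Lim_transform_eventually)
qed

lemma flat_exp_tendsto: "(flat_exp k \<longlongrightarrow> 0) (at 0)"
proof -
  have "(flat_exp k \<longlongrightarrow> 0) (at_left 0)"
  proof (rule Lim_transform_eventually[OF tendsto_const])
    show "\<forall>\<^sub>F t in at_left 0. 0 = flat_exp k t"
      unfolding eventually_at_left_field by (intro exI[of _ "-1"]) (auto simp: flat_exp_def)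
  qed
  then show ?thesis using flat_exp_right_tendsto by (simp add: filterlim_at_split)
qed

lemma flat_exp_has_derivative:
  "(flat_exp k has_real_derivative (flat_exp (k + 2) t - real k * flat_exp (k + 1) t)) (at t)"
proof -
  consider "t > 0" | "t < 0" | "t = 0" by linarith
  then show ?thesis
  proof cases
    case 1
    have "((\<lambda>t. exp (- (1 / t)) / t ^ k) has_real_derivative (flat_exp (k + 2) t - real k * flat_exp (k + 1) t)) (at t)"
      using 1
      apply (cases k)
       apply (auto intro!: derivative_eq_intros simp: flat_exp_def field_simps power2_eq_square)
      subgoal for n by (cases n) auto
      done
    then show ?thesis
      by (rule has_field_derivative_transform_within_open[of _ _ _ "{0<..}"]) (use 1 in \<open>auto simp: flat_exp_def\<close>)
  next
    case 2
    have "((\<lambda>t. 0) has_real_derivative (flat_exp (k + 2) t - real k * flat_exp (k + 1) t)) (at t)"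
      using 2 by (simp add: flat_exp_def)
    then show ?thesis
      by (rule has_field_derivative_transform_within_open[of _ _ _ "{..<0}"]) (use 2 in \<open>auto simp: flat_exp_def\<close>)
  next
    case 3
    have "((\<lambda>h. (flat_exp k (0 + h) - flat_exp k 0) / h) \<longlongrightarrow> 0) (at 0)"
    proof (rule Lim_transform_eventually[OF flat_exp_tendsto[of "k + 1"]])
      show "\<forall>\<^sub>F h in at 0. flat_exp (k + 1) h = (flat_exp k (0 + h) - flat_exp k 0) / h"
        by (rule always_eventually) (auto simp: flat_exp_def)
    qed
    then show ?thesis by (simp add: 3 DERIV_def flat_exp_def)
  qed
qed

lemma smooth_flat_exp: "smooth_on_open 1 (ES 1) (\<lambda>z. flat_exp k (z 0))"
proof -
  have op: "open_ES 1 (ES 1)" by simp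
  have hp: "has_partial i (\<lambda>z. flat_exp k (z 0)) (flat_exp (k + 2) (z 0) - real k * flat_exp (k + 1) (z 0)) z"
    if "i < 1" for i k z
    using flat_exp_has_derivative[of k "z 0"] that by (simp add: has_real_derivative_iff_has_vector_derivative)
  have "cont_ES 1 (ES 1) (\<lambda>z. flat_exp k (z 0))" for k
    unfolding cont_ES_def
  proof (intro ballI allI impI)
    fix x and e :: real assume x: "x \<in> ES 1" and e: "0 < e"
    have "isCont (flat_exp k) (x 0)" using flat_exp_has_derivative DERIV_isCont by blast
    then obtain r where r: "0 < r" "\<And>y. dist y (x 0) < r \<Longrightarrow> dist (flat_exp k y) (flat_exp k (x 0)) < e"
      using e unfolding continuous_at_eps_delta by (auto simp: dist_real_def)
    then show "\<exists>r>0. \<forall>y\<in>ebox 1 x r. y \<in> ES 1 \<and> dist (flat_exp k (y 0)) (flat_exp k (x 0)) < e"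
      by (intro exI[of _ r]) (auto simp: ebox_def dist_real_def)
  qed
  then have "Ck_on 1 (ES 1) n (\<lambda>z. flat_exp k (z 0))" for n k
  proof (induction n arbitrary: k)
    case (Suc n)
    show ?case
    proof (rule Ck_on_SucI[where g = "\<lambda>i z. flat_exp (k + 2) (z 0) + (- real k) * flat_exp (k + 1) (z 0)"])
      show "Ck_on 1 (ES 1) n (\<lambda>z. flat_exp (k + 2) (z 0) + (- real k) * flat_exp (k + 1) (z 0))"
        using Suc by (intro Ck_on_add Ck_on_bilinear[OF op bounded_bilinear_mult] Ck_on_const op) auto
      show "has_partial i (\<lambda>z. flat_exp k (z 0)) (flat_exp (k + 2) (x 0) + (- real k) * flat_exp (k + 1) (x 0)) x"
        if "i < 1" for i x
        using hp[OF that, of k x] by (simp del: fun_upd_apply)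
    qed (use Suc.prems in blast)
  qed simp
  then show ?thesis unfolding smooth_on_open_iff_Ck[OF op] by blast
qed

lemma bump_function:
  assumes p: "p \<in> ES d" and r: "0 < r"
  obtains \<beta> :: "(nat \<Rightarrow> real) \<Rightarrow> real"
    where "smooth_on_open d (ES d) \<beta>" "\<beta> p = 1" "\<And>y. y \<in> ES d \<Longrightarrow> y \<notin> ecbox d p r \<Longrightarrow> \<beta> y = 0"
proof -
  define q where "q = (\<lambda>y. r * r - (\<Sum>i<d. (y i - p i) * (y i - p i)))"
  have op: "open_ES d (ES d)" "open_ES 1 (ES 1)" by auto
  have q: "smooth_on_open d (ES d) q"
    unfolding q_def
    by (intro smooth_diff smooth_sum smooth_mult smooth_const smooth_coord op finite_lessThan)
  define \<iota> :: "(nat \<Rightarrow> real) \<Rightarrow> nat \<Rightarrow> real" where "\<iota> = (\<lambda>y j. if j = 0 then q y else 0)"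
  define \<beta> where "\<beta> = (\<lambda>y. exp (1 / (r * r)) * flat_exp 0 (\<iota> y 0))"
  show thesis
  proof (rule that[of \<beta>])
    have s\<iota>: "smooth_on_open d (ES d) (\<lambda>y. \<iota> y j)" for j
      using q smooth_const[OF op(1)] by (cases "j = 0") (simp_all add: \<iota>_def)
    show "smooth_on_open d (ES d) \<beta>"
      unfolding \<beta>_def
      by (intro smooth_cmult op smooth_compose[OF op _ smooth_flat_exp] s\<iota>) (auto simp: \<iota>_def in_ES_iff)
    show "\<beta> p = 1" using r by (simp add: \<beta>_def \<iota>_def q_def flat_exp_def flip: exp_add)
    fix y assume y: "y \<in> ES d" "y \<notin> ecbox d p r"
    then obtain i where i: "i < d" "\<not> \<bar>y i - p i\<bar> \<le> r" by (auto simp: ecbox_def)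
    have "r * r \<le> \<bar>y i - p i\<bar> * \<bar>y i - p i\<bar>" using i r by (intro mult_mono) auto
    also have "\<dots> = (y i - p i) * (y i - p i)" by simp
    also have "\<dots> \<le> (\<Sum>i<d. (y i - p i) * (y i - p i))" using i by (intro member_le_sum) auto
    finally have "\<not> 0 < q y" by (simp add: q_def)
    then show "\<beta> y = 0" by (simp add: \<beta>_def \<iota>_def flat_exp_def)
  qed
qed

lemma open_ES_preimage:
  assumes W: "open_ES d W" and V: "open_ES m V" and c: "\<And>j. j < m \<Longrightarrow> cont_ES d W (\<lambda>x. g x j)"
    and g: "\<And>x. x \<in> W \<Longrightarrow> g x \<in> ES m"
  shows "open_ES d {x \<in> W. g x \<in> V}"
  unfolding open_ES_iff
proof (intro conjI ballI)
  show "{x \<in> W. g x \<in> V} \<subseteq> ES d" using openin_subset[OF W] by blast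
  fix x assume "x \<in> {x \<in> W. g x \<in> V}"
  then have x: "x \<in> W" "g x \<in> V" by auto
  obtain r where r: "0 < r" "ebox m (g x) r \<subseteq> V" using V x unfolding open_ES_iff by meson
  have "\<exists>s>0. \<forall>y\<in>ebox d x s. y \<in> W \<and> dist (g y j) (g x j) < r" if "j < m" for j
    using c[OF that] x r(1) unfolding cont_ES_def by blast
  then obtain s where s: "\<And>j. j < m \<Longrightarrow> 0 < s j" "\<And>j y. j < m \<Longrightarrow> y \<in> ebox d x (s j) \<Longrightarrow> dist (g y j) (g x j) < r"
    by metis
  obtain s0 where s0: "0 < s0" "\<And>k. k \<in> {..<m} \<Longrightarrow> s0 \<le> s k"
    using finite_min_pos[of "{..<m}" s] s(1) by auto
  obtain sW where sW: "0 < sW" "ebox d x sW \<subseteq> W" using W x unfolding open_ES_iff by meson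
  have "ebox d x (min s0 sW) \<subseteq> {x \<in> W. g x \<in> V}"
  proof
    fix y assume y: "y \<in> ebox d x (min s0 sW)"
    have yW: "y \<in> W" using y sW(2) ebox_mono[of "min s0 sW" sW d x] by auto
    have "dist (g y j) (g x j) < r" if "j < m" for j
    proof (rule s(2)[OF that])
      show "y \<in> ebox d x (s j)" using y s0(2)[of j] that by (auto simp: ebox_def intro: less_le_trans)
    qed
    then have "g y \<in> ebox m (g x) r"
      using g[OF yW] by (auto simp: ebox_def dist_real_def)
    then show "y \<in> {x \<in> W. g x \<in> V}" using r(2) yW by blast
  qed
  then show "\<exists>r>0. ebox d x r \<subseteq> {x \<in> W. g x \<in> V}"
    using s0(1) sW(1) by (intro exI[of _ "min s0 sW"]) auto
qed

text \<open>Points of \<open>\<real>\<^sup>d \<times> \<real>\<^sup>e\<close> are coded as points of \<open>\<real>\<^sup>d\<^sup>+\<^sup>e\<close>, as in \<^const>\<open>prod_manifold\<close>.\<close>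

definition fst_ES :: "nat \<Rightarrow> (nat \<Rightarrow> real) \<Rightarrow> nat \<Rightarrow> real" where
  "fst_ES d z = (\<lambda>i. if i < d then z i else 0)"

definition snd_ES :: "nat \<Rightarrow> (nat \<Rightarrow> real) \<Rightarrow> nat \<Rightarrow> real" where
  "snd_ES d z = (\<lambda>i. z (i + d))"

definition pair_ES :: "nat \<Rightarrow> (nat \<Rightarrow> real) \<Rightarrow> (nat \<Rightarrow> real) \<Rightarrow> nat \<Rightarrow> real" where
  "pair_ES d a b = (\<lambda>k. if k < d then a k else b (k - d))"

definition prod_ES :: "nat \<Rightarrow> nat \<Rightarrow> (nat \<Rightarrow> real) set \<Rightarrow> (nat \<Rightarrow> real) set \<Rightarrow> (nat \<Rightarrow> real) set" where
  "prod_ES d e W W' = {z \<in> ES (d + e). fst_ES d z \<in> W \<and> snd_ES d z \<in> W'}"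

lemma fst_ES_in_ES: "fst_ES d z \<in> ES d" by (simp add: fst_ES_def in_ES_iff)
lemma snd_ES_in_ES: "z \<in> ES (d + e) \<Longrightarrow> snd_ES d z \<in> ES e" by (simp add: snd_ES_def in_ES_iff)
lemma fst_pair_ES [simp]: "a \<in> ES d \<Longrightarrow> fst_ES d (pair_ES d a b) = a" by (auto simp: fst_ES_def pair_ES_def in_ES_iff fun_eq_iff)
lemma snd_pair_ES [simp]: "snd_ES d (pair_ES d a b) = b" by (auto simp: snd_ES_def pair_ES_def)
lemma pair_fst_snd_ES [simp]: "pair_ES d (fst_ES d z) (snd_ES d z) = z" by (auto simp: fst_ES_def snd_ES_def pair_ES_def)
lemma pair_ES_in_ES: "b \<in> ES e \<Longrightarrow> pair_ES d a b \<in> ES (d + e)" by (auto simp: pair_ES_def in_ES_iff)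

lemma pair_in_prod_ES: "a \<in> W \<Longrightarrow> b \<in> W' \<Longrightarrow> W \<subseteq> ES d \<Longrightarrow> W' \<subseteq> ES e \<Longrightarrow> pair_ES d a b \<in> prod_ES d e W W'"
  by (auto simp: prod_ES_def pair_ES_in_ES subset_iff)

lemma pair_ES_upd_fst: "i < d \<Longrightarrow> (pair_ES d a b)(i := t) = pair_ES d (a(i := t)) b"
  by (auto simp: pair_ES_def)

lemma pair_ES_upd_snd: "(pair_ES d a b)(d + i := t) = pair_ES d a (b(i := t))"
  by (auto simp: pair_ES_def fun_eq_iff)

lemma open_prod_ES:
  assumes "open_ES d W" "open_ES e W'"
  shows "open_ES (d + e) (prod_ES d e W W')"
proof -
  have op: "open_ES (d + e) (ES (d + e))" by simp
  have "cont_ES (d + e) (ES (d + e)) (\<lambda>z. fst_ES d z j)" for j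
    unfolding fst_ES_def by (cases "j < d") (auto intro: cont_ES_coord cont_ES_const)
  then have 1: "open_ES (d + e) {z \<in> ES (d + e). fst_ES d z \<in> W}"
    by (intro open_ES_preimage[OF op assms(1)] fst_ES_in_ES)
  have "cont_ES (d + e) (ES (d + e)) (\<lambda>z. snd_ES d z j)" for j
    unfolding snd_ES_def by (intro cont_ES_coord op)
  then have 2: "open_ES (d + e) {z \<in> ES (d + e). snd_ES d z \<in> W'}"
    by (intro open_ES_preimage[OF op assms(2)] snd_ES_in_ES)
  have "prod_ES d e W W' = {z \<in> ES (d + e). fst_ES d z \<in> W} \<inter> {z \<in> ES (d + e). snd_ES d z \<in> W'}"
    by (auto simp: prod_ES_def)
  with openin_Int[OF 1 2] show ?thesis by simp
qed

lemma smooth_fst_ES: "open_ES n W \<Longrightarrow> smooth_on_open n W (\<lambda>z. fst_ES d z j)"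
  unfolding fst_ES_def by (cases "j < d") (auto intro: smooth_coord smooth_const)

lemma smooth_snd_ES: "open_ES n W \<Longrightarrow> smooth_on_open n W (\<lambda>z. snd_ES d z j)"
  unfolding snd_ES_def by (intro smooth_coord)

lemma smooth_pair_ES:
  assumes "open_ES n W" "\<And>j. j < d \<Longrightarrow> smooth_on_open n W (\<lambda>x. g x j)" "\<And>j. j < e \<Longrightarrow> smooth_on_open n W (\<lambda>x. h x j)"
    "k < d + e"
  shows "smooth_on_open n W (\<lambda>x. pair_ES d (g x) (h x) k)"
  unfolding pair_ES_def using assms by (cases "k < d") auto

lemma iter_partial_pair_ES:
  "set ks \<subseteq> {..<d} \<Longrightarrow> iter_partial ks (\<lambda>a. F (pair_ES d a b)) a = iter_partial ks F (pair_ES d a b)"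
proof (induction ks arbitrary: a)
  case (Cons i ks)
  then have "iter_partial ks (\<lambda>a. F (pair_ES d a b)) = (\<lambda>a. iter_partial ks F (pair_ES d a b))" by auto
  moreover have "pair_ES d a b i = a i" "i < d" using Cons.prems by (auto simp: pair_ES_def)
  ultimately show ?case by (simp add: partial_deriv_def pair_ES_upd_fst)
qed simp

section \<open>Smooth parametrisations of manifolds and Lie groups\<close>

definition param :: "'a manifold \<Rightarrow> nat \<Rightarrow> (nat \<Rightarrow> real) set \<Rightarrow> ((nat \<Rightarrow> real) \<Rightarrow> 'a) \<Rightarrow> bool" where
  "param M d W \<Phi> \<longleftrightarrow> open_ES d W \<and> (\<forall>x\<in>W. \<Phi> x \<in> topspace (mtop M)) \<and>
     (\<forall>T. openin (mtop M) T \<longrightarrow> open_ES d {x \<in> W. \<Phi> x \<in> T}) \<and>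
     (\<forall>U \<phi> i. (U, \<phi>) \<in> atlas M \<longrightarrow> i < mdim M \<longrightarrow> smooth_on_open d {x \<in> W. \<Phi> x \<in> U} (\<lambda>x. \<phi> (\<Phi> x) i))"

lemma paramD:
  assumes "param M d W \<Phi>"
  shows "open_ES d W" "\<And>x. x \<in> W \<Longrightarrow> \<Phi> x \<in> topspace (mtop M)" "\<And>T. openin (mtop M) T \<Longrightarrow> open_ES d {x \<in> W. \<Phi> x \<in> T}"
    "\<And>U \<phi> i. (U, \<phi>) \<in> atlas M \<Longrightarrow> i < mdim M \<Longrightarrow> smooth_on_open d {x \<in> W. \<Phi> x \<in> U} (\<lambda>x. \<phi> (\<Phi> x) i)"
  using assms unfolding param_def by blast+

context smooth_manifold
begin

lemma chart_subset: "(U, \<phi>) \<in> atlas M \<Longrightarrow> U \<subseteq> topspace (mtop M)"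
  using chart_domain openin_subset by blast

lemma chart_image_ES: "(U, \<phi>) \<in> atlas M \<Longrightarrow> \<phi> ` U \<subseteq> ES (mdim M)"
  using chart_image openin_subset by blast

lemma chart_inj: "(U, \<phi>) \<in> atlas M \<Longrightarrow> inj_on \<phi> U"
  using homeomorphic_imp_injective_map[OF chart_homeomorphic] chart_subset by (metis inf.absorb2 topspace_subtopology)

lemma chart_inv [simp]: "(U, \<phi>) \<in> atlas M \<Longrightarrow> x \<in> U \<Longrightarrow> inv_into U \<phi> (\<phi> x) = x"
  by (simp add: chart_inj inv_into_f_f)

lemma chart_exists: "x \<in> topspace (mtop M) \<Longrightarrow> \<exists>U \<phi>. (U, \<phi>) \<in> atlas M \<and> x \<in> U"
  using atlas_cover by (metis (no_types, lifting) UN_E case_prod_beta prod.collapse)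

lemma chart_open_image:
  assumes "(U, \<phi>) \<in> atlas M" "openin (mtop M) T"
  shows "open_ES (mdim M) (\<phi> ` (U \<inter> T))"
proof -
  have "openin (subtopology (mtop M) U) (U \<inter> T)"
    using assms(2) by (simp add: openin_subtopology_Int2)
  then have "openin (subtopology (Euclidean_space (mdim M)) (\<phi> ` U)) (\<phi> ` (U \<inter> T))"
    using homeomorphic_imp_open_map[OF chart_homeomorphic[OF assms(1)]] unfolding open_map_def by blast
  then show ?thesis using openin_open_subtopology[OF chart_image[OF assms(1)]] by blast
qed

lemma chart_open_preimage:
  assumes "(U, \<phi>) \<in> atlas M" "open_ES (mdim M) T"
  shows "openin (mtop M) {x \<in> U. \<phi> x \<in> T}"
proof -
  have c: "continuous_map (subtopology (mtop M) U) (subtopology (Euclidean_space (mdim M)) (\<phi> ` U)) \<phi>"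
    by (rule homeomorphic_imp_continuous_map[OF chart_homeomorphic[OF assms(1)]])
  have "openin (subtopology (Euclidean_space (mdim M)) (\<phi> ` U)) (\<phi> ` U \<inter> T)"
    using assms(2) by (simp add: openin_subtopology_Int2)
  from openin_continuous_map_preimage[OF c this]
  have "openin (subtopology (mtop M) U) {x \<in> topspace (subtopology (mtop M) U). \<phi> x \<in> \<phi> ` U \<inter> T}" .
  moreover have "{x \<in> topspace (subtopology (mtop M) U). \<phi> x \<in> \<phi> ` U \<inter> T} = {x \<in> U. \<phi> x \<in> T}"
    using chart_subset[OF assms(1)] by auto
  ultimately show ?thesis using openin_open_subtopology[OF chart_domain[OF assms(1)]] by simp
qed

lemma chart_compact_preimage:
  assumes "(U, \<phi>) \<in> atlas M" "compactin (Euclidean_space (mdim M)) K" "K \<subseteq> \<phi> ` U"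
  shows "compactin (mtop M) (inv_into U \<phi> ` K)"
proof -
  have "homeomorphic_map (subtopology (Euclidean_space (mdim M)) (\<phi> ` U)) (subtopology (mtop M) U) (inv_into U \<phi>)"
  proof -
    obtain g where g: "homeomorphic_maps (subtopology (mtop M) U) (subtopology (Euclidean_space (mdim M)) (\<phi> ` U)) \<phi> g"
      using chart_homeomorphic[OF assms(1)] homeomorphic_map_maps by blast
    then have "homeomorphic_map (subtopology (Euclidean_space (mdim M)) (\<phi> ` U)) (subtopology (mtop M) U) g"
      using homeomorphic_maps_map by blast
    moreover have "g y = inv_into U \<phi> y" if "y \<in> topspace (subtopology (Euclidean_space (mdim M)) (\<phi> ` U))" for y
      using g that chart_subset[OF assms(1)] chart_inv[OF assms(1)] unfolding homeomorphic_maps_def by auto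
    ultimately show ?thesis using homeomorphic_map_eq by blast
  qed
  then have "continuous_map (subtopology (Euclidean_space (mdim M)) (\<phi> ` U)) (mtop M) (inv_into U \<phi>)"
    using homeomorphic_imp_continuous_map continuous_map_in_subtopology by blast
  moreover have "compactin (subtopology (Euclidean_space (mdim M)) (\<phi> ` U)) K"
    using assms(2,3) by (simp add: compactin_subtopology)
  ultimately show ?thesis using image_compactin by blast
qed

lemma param_chart:
  assumes "(U, \<phi>) \<in> atlas M"
  shows "param M (mdim M) (\<phi> ` U) (inv_into U \<phi>)"
proof -
  have eq: "{x \<in> \<phi> ` U. inv_into U \<phi> x \<in> T} = \<phi> ` (U \<inter> T)" for T
    using chart_inv[OF assms] by auto
  show ?thesis
    unfolding param_def eq
  proof (intro conjI ballI allI impI)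
    show "inv_into U \<phi> x \<in> topspace (mtop M)" if "x \<in> \<phi> ` U" for x
      using chart_subset[OF assms] that inv_into_into[OF that] by blast
  qed (use chart_image chart_open_image chart_compatible assms in auto)
qed

lemma param_const: "open_ES d W \<Longrightarrow> x \<in> topspace (mtop M) \<Longrightarrow> param M d W (\<lambda>_. x)"
proof -
  assume W: "open_ES d W" and x: "x \<in> topspace (mtop M)"
  have op: "open_ES d {xa \<in> W. x \<in> T}" for T using W by (cases "x \<in> T") auto
  then show ?thesis unfolding param_def using W x by (auto intro!: smooth_const)
qed

lemma smooth_fun_param:
  assumes f: "smooth_fun_on M T f" and T: "openin (mtop M) T" and \<Phi>: "param M d W \<Phi>" and W: "\<And>x. x \<in> W \<Longrightarrow> \<Phi> x \<in> T"
  shows "smooth_on_open d W (\<lambda>x. f (\<Phi> x))"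
proof (rule smooth_on_open_local[OF paramD(1)[OF \<Phi>]])
  fix x assume x: "x \<in> W"
  obtain U \<phi> where U: "(U, \<phi>) \<in> atlas M" "\<Phi> x \<in> U" using chart_exists paramD(2)[OF \<Phi> x] by blast
  let ?V = "{x \<in> W. \<Phi> x \<in> U}"
  have V: "open_ES d ?V" by (rule paramD(3)[OF \<Phi> chart_domain[OF U(1)]])
  have s: "smooth_on_open (mdim M) (\<phi> ` (U \<inter> T)) (\<lambda>y. f (inv_into U \<phi> y))"
    using f U(1) unfolding smooth_fun_on_def by blast
  have "smooth_on_open d ?V (\<lambda>x. f (inv_into U \<phi> (\<phi> (\<Phi> x))))"
    by (rule smooth_compose[OF V chart_open_image[OF U(1) T] _ s]) (use W paramD(4)[OF \<Phi> U(1)] in auto)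
  then have "smooth_on_open d ?V (\<lambda>x. f (\<Phi> x))"
    by (rule smooth_on_open_cong[OF V, rotated]) (use U(1) in auto)
  then show "\<exists>V. open_ES d V \<and> x \<in> V \<and> V \<subseteq> W \<and> smooth_on_open d V (\<lambda>x. f (\<Phi> x))"
    using V x U(2) by (intro exI[of _ ?V]) auto
qed

lemma C_inf_param:
  assumes "f \<in> C_inf M" "param M d W \<Phi>"
  shows "smooth_on_open d W (\<lambda>x. f (\<Phi> x))"
  by (rule smooth_fun_param[OF _ openin_topspace assms(2) paramD(2)[OF assms(2)]]) (use assms(1) in \<open>auto simp: C_inf_def\<close>)

lemma C_inf_I:
  assumes "\<And>U \<phi>. (U, \<phi>) \<in> atlas M \<Longrightarrow> smooth_on_open (mdim M) (\<phi> ` U) (\<lambda>y. f (inv_into U \<phi> y))"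
    "\<And>x. x \<notin> topspace (mtop M) \<Longrightarrow> f x = 0"
  shows "f \<in> C_inf M"
proof -
  have "U \<inter> topspace (mtop M) = U" if "(U, \<phi>) \<in> atlas M" for U \<phi> using chart_subset[OF that] by blast
  then show ?thesis using assms unfolding C_inf_def smooth_fun_on_def by auto
qed

lemma C_inf_outside: "f \<in> C_inf M \<Longrightarrow> x \<notin> topspace (mtop M) \<Longrightarrow> f x = 0"
  by (simp add: C_inf_def)

lemma C_inf_local:
  assumes out: "\<And>x. x \<notin> topspace (mtop M) \<Longrightarrow> f x = 0"
    and loc: "\<And>x. x \<in> topspace (mtop M) \<Longrightarrow> \<exists>T. openin (mtop M) T \<and> x \<in> T \<and> smooth_fun_on M T f"
  shows "f \<in> C_inf M"
proof (rule C_inf_I)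
  fix U \<phi> assume U: "(U, \<phi>) \<in> atlas M"
  show "smooth_on_open (mdim M) (\<phi> ` U) (\<lambda>y. f (inv_into U \<phi> y))"
  proof (rule smooth_on_open_local[OF chart_image[OF U]])
    fix y assume "y \<in> \<phi> ` U"
    then obtain x where x: "x \<in> U" "y = \<phi> x" by blast
    then obtain T where T: "openin (mtop M) T" "x \<in> T" "smooth_fun_on M T f" using loc chart_subset[OF U] by blast
    then show "\<exists>V. open_ES (mdim M) V \<and> y \<in> V \<and> V \<subseteq> \<phi> ` U \<and> smooth_on_open (mdim M) V (\<lambda>y. f (inv_into U \<phi> y))"
      using chart_open_image[OF U T(1)] x U unfolding smooth_fun_on_def
      by (intro exI[of _ "\<phi> ` (U \<inter> T)"]) auto
  qed
qed (rule out)

lemma C_inf_chart: "f \<in> C_inf M \<Longrightarrow> (U, \<phi>) \<in> atlas M \<Longrightarrow> smooth_on_open (mdim M) (\<phi> ` U) (\<lambda>y. f (inv_into U \<phi> y))"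
  by (rule C_inf_param[OF _ param_chart])

lemma C_inf_add: "f \<in> C_inf M \<Longrightarrow> g \<in> C_inf M \<Longrightarrow> (\<lambda>x. f x + g x) \<in> C_inf M"
  by (rule C_inf_I, rule smooth_add[OF chart_image C_inf_chart C_inf_chart]) (simp_all add: C_inf_outside)

lemma C_inf_mult: "f \<in> C_inf M \<Longrightarrow> g \<in> C_inf M \<Longrightarrow> (\<lambda>x. f x * g x) \<in> C_inf M"
  by (rule C_inf_I, rule smooth_mult[OF chart_image C_inf_chart C_inf_chart]) (simp_all add: C_inf_outside)

lemma C_inf_cmult: "f \<in> C_inf M \<Longrightarrow> (\<lambda>x. c * f x) \<in> C_inf M"
  by (rule C_inf_I, rule smooth_cmult[OF chart_image C_inf_chart]) (simp_all add: C_inf_outside)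

lemma C_inf_sum: "finite I \<Longrightarrow> (\<And>i. i \<in> I \<Longrightarrow> f i \<in> C_inf M) \<Longrightarrow> (\<lambda>x. \<Sum>i\<in>I. f i x) \<in> C_inf M"
  by (rule C_inf_I, rule smooth_sum[OF chart_image _ C_inf_chart]) (simp_all add: C_inf_outside)

lemma C_inf_cnj: "f \<in> C_inf M \<Longrightarrow> (\<lambda>x. cnj (f x)) \<in> C_inf M"
  by (rule C_inf_I, rule smooth_bounded_linear[OF chart_image bounded_linear_cnj C_inf_chart]) (simp_all add: C_inf_outside)

lemma C_inf_const: "restrict0 (topspace (mtop M)) (\<lambda>x. c) \<in> C_inf M"
proof (rule C_inf_I)
  fix U \<phi> assume U: "(U, \<phi>) \<in> atlas M"
  show "smooth_on_open (mdim M) (\<phi> ` U) (\<lambda>y. restrict0 (topspace (mtop M)) (\<lambda>x. c) (inv_into U \<phi> y))"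
    by (rule smooth_on_open_cong[OF chart_image[OF U] _ smooth_const[OF chart_image[OF U], of c]])
      (use paramD(2)[OF param_chart[OF U]] in \<open>auto simp: restrict0_def\<close>)
qed (simp add: restrict0_def)

lemma C_inf_param_restrict0:
  assumes "\<And>U \<phi>. (U, \<phi>) \<in> atlas M \<Longrightarrow> smooth_on_open (mdim M) (\<phi> ` U) (\<lambda>y. f (inv_into U \<phi> y))"
  shows "restrict0 (topspace (mtop M)) f \<in> C_inf M"
proof (rule C_inf_I)
  fix U \<phi> assume U: "(U, \<phi>) \<in> atlas M"
  show "smooth_on_open (mdim M) (\<phi> ` U) (\<lambda>y. restrict0 (topspace (mtop M)) f (inv_into U \<phi> y))"
    by (rule smooth_on_open_cong[OF chart_image[OF U] _ assms[OF U]])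
      (use paramD(2)[OF param_chart[OF U]] in \<open>auto simp: restrict0_def\<close>)
qed (simp add: restrict0_def)

end

lemma param_compose:
  assumes \<Phi>: "param M m W' \<Phi>" and W: "open_ES d W" and g: "\<And>x. x \<in> W \<Longrightarrow> g x \<in> W'"
    and sg: "\<And>j. j < m \<Longrightarrow> smooth_on_open d W (\<lambda>x. g x j)"
    and dom: "\<And>U \<phi>. (U, \<phi>) \<in> atlas M \<Longrightarrow> openin (mtop M) U"
  shows "param M d W (\<lambda>x. \<Phi> (g x))"
proof -
  have gES: "g x \<in> ES m" if "x \<in> W" for x using g[OF that] openin_subset[OF paramD(1)[OF \<Phi>]] by blast
  have op: "open_ES d {x \<in> W. \<Phi> (g x) \<in> T}" if "openin (mtop M) T" for T
  proof -
    have "{x \<in> W. \<Phi> (g x) \<in> T} = {x \<in> W. g x \<in> {y \<in> W'. \<Phi> y \<in> T}}" using g by auto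
    then show ?thesis
      using open_ES_preimage[OF W paramD(3)[OF \<Phi> that] smooth_cont[OF W sg] gES] by simp
  qed
  show ?thesis
    unfolding param_def
  proof (intro conjI ballI allI impI W op)
    fix U \<phi> i assume U: "(U, \<phi>) \<in> atlas M" "i < mdim M"
    have V: "open_ES d {x \<in> W. \<Phi> (g x) \<in> U}" by (rule op[OF dom[OF U(1)]])
    show "smooth_on_open d {x \<in> W. \<Phi> (g x) \<in> U} (\<lambda>x. \<phi> (\<Phi> (g x)) i)"
      by (rule smooth_compose[OF V paramD(3)[OF \<Phi> dom[OF U(1)]] _ paramD(4)[OF \<Phi> U]])
        (use g smooth_on_open_subset[OF W V _ sg] in auto)
  qed (use g paramD(2)[OF \<Phi>] in auto)
qed

lemma smooth_mapD:
  assumes "smooth_map M N F" "(U, \<phi>) \<in> atlas M" "(V, \<psi>) \<in> atlas N" "i < mdim N"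
  shows "smooth_on_open (mdim M) (\<phi> ` {x \<in> U. F x \<in> V}) (\<lambda>y. \<psi> (F (inv_into U \<phi> y)) i)"
proof -
  have *: "\<forall>(U, \<phi>)\<in>atlas M. \<forall>(V, \<psi>)\<in>atlas N. \<forall>i<mdim N.
        smooth_on_open (mdim M) (\<phi> ` {x \<in> U. F x \<in> V}) (\<lambda>y. \<psi> (F (inv_into U \<phi> y)) i)"
    using assms(1)[unfolded smooth_map_def] by (rule conjunct2)
  show ?thesis
    using bspec[OF bspec[OF * assms(2), unfolded prod.case] assms(3), unfolded prod.case] assms(4) by blast
qed

lemma param_smooth_map:
  assumes M: "smooth_manifold M" and N: "smooth_manifold N" and F: "smooth_map M N F" and \<Phi>: "param M d W \<Phi>"
  shows "param N d W (\<lambda>x. F (\<Phi> x))"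
proof -
  interpret M: smooth_manifold M by fact
  interpret N: smooth_manifold N by fact
  have c: "continuous_map (mtop M) (mtop N) F" using F by (simp add: smooth_map_def)
  have op: "open_ES d {x \<in> W. F (\<Phi> x) \<in> T}" if "openin (mtop N) T" for T
  proof -
    have "{x \<in> W. F (\<Phi> x) \<in> T} = {x \<in> W. \<Phi> x \<in> {y \<in> topspace (mtop M). F y \<in> T}}"
      using paramD(2)[OF \<Phi>] by auto
    then show ?thesis using paramD(3)[OF \<Phi> openin_continuous_map_preimage[OF c that]] by simp
  qed
  show ?thesis
    unfolding param_def
  proof (intro conjI ballI allI impI op paramD(1)[OF \<Phi>])
    show "F (\<Phi> x) \<in> topspace (mtop N)" if "x \<in> W" for x
      using paramD(2)[OF \<Phi> that] c by (auto simp: continuous_map_def)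
    fix V \<psi> i assume V: "(V, \<psi>) \<in> atlas N" "i < mdim N"
    let ?W = "{x \<in> W. F (\<Phi> x) \<in> V}"
    show "smooth_on_open d ?W (\<lambda>x. \<psi> (F (\<Phi> x)) i)"
    proof (rule smooth_on_open_local[OF op[OF N.chart_domain[OF V(1)]]])
      fix x assume x: "x \<in> ?W"
      obtain U \<phi> where U: "(U, \<phi>) \<in> atlas M" "\<Phi> x \<in> U" using M.chart_exists paramD(2)[OF \<Phi>] x by blast
      let ?T = "{y \<in> topspace (mtop M). F y \<in> V}"
      have T: "openin (mtop M) ?T" by (rule openin_continuous_map_preimage[OF c N.chart_domain[OF V(1)]])
      have UT: "U \<inter> ?T = {y \<in> U. F y \<in> V}" using M.chart_subset[OF U(1)] by auto
      have s: "smooth_on_open (mdim M) (\<phi> ` (U \<inter> ?T)) (\<lambda>y. \<psi> (F (inv_into U \<phi> y)) i)"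
        unfolding UT by (rule smooth_mapD[OF F U(1) V])
      let ?V = "{x \<in> W. \<Phi> x \<in> U \<inter> ?T}"
      have oV: "open_ES d ?V" by (rule paramD(3)[OF \<Phi> openin_Int[OF M.chart_domain[OF U(1)] T]])
      have oU: "open_ES d {x \<in> W. \<Phi> x \<in> U}" by (rule paramD(3)[OF \<Phi> M.chart_domain[OF U(1)]])
      have "smooth_on_open d ?V (\<lambda>x. \<psi> (F (inv_into U \<phi> (\<phi> (\<Phi> x)))) i)"
      proof (rule smooth_compose[OF oV M.chart_open_image[OF U(1) T] _ s])
        show "smooth_on_open d ?V (\<lambda>x. \<phi> (\<Phi> x) j)" if "j < mdim M" for j
          by (rule smooth_on_open_subset[OF oU oV _ paramD(4)[OF \<Phi> U(1) that]]) auto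
      qed auto
      then have "smooth_on_open d ?V (\<lambda>x. \<psi> (F (\<Phi> x)) i)"
        by (rule smooth_on_open_cong[OF oV, rotated]) (use U(1) in auto)
      then show "\<exists>V'. open_ES d V' \<and> x \<in> V' \<and> V' \<subseteq> ?W \<and> smooth_on_open d V' (\<lambda>x. \<psi> (F (\<Phi> x)) i)"
        using oV x U(2) paramD(2)[OF \<Phi>] by (intro exI[of _ ?V]) auto
    qed
  qed
qed

context lie_group
begin

lemma mult_continuous: "continuous_map (prod_topology (mtop M) (mtop M)) (mtop M) (\<lambda>(x, y). x \<otimes> y)"
  using smooth_mult by (simp add: smooth_map_def prod_manifold_def)

lemma param_mult_open:
  assumes \<Phi>: "param M d W \<Phi>" and \<Psi>: "param M d W \<Psi>" and T: "openin (mtop M) T"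
  shows "open_ES d {x \<in> W. \<Phi> x \<otimes> \<Psi> x \<in> T}"
proof (subst openin_subopen, rule ballI)
  fix x assume x: "x \<in> {x \<in> W. \<Phi> x \<otimes> \<Psi> x \<in> T}"
  let ?P = "{z \<in> topspace (prod_topology (mtop M) (mtop M)). (\<lambda>(x, y). x \<otimes> y) z \<in> T}"
  have P: "openin (prod_topology (mtop M) (mtop M)) ?P"
    by (rule openin_continuous_map_preimage[OF mult_continuous T])
  have "(\<Phi> x, \<Psi> x) \<in> ?P" using x paramD(2)[OF \<Phi>] paramD(2)[OF \<Psi>] by auto
  then obtain A B where AB: "openin (mtop M) A" "openin (mtop M) B" "\<Phi> x \<in> A" "\<Psi> x \<in> B" "A \<times> B \<subseteq> ?P"
    using P unfolding openin_prod_topology_alt by meson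
  let ?V = "{x \<in> W. \<Phi> x \<in> A} \<inter> {x \<in> W. \<Psi> x \<in> B}"
  have "open_ES d ?V" by (rule openin_Int[OF paramD(3)[OF \<Phi> AB(1)] paramD(3)[OF \<Psi> AB(2)]])
  moreover have "x \<in> ?V" using x AB by auto
  moreover have "?V \<subseteq> {x \<in> W. \<Phi> x \<otimes> \<Psi> x \<in> T}"
    using AB(5) by (auto simp: subset_iff)
  ultimately show "\<exists>V. open_ES d V \<and> x \<in> V \<and> V \<subseteq> {x \<in> W. \<Phi> x \<otimes> \<Psi> x \<in> T}" by blast
qed

lemma param_mult:
  assumes \<Phi>: "param M d W \<Phi>" and \<Psi>: "param M d W \<Psi>"
  shows "param M d W (\<lambda>x. \<Phi> x \<otimes> \<Psi> x)"
  unfolding param_def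
proof (intro conjI ballI allI impI paramD(1)[OF \<Phi>] param_mult_open[OF \<Phi> \<Psi>])
  show "\<Phi> x \<otimes> \<Psi> x \<in> topspace (mtop M)" if "x \<in> W" for x
    using paramD(2)[OF \<Phi> that] paramD(2)[OF \<Psi> that] by (simp add: topspace_carrier)
  fix V \<psi> i assume V: "(V, \<psi>) \<in> atlas M" "i < mdim M"
  let ?W = "{x \<in> W. \<Phi> x \<otimes> \<Psi> x \<in> V}"
  have oW: "open_ES d ?W" by (rule param_mult_open[OF \<Phi> \<Psi> chart_domain[OF V(1)]])
  show "smooth_on_open d ?W (\<lambda>x. \<psi> (\<Phi> x \<otimes> \<Psi> x) i)"
  proof (rule smooth_on_open_local[OF oW])
    fix x assume x: "x \<in> ?W"
    obtain U1 \<phi>1 where 1: "(U1, \<phi>1) \<in> atlas M" "\<Phi> x \<in> U1" using chart_exists paramD(2)[OF \<Phi>] x by blast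
    obtain U2 \<phi>2 where 2: "(U2, \<phi>2) \<in> atlas M" "\<Psi> x \<in> U2" using chart_exists paramD(2)[OF \<Psi>] x by blast
    let ?D = "mdim M"
    define \<theta> where "\<theta> = (\<lambda>(x, y) k. if k < mdim M then \<phi>1 x k else \<phi>2 y (k - mdim M))"
    have \<theta>: "\<theta> (a, b) = pair_ES ?D (\<phi>1 a) (\<phi>2 b)" for a b by (auto simp: \<theta>_def pair_ES_def)
    have "(U1 \<times> U2, \<theta>) \<in> atlas (prod_manifold M M)"
      using 1 2 unfolding prod_manifold_def \<theta>_def by auto
    then have s: "smooth_on_open (?D + ?D) (\<theta> ` {z \<in> U1 \<times> U2. (\<lambda>(x, y). x \<otimes> y) z \<in> V})
        (\<lambda>y. \<psi> ((\<lambda>(x, y). x \<otimes> y) (inv_into (U1 \<times> U2) \<theta> y)) i)"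
      using smooth_mapD[OF lie_group.smooth_mult[OF lie_group_axioms] _ V] by (simp add: prod_manifold_def)
    let ?Q = "prod_ES ?D ?D (\<phi>1 ` U1) (\<phi>2 ` U2)"
    have oQ: "open_ES (?D + ?D) ?Q" by (rule open_prod_ES[OF chart_image[OF 1(1)] chart_image[OF 2(1)]])
    have p1: "param M (?D + ?D) ?Q (\<lambda>z. inv_into U1 \<phi>1 (fst_ES ?D z))"
      by (rule param_compose[OF param_chart[OF 1(1)] oQ _ _ chart_domain])
        (auto simp: prod_ES_def intro: smooth_fst_ES[OF oQ, unfolded prod_ES_def])
    have p2: "param M (?D + ?D) ?Q (\<lambda>z. inv_into U2 \<phi>2 (snd_ES ?D z))"
      by (rule param_compose[OF param_chart[OF 2(1)] oQ _ _ chart_domain])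
        (auto simp: prod_ES_def intro: smooth_snd_ES[OF oQ, unfolded prod_ES_def])
    have ES1: "\<phi>1 a \<in> ES ?D" if "a \<in> U1" for a using chart_image_ES[OF 1(1)] that by blast
    have ES2: "\<phi>2 a \<in> ES ?D" if "a \<in> U2" for a using chart_image_ES[OF 2(1)] that by blast
    have "\<theta> ` {z \<in> U1 \<times> U2. (\<lambda>(x, y). x \<otimes> y) z \<in> V} =
        {z \<in> ?Q. inv_into U1 \<phi>1 (fst_ES ?D z) \<otimes> inv_into U2 \<phi>2 (snd_ES ?D z) \<in> V}" (is "?L = ?R")
    proof (intro equalityI subsetI)
      fix z assume "z \<in> ?L"
      then obtain a b where ab: "a \<in> U1" "b \<in> U2" "a \<otimes> b \<in> V" "z = pair_ES ?D (\<phi>1 a) (\<phi>2 b)"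
        by (auto simp: \<theta>)
      then show "z \<in> ?R"
        using chart_inv[OF 1(1)] chart_inv[OF 2(1)] chart_image_ES[OF 1(1)] chart_image_ES[OF 2(1)]
          ES1 by (auto intro: pair_in_prod_ES)
    next
      fix z assume z: "z \<in> ?R"
      then obtain a b where ab: "a \<in> U1" "b \<in> U2" "fst_ES ?D z = \<phi>1 a" "snd_ES ?D z = \<phi>2 b"
        by (auto simp: prod_ES_def)
      then have "z = \<theta> (a, b)" using pair_fst_snd_ES[of ?D z] by (simp add: \<theta>)
      moreover have "a \<otimes> b \<in> V" using z ab chart_inv[OF 1(1)] chart_inv[OF 2(1)] by simp
      ultimately show "z \<in> ?L" using ab by auto
    qed
    then have oL: "open_ES (?D + ?D) (\<theta> ` {z \<in> U1 \<times> U2. (\<lambda>(x, y). x \<otimes> y) z \<in> V})"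
      using param_mult_open[OF p1 p2 chart_domain[OF V(1)]] by simp
    have inj: "inj_on \<theta> (U1 \<times> U2)"
    proof (rule inj_onI, clarify)
      fix a b a' b' assume *: "a \<in> U1" "b \<in> U2" "a' \<in> U1" "b' \<in> U2" "\<theta> (a, b) = \<theta> (a', b')"
      then have "fst_ES ?D (\<theta> (a, b)) = fst_ES ?D (\<theta> (a', b'))" "snd_ES ?D (\<theta> (a, b)) = snd_ES ?D (\<theta> (a', b'))" by auto
      then have "\<phi>1 a = \<phi>1 a'" "\<phi>2 b = \<phi>2 b'" using ES1 * by (auto simp: \<theta>)
      then show "a = a' \<and> b = b'" using chart_inj[OF 1(1)] chart_inj[OF 2(1)] * by (auto dest: inj_onD)
    qed
    let ?A = "{x \<in> W. \<Phi> x \<in> U1}" and ?B = "{x \<in> W. \<Psi> x \<in> U2}"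
    have oA: "open_ES d ?A" by (rule paramD(3)[OF \<Phi> chart_domain[OF 1(1)]])
    have oB: "open_ES d ?B" by (rule paramD(3)[OF \<Psi> chart_domain[OF 2(1)]])
    let ?V = "?A \<inter> ?B \<inter> ?W"
    have oV: "open_ES d ?V" by (intro openin_Int oA oB oW)
    have "smooth_on_open d ?V (\<lambda>x. \<psi> ((\<lambda>(x, y). x \<otimes> y) (inv_into (U1 \<times> U2) \<theta> (\<theta> (\<Phi> x, \<Psi> x)))) i)"
    proof (rule smooth_compose[OF oV oL _ s])
      show "smooth_on_open d ?V (\<lambda>x. \<theta> (\<Phi> x, \<Psi> x) j)" if "j < ?D + ?D" for j
        unfolding \<theta>
      proof (rule smooth_pair_ES[OF oV _ _ that])
        show "smooth_on_open d ?V (\<lambda>x. \<phi>1 (\<Phi> x) j)" if "j < ?D" for j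
          by (rule smooth_on_open_subset[OF oA oV _ paramD(4)[OF \<Phi> 1(1) that]]) auto
        show "smooth_on_open d ?V (\<lambda>x. \<phi>2 (\<Psi> x) j)" if "j < ?D" for j
          by (rule smooth_on_open_subset[OF oB oV _ paramD(4)[OF \<Psi> 2(1) that]]) auto
      qed
    qed auto
    then have "smooth_on_open d ?V (\<lambda>x. \<psi> (\<Phi> x \<otimes> \<Psi> x) i)"
      by (rule smooth_on_open_cong[OF oV, rotated]) (use inj in auto)
    then show "\<exists>V'. open_ES d V' \<and> x \<in> V' \<and> V' \<subseteq> ?W \<and> smooth_on_open d V' (\<lambda>x. \<psi> (\<Phi> x \<otimes> \<Psi> x) i)"
      using oV x 1(2) 2(2) by (intro exI[of _ ?V]) auto
  qed
qed

lemma param_inv: "param M d W \<Phi> \<Longrightarrow> param M d W (\<lambda>x. inv (\<Phi> x))"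
  using param_smooth_map[OF smooth_manifold_axioms smooth_manifold_axioms smooth_inv] .

end

lemma param_subset:
  assumes \<Phi>: "param M d W \<Phi>" and V: "open_ES d V" "V \<subseteq> W" and dom: "\<And>U \<phi>. (U, \<phi>) \<in> atlas M \<Longrightarrow> openin (mtop M) U"
  shows "param M d V \<Phi>"
  by (rule param_compose[OF \<Phi> V(1), where g = "\<lambda>x. x"]) (use V dom in \<open>auto intro: smooth_coord\<close>)

context smooth_manifold
begin

lemma ctangent_space_D:
  assumes "D \<in> ctangent_space M x" "f \<in> C_inf M" "g \<in> C_inf M"
  shows "D (\<lambda>y. f y + g y) = D f + D g" "D (\<lambda>y. c * f y) = c * D f" "D (\<lambda>y. f y * g y) = f x * D g + g x * D f"
  using assms unfolding ctangent_space_def by blast+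

lemma ctangent_space_sum:
  assumes D: "D \<in> ctangent_space M x" and "finite I" "\<And>i. i \<in> I \<Longrightarrow> f i \<in> C_inf M"
  shows "D (\<lambda>y. \<Sum>i\<in>I. f i y) = (\<Sum>i\<in>I. D (f i))"
  using assms(2,3)
proof (induction I rule: finite_induct)
  case empty
  have "(\<lambda>y. 0) \<in> C_inf M" using C_inf_cmult[OF C_inf_const, of 0] by simp
  from ctangent_space_D(2)[OF D this this, of 0] show ?case by simp
next
  case (insert i I)
  then show ?case using ctangent_space_D(1)[OF D, of "f i" "\<lambda>y. \<Sum>i\<in>I. f i y"] by (simp add: C_inf_sum)
qed

lemma smooth_fun_on_param:
  assumes "\<And>V \<phi>. (V, \<phi>) \<in> atlas M \<Longrightarrow> param M (mdim M) (\<phi> ` (V \<inter> T)) (inv_into V \<phi>) \<Longrightarrow>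
       smooth_on_open (mdim M) (\<phi> ` (V \<inter> T)) (\<lambda>y. f (inv_into V \<phi> y))"
    and T: "openin (mtop M) T"
  shows "smooth_fun_on M T f"
  unfolding smooth_fun_on_def
proof (intro ballI, clarify)
  fix V \<phi> assume V: "(V, \<phi>) \<in> atlas M"
  show "smooth_on_open (mdim M) (\<phi> ` (V \<inter> T)) (\<lambda>y. f (inv_into V \<phi> y))"
    by (intro assms(1)[OF V] param_subset[OF param_chart[OF V]] chart_open_image V T chart_domain) auto
qed

lemma C_inf_extension:
  assumes U: "(U, \<psi>) \<in> atlas M" and x: "x \<in> U" and R: "0 < R" and sub: "ebox (mdim M) (\<psi> x) R \<subseteq> \<psi> ` U"
  obtains \<beta> :: "(nat \<Rightarrow> real) \<Rightarrow> real" where "\<beta> (\<psi> x) = 1"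
    "\<And>a. smooth_on_open (mdim M) (ebox (mdim M) (\<psi> x) R) a \<Longrightarrow>
      (\<lambda>z. if z \<in> U \<and> \<psi> z \<in> ebox (mdim M) (\<psi> x) R then \<beta> (\<psi> z) *\<^sub>R a (\<psi> z) else 0 :: complex) \<in> C_inf M"
proof -
  let ?d = "mdim M" and ?p = "\<psi> x" and ?k = "inv_into U \<psi>"
  have p: "?p \<in> ES ?d" using chart_image_ES[OF U] x by blast
  obtain \<beta> :: "(nat \<Rightarrow> real) \<Rightarrow> real" where \<beta>: "smooth_on_open ?d (ES ?d) \<beta>" "\<beta> ?p = 1"
    "\<And>y. y \<in> ES ?d \<Longrightarrow> y \<notin> ecbox ?d ?p (R/2) \<Longrightarrow> \<beta> y = 0"
    using bump_function[OF p, of "R/2"] R by (metis half_gt_zero)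
  have subc: "ecbox ?d ?p (R/2) \<subseteq> ebox ?d ?p R" using R by (intro ecbox_subset_ebox) auto
  show thesis
  proof (rule that[of \<beta>, OF \<beta>(2)])
    fix a :: "(nat \<Rightarrow> real) \<Rightarrow> complex" assume a: "smooth_on_open ?d (ebox ?d ?p R) a"
    let ?f = "\<lambda>z. if z \<in> U \<and> \<psi> z \<in> ebox ?d ?p R then \<beta> (\<psi> z) *\<^sub>R a (\<psi> z) else 0"
    let ?T1 = "{z \<in> U. \<psi> z \<in> ebox ?d ?p R}" and ?C = "?k ` ecbox ?d ?p (R/2)"
    have T1: "openin (mtop M) ?T1" by (rule chart_open_preimage[OF U open_ES_ebox])
    have "compactin (mtop M) ?C"
      by (rule chart_compact_preimage[OF U compactin_ecbox]) (use subc sub in blast)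
    then have T2: "openin (mtop M) (topspace (mtop M) - ?C)"
      using compactin_imp_closedin[OF hausdorff] by blast
    have s1: "smooth_on_open ?d (ebox ?d ?p R) (\<lambda>q. \<beta> q *\<^sub>R a q)"
      by (rule smooth_scaleR[OF open_ES_ebox smooth_on_open_subset[OF _ open_ES_ebox ebox_subset_ES \<beta>(1)] a]) simp
    have f1: "smooth_fun_on M ?T1 ?f"
    proof (rule smooth_fun_on_param[OF _ T1])
      fix V \<phi> assume V: "(V, \<phi>) \<in> atlas M" and P: "param M ?d (\<phi> ` (V \<inter> ?T1)) (inv_into V \<phi>)"
      have in1: "inv_into V \<phi> y \<in> ?T1" if "y \<in> \<phi> ` (V \<inter> ?T1)" for y
        using that chart_inv[OF V] by auto
      have eq: "{y \<in> \<phi> ` (V \<inter> ?T1). inv_into V \<phi> y \<in> U} = \<phi> ` (V \<inter> ?T1)" using in1 by blast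
      have "smooth_on_open ?d (\<phi> ` (V \<inter> ?T1)) (\<lambda>y. \<beta> (\<psi> (inv_into V \<phi> y)) *\<^sub>R a (\<psi> (inv_into V \<phi> y)))"
        by (rule smooth_compose[OF paramD(1)[OF P] open_ES_ebox _ s1]) (use in1 paramD(4)[OF P U] eq in auto)
      then show "smooth_on_open ?d (\<phi> ` (V \<inter> ?T1)) (\<lambda>y. ?f (inv_into V \<phi> y))"
        by (rule smooth_on_open_cong[OF paramD(1)[OF P], rotated]) (use in1 in simp)
    qed
    have f2: "smooth_fun_on M (topspace (mtop M) - ?C) ?f"
    proof (rule smooth_fun_on_param[OF _ T2])
      fix V \<phi> assume V: "(V, \<phi>) \<in> atlas M" and P: "param M ?d (\<phi> ` (V \<inter> (topspace (mtop M) - ?C))) (inv_into V \<phi>)"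
      have zero: "?f z = 0" if z: "z \<notin> ?C" for z
      proof (cases "z \<in> U \<and> \<psi> z \<in> ebox ?d ?p R")
        case True
        then have "\<psi> z \<notin> ecbox ?d ?p (R/2)" using z chart_inv[OF U, of z] by (metis imageI)
        then show ?thesis using \<beta>(3)[of "\<psi> z"] True ebox_subset_ES by auto
      qed auto
      have "0 = ?f (inv_into V \<phi> y)" if y: "y \<in> \<phi> ` (V \<inter> (topspace (mtop M) - ?C))" for y
      proof -
        obtain z where z: "z \<in> V" "z \<notin> ?C" "y = \<phi> z" using y by blast
        show ?thesis unfolding z(3) chart_inv[OF V z(1)] by (rule zero[OF z(2), symmetric])
      qed
      then show "smooth_on_open ?d (\<phi> ` (V \<inter> (topspace (mtop M) - ?C))) (\<lambda>y. ?f (inv_into V \<phi> y))"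
        by (rule smooth_on_open_cong[OF paramD(1)[OF P] _ smooth_const[OF paramD(1)[OF P], of 0]])
    qed
    show "?f \<in> C_inf M"
    proof (rule C_inf_local)
      fix z assume z: "z \<in> topspace (mtop M)"
      have "?C \<subseteq> ?T1" using subc sub by (auto simp: inv_into_into f_inv_into_f subset_iff)
      then have "z \<in> ?T1 \<or> z \<in> topspace (mtop M) - ?C" using z by blast
      then show "\<exists>T. openin (mtop M) T \<and> z \<in> T \<and> smooth_fun_on M T ?f"
        using T1 T2 f1 f2 by blast
    qed (use chart_subset[OF U] in auto)
  qed
qed

theorem ctangent_space_partials:
  assumes U: "(U, \<psi>) \<in> atlas M" and x: "x \<in> U" and D: "D \<in> ctangent_space M x"
  obtains c where "\<And>w. w \<in> C_inf M \<Longrightarrow>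
    D w = (\<Sum>i<mdim M. c i * partial_deriv i (\<lambda>q. w (inv_into U \<psi> q)) (\<psi> x))"
proof -
  let ?d = "mdim M" and ?p = "\<psi> x" and ?k = "inv_into U \<psi>"
  have p: "?p \<in> ES ?d" using chart_image_ES[OF U] x by blast
  obtain R where R: "0 < R" "ebox ?d ?p R \<subseteq> \<psi> ` U"
    using chart_image[OF U] x unfolding open_ES_iff by blast
  let ?B = "ebox ?d ?p R"
  have pB: "?p \<in> ?B" by (rule centre_in_ebox[OF p R(1)])
  obtain \<beta> :: "(nat \<Rightarrow> real) \<Rightarrow> real" where \<beta>: "\<beta> ?p = 1" and ext0: "\<And>a. smooth_on_open ?d ?B a \<Longrightarrow>
      (\<lambda>z. if z \<in> U \<and> \<psi> z \<in> ?B then \<beta> (\<psi> z) *\<^sub>R a (\<psi> z) else 0 :: complex) \<in> C_inf M"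
    by (rule C_inf_extension[OF U x R]) (rule that)
  define ext where "ext = (\<lambda>(a::(nat \<Rightarrow> real) \<Rightarrow> complex) z. if z \<in> U \<and> \<psi> z \<in> ?B then \<beta> (\<psi> z) *\<^sub>R a (\<psi> z) else 0)"
  have ext: "ext a \<in> C_inf M" if "smooth_on_open ?d ?B a" for a
    unfolding ext_def by (rule ext0[OF that])
  define y where "y = (\<lambda>i. ext (\<lambda>q. of_real (q i - ?p i)))"
  have y: "y i \<in> C_inf M" for i
    unfolding y_def by (intro ext smooth_of_real smooth_diff smooth_coord smooth_const open_ES_ebox)
  have y0: "y i x = 0" for i by (simp add: y_def ext_def)
  define e where "e = ext (\<lambda>q. 1)"
  have e: "e \<in> C_inf M" unfolding e_def by (intro ext smooth_const open_ES_ebox)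
  have e1: "e x = 1" using x pB \<beta> by (simp add: e_def ext_def)
  define one where "one = restrict0 (topspace (mtop M)) (\<lambda>x. 1 :: complex)"
  have one: "one \<in> C_inf M" unfolding one_def by (rule C_inf_const)
  have xtop: "x \<in> topspace (mtop M)" using chart_subset[OF U] x by blast
  have one1: "one x = 1" using xtop by (simp add: one_def restrict0_def)
  have "D one = 0"
  proof -
    have "(\<lambda>y. one y * one y) = one" by (auto simp: one_def restrict0_def)
    then have "D one = D one + D one" using ctangent_space_D(3)[OF D one one] one1 by simp
    then show ?thesis by simp
  qed
  show thesis
  proof (rule that[of "\<lambda>i. D (y i)"])
    fix w assume w: "w \<in> C_inf M"
    let ?v = "\<lambda>q. w (?k q)"
    have kx: "?k ?p = x" using chart_inv[OF U x] .
    have v: "smooth_on_open ?d ?B ?v"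
      by (rule smooth_on_open_subset[OF chart_image[OF U] open_ES_ebox R(2) C_inf_chart[OF w U]])
    obtain g where g: "\<And>i. i < ?d \<Longrightarrow> smooth_on_open ?d ?B (g i)"
      "\<And>q. q \<in> ?B \<Longrightarrow> ?v q = ?v ?p + (\<Sum>i<?d. (q i - ?p i) *\<^sub>R g i q)"
      "\<And>i. i < ?d \<Longrightarrow> g i ?p = partial_deriv i ?v ?p"
      by (rule hadamard[OF p R(1) v]) (rule that)
    let ?G = "\<lambda>i. ext (g i)"
    define E where "E = (\<lambda>z. one z + (- 1) * (e z * e z))"
    define Z where "Z = (\<lambda>z. w z + (- w x) * one z)"
    have E: "E \<in> C_inf M" unfolding E_def by (intro C_inf_add C_inf_cmult C_inf_mult one e)
    have Z: "Z \<in> C_inf M" unfolding Z_def by (intro C_inf_add C_inf_cmult w one)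
    define S where "S = (\<lambda>z. \<Sum>i<?d. y i z * ?G i z)"
    have Si: "(\<lambda>z. y i z * ?G i z) \<in> C_inf M" if "i < ?d" for i
      by (rule C_inf_mult[OF y ext[OF g(1)[OF that]]])
    have S: "S \<in> C_inf M" unfolding S_def by (rule C_inf_sum) (use Si in auto)
    have eq: "w = (\<lambda>z. (w x * one z + E z * Z z) + S z)"
    proof
      fix z
      show "w z = (w x * one z + E z * Z z) + S z"
      proof (cases "z \<in> topspace (mtop M)")
        case False
        then have "S z = 0" using C_inf_outside[OF S] by blast
        then show ?thesis using False C_inf_outside[OF w] C_inf_outside[OF one] C_inf_outside[OF e] by (simp add: E_def Z_def)
      next
        case True
        then have o: "one z = 1" by (simp add: one_def restrict0_def)
        show ?thesis
        proof (cases "z \<in> U \<and> \<psi> z \<in> ?B")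
          case False
          then have "e z = 0" "S z = 0" by (auto simp: e_def S_def y_def ext_def)
          then show ?thesis by (simp add: E_def Z_def o)
        next
          case zU: True
          have "S z = (\<Sum>i<?d. (\<beta> (\<psi> z) * \<beta> (\<psi> z)) *\<^sub>R ((\<psi> z i - ?p i) *\<^sub>R g i (\<psi> z)))"
            using zU unfolding S_def y_def ext_def by (intro sum.cong) (auto simp: scaleR_conv_of_real)
          also have "\<dots> = (\<beta> (\<psi> z) * \<beta> (\<psi> z)) *\<^sub>R (?v (\<psi> z) - ?v ?p)"
            using g(2)[of "\<psi> z"] zU by (simp add: scaleR_sum_right)
          also have "\<dots> = e z * e z * (w z - w x)"
            using zU chart_inv[OF U, of z] kx by (simp add: e_def ext_def scaleR_conv_of_real)
          finally show ?thesis by (simp add: E_def Z_def o algebra_simps)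
        qed
      qed
    qed
    have "D w = D (\<lambda>z. w x * one z + E z * Z z) + D S"
      by (subst eq, rule ctangent_space_D(1)[OF D]) (intro C_inf_add C_inf_cmult C_inf_mult one E Z S)+
    also have "D (\<lambda>z. w x * one z + E z * Z z) = D (\<lambda>z. w x * one z) + D (\<lambda>z. E z * Z z)"
      by (rule ctangent_space_D(1)[OF D C_inf_cmult[OF one] C_inf_mult[OF E Z]])
    also have "D (\<lambda>z. w x * one z) = 0" using ctangent_space_D(2)[OF D one one] \<open>D one = 0\<close> by simp
    also have "D (\<lambda>z. E z * Z z) = 0"
      using ctangent_space_D(3)[OF D E Z] e1 one1 by (simp add: E_def Z_def)
    also have "D S = (\<Sum>i<?d. D (\<lambda>z. y i z * ?G i z))"
      unfolding S_def by (rule ctangent_space_sum[OF D]) (use Si in auto)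
    also have "\<dots> = (\<Sum>i<?d. D (y i) * partial_deriv i ?v ?p)"
    proof (rule sum.cong[OF refl])
      fix i assume "i \<in> {..<?d}"
      then have i: "i < ?d" by simp
      have "?G i x = g i ?p" using x pB \<beta> by (simp add: ext_def)
      then show "D (\<lambda>z. y i z * ?G i z) = D (y i) * partial_deriv i ?v ?p"
        using ctangent_space_D(3)[OF D y ext[OF g(1)[OF i]]] y0 g(3)[OF i] by simp
    qed
    finally show "D w = (\<Sum>i<?d. D (y i) * partial_deriv i ?v ?p)" by simp
  qed
qed

end

definition coord_field :: "('a, 'b) monoid_scheme \<Rightarrow> 'a manifold \<Rightarrow> ((nat \<Rightarrow> real) \<Rightarrow> 'a) \<Rightarrow> (nat \<Rightarrow> real) \<Rightarrow> nat \<Rightarrow> 'a vfield" where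
  "coord_field G M \<kappa> p i = (\<lambda>x f. if x \<in> carrier G \<and> f \<in> C_inf M then partial_deriv i (\<lambda>q. f (x \<otimes>\<^bsub>G\<^esub> \<kappa> q)) p else 0)"

context lie_group
begin

lemma left_translate_C_inf:
  assumes "x \<in> carrier G" "f \<in> C_inf M"
  shows "restrict0 (topspace (mtop M)) (\<lambda>y. f (x \<otimes> y)) \<in> C_inf M"
proof (rule C_inf_param_restrict0)
  fix U \<phi> assume U: "(U, \<phi>) \<in> atlas M"
  have "param M (mdim M) (\<phi> ` U) (\<lambda>y. x \<otimes> inv_into U \<phi> y)"
    by (rule param_mult[OF param_const param_chart[OF U]]) (use chart_image[OF U] assms topspace_carrier in auto)
  then show "smooth_on_open (mdim M) (\<phi> ` U) (\<lambda>y. f (x \<otimes> inv_into U \<phi> y))"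
    by (rule C_inf_param[OF assms(2)])
qed

lemma smooth_translate_param:
  assumes "param M d W \<kappa>" "x \<in> carrier G" "f \<in> C_inf M"
  shows "smooth_on_open d W (\<lambda>q. f (x \<otimes> \<kappa> q))"
  using assms by (intro C_inf_param[OF assms(3)] param_mult param_const)
    (auto simp: topspace_carrier dest: paramD(1))

lemma smooth_translate_param_joint:
  assumes U: "(U, \<phi>) \<in> atlas M" and \<kappa>: "param M d W \<kappa>" and f: "f \<in> C_inf M"
  shows "smooth_on_open (mdim M + d) (prod_ES (mdim M) d (\<phi> ` U) W) (\<lambda>z. f (inv_into U \<phi> (fst_ES (mdim M) z) \<otimes> \<kappa> (snd_ES (mdim M) z)))"
proof -
  let ?Q = "prod_ES (mdim M) d (\<phi> ` U) W"
  have oQ: "open_ES (mdim M + d) ?Q" by (rule open_prod_ES[OF chart_image[OF U] paramD(1)[OF \<kappa>]])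
  show ?thesis
    by (rule C_inf_param[OF f], rule param_mult; rule param_compose[OF _ oQ _ _ chart_domain])
      (auto simp: prod_ES_def intro: param_chart[OF U] \<kappa> smooth_fst_ES[OF oQ, unfolded prod_ES_def] smooth_snd_ES[OF oQ, unfolded prod_ES_def])
qed

context
  fixes d W \<kappa> p i
  assumes \<kappa>: "param M d W \<kappa>" and p: "p \<in> W" and \<kappa>p: "\<kappa> p = \<one>" and i: "i < d"
begin

abbreviation (input) "X \<equiv> coord_field G M \<kappa> p i"

lemma coord_field_has_partial:
  "x \<in> carrier G \<Longrightarrow> f \<in> C_inf M \<Longrightarrow> has_partial i (\<lambda>q. f (x \<otimes> \<kappa> q)) (X x f) p"
  using smooth_has_partial[OF smooth_translate_param[OF \<kappa>] i p] by (simp add: coord_field_def del: fun_upd_apply)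

lemma coord_field_eqI:
  "x \<in> carrier G \<Longrightarrow> f \<in> C_inf M \<Longrightarrow> has_partial i (\<lambda>q. f (x \<otimes> \<kappa> q)) D p \<Longrightarrow> X x f = D"
  using has_partial_imp by (simp add: coord_field_def)

lemma coord_field_ctangent:
  assumes x: "x \<in> carrier G"
  shows "X x \<in> ctangent_space M x"
  unfolding ctangent_space_def
proof (intro CollectI conjI ballI allI impI)
  fix f g assume f: "f \<in> C_inf M" and g: "g \<in> C_inf M"
  note df = coord_field_has_partial[OF x f] and dg = coord_field_has_partial[OF x g]
  show "X x (\<lambda>y. f y + g y) = X x f + X x g"
    by (rule coord_field_eqI[OF x C_inf_add[OF f g] has_vector_derivative_add[OF df dg]])
  have "X x (\<lambda>y. f y * g y) = f (x \<otimes> \<kappa> (p(i := p i))) * X x g + X x f * g (x \<otimes> \<kappa> (p(i := p i)))"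
    by (rule coord_field_eqI[OF x C_inf_mult[OF f g] has_vector_derivative_mult[OF df dg]])
  then show "X x (\<lambda>y. f y * g y) = f x * X x g + g x * X x f"
    using x by (simp add: \<kappa>p)
next
  fix f c assume f: "f \<in> C_inf M"
  show "X x (\<lambda>y. c * f y) = c * X x f"
    by (rule coord_field_eqI[OF x C_inf_cmult[OF f] bounded_linear.has_vector_derivative[OF bounded_linear_mult_right coord_field_has_partial[OF x f]]])
qed (simp add: coord_field_def)

lemma coord_field_lie_algebra: "X \<in> lie_algebra G M"
proof -
  let ?D = "mdim M"
  have vf: "X \<in> vfields M"
    unfolding vfields_def smooth_vfield_on_def
  proof (intro CollectI conjI ballI allI impI)
    show "X x \<in> ctangent_space M x" if "x \<in> topspace (mtop M)" for x
      using that coord_field_ctangent by (simp add: topspace_carrier)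
    show "X x = (\<lambda>f. 0)" if "x \<notin> topspace (mtop M)" for x
      using that by (simp add: coord_field_def topspace_carrier)
    fix f assume f: "f \<in> C_inf M"
    show "smooth_fun_on M (topspace (mtop M)) (\<lambda>x. X x f)"
    proof (rule smooth_fun_on_param[OF _ openin_topspace])
      fix U \<phi> assume U: "(U, \<phi>) \<in> atlas M"
      have UT: "U \<inter> topspace (mtop M) = U" using chart_subset[OF U] by blast
      let ?\<Psi> = "\<lambda>z. f (inv_into U \<phi> (fst_ES ?D z) \<otimes> \<kappa> (snd_ES ?D z))" and ?Q = "prod_ES ?D d (\<phi> ` U) W"
      have oQ: "open_ES (?D + d) ?Q" by (rule open_prod_ES[OF chart_image[OF U] paramD(1)[OF \<kappa>]])
      have p_in_ES: "W \<subseteq> ES d" using openin_subset[OF paramD(1)[OF \<kappa>]] by blast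
      have s: "smooth_on_open (?D + d) ?Q (partial_deriv (?D + i) ?\<Psi>)"
        using i by (intro smooth_partial_deriv smooth_translate_param_joint U \<kappa> f) auto
      have "smooth_on_open ?D (\<phi> ` U) (\<lambda>a. partial_deriv (?D + i) ?\<Psi> (pair_ES ?D a p))"
        by (rule smooth_compose[OF chart_image[OF U] oQ _ s])
          (auto intro!: pair_in_prod_ES p p_in_ES chart_image_ES[OF U] smooth_pair_ES smooth_coord smooth_const chart_image[OF U] simp del: image_eqI)
      moreover have "partial_deriv (?D + i) ?\<Psi> (pair_ES ?D a p) = X (inv_into U \<phi> a) f" if a: "a \<in> \<phi> ` U" for a
      proof -
        have aES: "a \<in> ES ?D" using chart_image_ES[OF U] a by blast
        have "inv_into U \<phi> a \<in> carrier G"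
          using paramD(2)[OF param_chart[OF U] a] by (simp add: topspace_carrier)
        moreover have "pair_ES ?D a p (?D + i) = p i" by (simp add: pair_ES_def)
        ultimately show ?thesis using f by (simp add: coord_field_def partial_deriv_def pair_ES_upd_snd aES)
      qed
      ultimately show "smooth_on_open ?D (\<phi> ` (U \<inter> topspace (mtop M))) (\<lambda>y. X (inv_into U \<phi> y) f)"
        unfolding UT by (rule smooth_on_open_cong[OF chart_image[OF U], rotated])
    qed
  qed
  have li: "left_translate G M x (X y) = X (x \<otimes> y)" if xy: "x \<in> carrier G" "y \<in> carrier G" for x y
  proof
    fix f
    show "left_translate G M x (X y) f = X (x \<otimes> y) f"
    proof (cases "f \<in> C_inf M")
      case f: True
      have "X y (restrict0 (topspace (mtop M)) (\<lambda>z. f (x \<otimes> z))) =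
          partial_deriv i (\<lambda>q. restrict0 (topspace (mtop M)) (\<lambda>z. f (x \<otimes> z)) (y \<otimes> \<kappa> q)) p"
        using left_translate_C_inf[OF xy(1) f] xy by (simp add: coord_field_def)
      also have "\<dots> = partial_deriv i (\<lambda>q. f ((x \<otimes> y) \<otimes> \<kappa> q)) p"
        by (rule partial_deriv_cong[OF paramD(1)[OF \<kappa>] p i])
          (use xy paramD(2)[OF \<kappa>] in \<open>simp add: restrict0_def topspace_carrier m_assoc\<close>)
      also have "\<dots> = X (x \<otimes> y) f" using xy f by (simp add: coord_field_def)
      finally show ?thesis using f by (simp add: left_translate_def pushforward_def)
    qed (simp add: left_translate_def pushforward_def coord_field_def)
  qed
  have "conj_tangent (X x) = X x" if x: "x \<in> topspace (mtop M)" for x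
  proof
    fix f
    have x': "x \<in> carrier G" using x by (simp add: topspace_carrier)
    show "conj_tangent (X x) f = X x f"
    proof (cases "f \<in> C_inf M")
      case True
      have "X x (\<lambda>y. cnj (f y)) = cnj (X x f)"
        by (rule coord_field_eqI[OF x' C_inf_cnj[OF True] bounded_linear.has_vector_derivative[OF bounded_linear_cnj coord_field_has_partial[OF x' True]]])
      then show ?thesis by (simp add: conj_tangent_def)
    next
      case False
      then have "(\<lambda>y. cnj (f y)) \<notin> C_inf M" using C_inf_cnj[of "\<lambda>y. cnj (f y)"] by auto
      with False show ?thesis by (simp add: conj_tangent_def coord_field_def)
    qed
  qed
  then show ?thesis
    unfolding lie_algebra_def complex_lie_algebra_def real_vfields_def using vf li by blast
qed

end

lemma lie_algebra_apply:
  assumes "Y \<in> lie_algebra G M" "x \<in> carrier G" "f \<in> C_inf M"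
  shows "Y x f = Y \<one> (restrict0 (topspace (mtop M)) (\<lambda>y. f (x \<otimes> y)))"
proof -
  have "Y x = left_translate G M x (Y \<one>)"
    using assms one_closed r_one unfolding lie_algebra_def complex_lie_algebra_def by auto
  then show ?thesis using assms(3) by (simp add: left_translate_def pushforward_def)
qed

end

section \<open>Estimates along a closed subgroup\<close>

theorem hall_marriage:
  fixes N :: "'i \<Rightarrow> 'v set"
  assumes "finite A" "\<And>a. a \<in> A \<Longrightarrow> finite (N a)" "\<And>S. S \<subseteq> A \<Longrightarrow> card S \<le> card (\<Union>(N ` S))"
  shows "\<exists>f. inj_on f A \<and> (\<forall>a\<in>A. f a \<in> N a)"
  using assms
proof (induction "card A" arbitrary: A N rule: less_induct)
  case less
  note fin = \<open>finite A\<close> and finN = less.prems(2) and hall = less.prems(3)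
  have finU: "finite (\<Union>(N ` S))" if "S \<subseteq> A" for S
    using that fin finN finite_subset by blast
  show ?case
  proof (cases "\<exists>S. S \<subset> A \<and> S \<noteq> {} \<and> card (\<Union>(N ` S)) = card S")
    case True
    then obtain S where S: "S \<subset> A" "S \<noteq> {}" "card (\<Union>(N ` S)) = card S" by blast
    have finS: "finite S" using S(1) fin finite_subset by blast
    have "\<exists>f. inj_on f S \<and> (\<forall>a\<in>S. f a \<in> N a)"
    proof (intro less.hyps)
      show "card S < card A" by (rule psubset_card_mono[OF fin S(1)])
    qed (use S(1) finS finN hall in auto)
    then obtain f where f: "inj_on f S" "\<And>a. a \<in> S \<Longrightarrow> f a \<in> N a" by blast
    let ?N = "\<lambda>a. N a - \<Union>(N ` S)"
    have "\<exists>g. inj_on g (A - S) \<and> (\<forall>a\<in>A - S. g a \<in> ?N a)"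
    proof (intro less.hyps)
      show "card (A - S) < card A" using S fin by (intro psubset_card_mono) auto
      fix T assume T: "T \<subseteq> A - S"
      have "card S + card T = card (S \<union> T)"
        using T finS fin finite_subset[OF T] by (subst card_Un_disjoint) auto
      also have "\<dots> \<le> card (\<Union>(N ` (S \<union> T)))" using S(1) T by (intro hall) auto
      also have "\<Union>(N ` (S \<union> T)) = \<Union>(N ` S) \<union> \<Union>(?N ` T)" by auto
      also have "card \<dots> \<le> card (\<Union>(N ` S)) + card (\<Union>(?N ` T))" by (rule card_Un_le)
      finally show "card T \<le> card (\<Union>(?N ` T))" using S(3) by simp
    qed (use fin finN in auto)
    then obtain g where g: "inj_on g (A - S)" "\<And>a. a \<in> A - S \<Longrightarrow> g a \<in> ?N a" by blast
    have "inj_on (\<lambda>a. if a \<in> S then f a else g a) A"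
    proof (rule inj_onI)
      fix a b assume "a \<in> A" "b \<in> A" and eq: "(if a \<in> S then f a else g a) = (if b \<in> S then f b else g b)"
      then show "a = b"
        using f(2)[of a] f(2)[of b] g(2)[of a] g(2)[of b] inj_onD[OF f(1), of a b] inj_onD[OF g(1), of a b]
        by (cases "a \<in> S"; cases "b \<in> S") auto
    qed
    moreover have "\<forall>a\<in>A. (if a \<in> S then f a else g a) \<in> N a" using f(2) g(2) by auto
    ultimately show ?thesis by blast
  next
    case strict: False
    show ?thesis
    proof (cases "A = {}")
      case False
      then obtain a where a: "a \<in> A" by blast
      have "card {a} \<le> card (N a)" using hall[of "{a}"] a by simp
      then obtain b where b: "b \<in> N a" by (cases "N a = {}") auto
      let ?N = "\<lambda>x. N x - {b}"
      have "\<exists>g. inj_on g (A - {a}) \<and> (\<forall>x\<in>A - {a}. g x \<in> ?N x)"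
      proof (intro less.hyps)
        show "card (A - {a}) < card A" using a fin by (intro psubset_card_mono) auto
        fix T assume T: "T \<subseteq> A - {a}"
        show "card T \<le> card (\<Union>(?N ` T))"
        proof (cases "T = {}")
          case False
          have "T \<subset> A" using T a by blast
          then have "card T < card (\<Union>(N ` T))"
            using hall[of T] strict False by (metis le_neq_implies_less psubset_imp_subset)
          also have "\<dots> \<le> Suc (card (\<Union>(N ` T) - {b}))"
            using finU[of T] T by (cases "b \<in> \<Union>(N ` T)") (auto simp: card_Suc_Diff1 simp del: UN_iff)
          also have "\<Union>(N ` T) - {b} = \<Union>(?N ` T)" by auto
          finally show ?thesis by simp
        qed simp
      qed (use fin finN in auto)
      then obtain g where g: "inj_on g (A - {a})" "\<And>x. x \<in> A - {a} \<Longrightarrow> g x \<in> ?N x" by blast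
      have "inj_on (g(a := b)) A"
      proof (rule inj_onI)
        fix x y assume "x \<in> A" "y \<in> A" "(g(a := b)) x = (g(a := b)) y"
        then show "x = y"
          using g(2)[of x] g(2)[of y] inj_onD[OF g(1), of x y] by (cases "x = a"; cases "y = a") auto
      qed
      moreover have "\<forall>x\<in>A. (g(a := b)) x \<in> N x" using g(2) b by auto
      ultimately show ?thesis by blast
    qed auto
  qed
qed

text \<open>A translate of a net of minimal cardinality is again such a net, and the two are matched by
  the marriage theorem. So averages over such nets are almost left invariant; they replace the Haar
  measure of the subgroup.\<close>

lemma (in group) net_matching:
  assumes H: "subgroup H G" and Q: "Q \<subseteq> H"
    and net: "\<exists>A. finite A \<and> A \<subseteq> H \<and> (\<forall>h\<in>H. \<exists>a\<in>A. \<exists>u\<in>Q. h = a \<otimes> u)"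
  obtains A where "finite A" "A \<subseteq> H" "A \<noteq> {}"
    "\<And>k. k \<in> H \<Longrightarrow> \<exists>\<pi>. bij_betw \<pi> A ((\<lambda>a. k \<otimes> a) ` A) \<and> (\<forall>a\<in>A. \<exists>u\<in>Q. \<exists>u'\<in>Q. a \<otimes> u = \<pi> a \<otimes> u')"
proof -
  let ?net = "\<lambda>A. finite A \<and> A \<subseteq> H \<and> (\<forall>h\<in>H. \<exists>a\<in>A. \<exists>u\<in>Q. h = a \<otimes> u)"
  obtain A where A: "?net A" "\<And>A'. ?net A' \<Longrightarrow> card A \<le> card A'"
  proof -
    obtain A0 where "?net A0" using net by (rule exE)
    from ex_has_least_nat[of ?net A0 card, OF this] obtain A where "?net A \<and> (\<forall>A'. ?net A' \<longrightarrow> card A \<le> card A')"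
      by (rule exE)
    then show thesis by (intro that[of A]) simp_all
  qed
  have Hc: "H \<subseteq> carrier G" using H by (rule subgroup.subset)
  show thesis
  proof (rule that[of A])
    show "A \<noteq> {}" using A(1) subgroup.one_closed[OF H] by blast
    fix k assume k: "k \<in> H"
    let ?kA = "(\<lambda>a. k \<otimes> a) ` A"
    let ?N = "\<lambda>a. {b \<in> ?kA. \<exists>u\<in>Q. \<exists>u'\<in>Q. a \<otimes> u = b \<otimes> u'}"
    have kAH: "?kA \<subseteq> H" using A(1) k subgroup.m_closed[OF H] by blast
    have "\<exists>f. inj_on f A \<and> (\<forall>a\<in>A. f a \<in> ?N a)"
    proof (rule hall_marriage)
      fix S assume S: "S \<subseteq> A"
      let ?B = "\<Union>(?N ` S)"
      have finB: "finite ?B" by (rule finite_subset[of _ ?kA]) (use A(1) in auto)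
      have "\<exists>a\<in>(A - S) \<union> ?B. \<exists>u\<in>Q. h = a \<otimes> u" if h: "h \<in> H" for h
      proof -
        obtain a u where au: "a \<in> A" "u \<in> Q" "h = a \<otimes> u" using A(1) h by blast
        show ?thesis
        proof (cases "a \<in> S")
          case True
          have "inv k \<otimes> h \<in> H" using k h subgroup.m_closed[OF H] subgroup.m_inv_closed[OF H] by blast
          then obtain a' u' where a': "a' \<in> A" "u' \<in> Q" "inv k \<otimes> h = a' \<otimes> u'" using A(1) by blast
          have "h = k \<otimes> (inv k \<otimes> h)" using k h Hc by (simp add: m_assoc[symmetric] subset_iff)
          also have "\<dots> = (k \<otimes> a') \<otimes> u'" unfolding a'(3)
            using k a' A(1) Q Hc by (intro m_assoc[symmetric]) blast+
          finally have hk: "h = (k \<otimes> a') \<otimes> u'" .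
          then have "k \<otimes> a' \<in> ?N a" using a' au by auto
          then show ?thesis using True hk a'(2) by blast
        next
          case False
          then show ?thesis using au by blast
        qed
      qed
      then have "?net ((A - S) \<union> ?B)" using A(1) finB kAH by blast
      then have "card A \<le> card ((A - S) \<union> ?B)" by (rule A(2))
      also have "\<dots> \<le> card (A - S) + card ?B" by (rule card_Un_le)
      also have "card (A - S) = card A - card S" using S A(1) finite_subset by (intro card_Diff_subset) auto
      finally show "card S \<le> card ?B" using card_mono[of A S] A(1) S by linarith
    qed (use A(1) in auto)
    then obtain f where f: "inj_on f A" "\<And>a. a \<in> A \<Longrightarrow> f a \<in> ?N a" by blast
    have "f ` A = ?kA"
    proof (rule card_subset_eq)
      show "f ` A \<subseteq> ?kA" using f(2) by blast
      have "card ?kA \<le> card A" using A(1) by (intro card_image_le) auto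
      moreover have "card (f ` A) \<le> card ?kA" using A(1) \<open>f ` A \<subseteq> ?kA\<close> by (intro card_mono) auto
      ultimately show "card (f ` A) = card ?kA" using card_image[OF f(1)] by simp
    qed (use A(1) in auto)
    then show "\<exists>\<pi>. bij_betw \<pi> A ?kA \<and> (\<forall>a\<in>A. \<exists>u\<in>Q. \<exists>u'\<in>Q. a \<otimes> u = \<pi> a \<otimes> u')"
      using f unfolding bij_betw_def by blast
  qed (use A(1) in auto)
qed

lemma lcomb_cong: "(\<And>s. s \<in> snd ` set xs \<Longrightarrow> g s = g' s) \<Longrightarrow> lcomb xs g = lcomb xs g'"
  by (induction xs) auto

lemma lcomb_diff: "lcomb xs (\<lambda>s. g s - g' s) = lcomb xs g - lcomb xs g'"
  by (induction xs) (auto simp: algebra_simps)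

lemma lcomb_cmult: "lcomb xs (\<lambda>s. c * g s) = c * lcomb xs g"
  by (induction xs) (auto simp: algebra_simps)

lemma lcomb_scaleR: "lcomb xs (\<lambda>s. c *\<^sub>R g s) = c *\<^sub>R lcomb xs g"
  using lcomb_cmult[of xs "complex_of_real c" g] by (simp add: scaleR_conv_of_real)

lemma lcomb_sum: "lcomb xs (\<lambda>s. \<Sum>i\<in>I. g i s) = (\<Sum>i\<in>I. lcomb xs (g i))"
  by (induction xs) (auto simp: sum_distrib_left sum.distrib)

lemma lcomb_map: "lcomb (map (\<lambda>(c, s). (c, h s)) xs) g = lcomb xs (\<lambda>s. g (h s))"
  by (induction xs) auto

lemma norm_lcomb_le:
  assumes "\<And>s. s \<in> snd ` set xs \<Longrightarrow> norm (g s) \<le> e"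
  shows "norm (lcomb xs g) \<le> (\<Sum>(c, s)\<leftarrow>xs. norm c) * e"
  using assms
proof (induction xs)
  case (Cons cs xs)
  obtain c s where cs: "cs = (c, s)" by (cases cs)
  have "norm (lcomb (cs # xs) g) \<le> norm c * norm (g s) + norm (lcomb xs g)"
    by (simp add: cs norm_mult norm_triangle_ineq[of "c * g s", THEN order_trans])
  also have "\<dots> \<le> norm c * e + (\<Sum>(c, s)\<leftarrow>xs. norm c) * e"
    using Cons cs by (intro add_mono mult_left_mono) auto
  finally show ?case by (simp add: cs algebra_simps)
qed simp

lemma lcomb_has_partial:
  assumes "\<And>s. s \<in> snd ` set xs \<Longrightarrow> has_partial l (g s) (D s) q"
  shows "has_partial l (\<lambda>q. lcomb xs (\<lambda>s. g s q)) (lcomb xs D) q"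
  using assms
proof (induction xs)
  case (Cons cs xs)
  obtain c s where cs: "cs = (c, s)" by (cases cs)
  have 1: "has_partial l (\<lambda>q. lcomb xs (\<lambda>s. g s q)) (lcomb xs D) q"
    by (rule Cons.IH, rule Cons.prems) simp
  have "has_partial l (g s) (D s) q" by (rule Cons.prems) (simp add: cs)
  from has_vector_derivative_add[OF bounded_linear.has_vector_derivative[OF bounded_linear_mult_right this, of c] 1]
  show ?case by (simp add: cs del: fun_upd_apply)
qed simp

lemma (in lie_group) continuous_left_mult:
  assumes "x \<in> carrier G"
  shows "continuous_map (mtop M) (mtop M) (\<lambda>y. x \<otimes> y)"
proof -
  have "continuous_map (mtop M) (prod_topology (mtop M) (mtop M)) (\<lambda>y. (x, y))"
    using assms by (simp add: continuous_map_pairedI topspace_carrier)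
  from continuous_map_compose[OF this mult_continuous] show ?thesis by (simp add: o_def)
qed

lemma (in lie_group) open_translate:
  assumes "x \<in> carrier G" "openin (mtop M) T"
  shows "openin (mtop M) {y \<in> carrier G. x \<otimes> y \<in> T}"
  using openin_continuous_map_preimage[OF continuous_left_mult[OF assms(1)] assms(2)] by (simp add: topspace_carrier)

locale closed_lie_subgroup = G: lie_group G M + N: lie_group "G\<lparr>carrier := H\<rparr>" N
  for G (structure) and M :: "'a manifold" and H :: "'a set" and N :: "'a manifold" +
  fixes U :: "'a set" and \<psi> :: "'a \<Rightarrow> nat \<Rightarrow> real"
  assumes sub: "subgroup H G" and compact: "compact_space (mtop M)" and closed: "closedin (mtop M) H"
    and conn: "connected_space (mtop N)" and incl: "smooth_map N M (\<lambda>x. x)"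
    and U: "(U, \<psi>) \<in> atlas N" and oneU: "\<one> \<in> U"
begin

abbreviation "d \<equiv> mdim N"
abbreviation "\<kappa> \<equiv> inv_into U \<psi>"
abbreviation "W \<equiv> \<psi> ` U"
abbreviation "p \<equiv> \<psi> \<one>"
abbreviation "X i \<equiv> coord_field G M \<kappa> p i"

lemma topspace_N: "topspace (mtop N) = H" using N.topspace_carrier by simp
lemma H_carrier: "H \<subseteq> carrier G" using sub by (rule subgroup.subset)
lemma one_H: "\<one> \<in> H" using sub by (rule subgroup.one_closed)
lemma mult_H: "x \<in> H \<Longrightarrow> y \<in> H \<Longrightarrow> x \<otimes> y \<in> H" using sub by (rule subgroup.m_closed)
lemma inv_H: "x \<in> H \<Longrightarrow> inv x \<in> H" using sub by (rule subgroup.m_inv_closed)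
lemma H_in_carrier: "x \<in> H \<Longrightarrow> x \<in> carrier G" using H_carrier by blast

lemma param_N: "param N d W \<kappa>" by (rule N.param_chart[OF U])
lemma param_M: "param M d W \<kappa>" by (rule param_smooth_map[OF N.smooth_manifold_axioms G.smooth_manifold_axioms incl param_N])
lemma W_open: "open_ES d W" by (rule N.chart_image[OF U])
lemma p_in_W: "p \<in> W" using oneU by blast
lemma p_in_ES: "p \<in> ES d" using p_in_W N.chart_image_ES[OF U] by blast
lemma \<kappa>_H: "q \<in> W \<Longrightarrow> \<kappa> q \<in> H" using paramD(2)[OF param_N] topspace_N by blast
lemma \<kappa>_p: "\<kappa> p = \<one>" by (rule N.chart_inv[OF U oneU])
lemma inv_N: "x \<in> H \<Longrightarrow> inv\<^bsub>G\<lparr>carrier := H\<rparr>\<^esub> x = inv x" by (rule G.m_inv_consistent[OF sub])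

text \<open>Differentiate \<open>f (s \<kappa>(q')) = f ((s \<kappa>(q)) \<kappa>(\<psi> (\<kappa>(q)\<^sup>-\<^sup>1 \<kappa>(q'))))\<close> at \<open>q' = q\<close>.\<close>

lemma frame_change:
  obtains B where "\<And>l i. l < d \<Longrightarrow> i < d \<Longrightarrow> smooth_on_open d W (B l i :: _ \<Rightarrow> real)"
    "\<And>f s q l. f \<in> C_inf M \<Longrightarrow> s \<in> carrier G \<Longrightarrow> q \<in> W \<Longrightarrow> l < d \<Longrightarrow>
      has_partial l (\<lambda>q. f (s \<otimes> \<kappa> q)) (\<Sum>i<d. B l i q *\<^sub>R X i (s \<otimes> \<kappa> q) f) q"
proof -
  let ?Q = "prod_ES d d W W"
  have oQ: "open_ES (d + d) ?Q" by (rule open_prod_ES[OF W_open W_open])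
  have p1: "param N (d + d) ?Q (\<lambda>z. \<kappa> (fst_ES d z))"
    by (rule param_compose[OF param_N oQ _ _ N.chart_domain])
      (auto simp: prod_ES_def intro: smooth_fst_ES[OF oQ, unfolded prod_ES_def])
  have p2: "param N (d + d) ?Q (\<lambda>z. \<kappa> (snd_ES d z))"
    by (rule param_compose[OF param_N oQ _ _ N.chart_domain])
      (auto simp: prod_ES_def intro: smooth_snd_ES[OF oQ, unfolded prod_ES_def])
  define m where "m = (\<lambda>z. inv\<^bsub>G\<lparr>carrier := H\<rparr>\<^esub> (\<kappa> (fst_ES d z)) \<otimes> \<kappa> (snd_ES d z))"
  have pm: "param N (d + d) ?Q m"
    using N.param_mult[OF N.param_inv[OF p1] p2] unfolding m_def by simp
  let ?V = "{z \<in> ?Q. m z \<in> U}"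
  have oV: "open_ES (d + d) ?V" by (rule paramD(3)[OF pm N.chart_domain[OF U]])
  have WES: "W \<subseteq> ES d" by (rule N.chart_image_ES[OF U])
  have sA: "smooth_on_open (d + d) ?V (\<lambda>z. \<psi> (m z) i)" if "i < d" for i
    by (rule paramD(4)[OF pm U that])
  have m_pair: "m (pair_ES d q q') = inv (\<kappa> q) \<otimes> \<kappa> q'" if "q \<in> W" "q' \<in> W" for q q'
    using that WES inv_N[OF \<kappa>_H[OF that(1)]] by (auto simp: m_def subset_iff)
  have pairQ: "pair_ES d q q' \<in> ?Q" if "q \<in> W" "q' \<in> W" for q q'
    by (rule pair_in_prod_ES[OF that WES WES])
  have diag: "pair_ES d q q \<in> ?V" "m (pair_ES d q q) = \<one>" if "q \<in> W" for q
    using pairQ[OF that that] m_pair[OF that that] H_in_carrier[OF \<kappa>_H[OF that]] oneU by auto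
  define B where "B = (\<lambda>l i q. partial_deriv (d + l) (\<lambda>z. \<psi> (m z) i) (pair_ES d q q))"
  show thesis
  proof (rule that[of B])
    fix l i assume l: "l < d" and i: "i < d"
    have "smooth_on_open (d + d) ?V (partial_deriv (d + l) (\<lambda>z. \<psi> (m z) i))"
      using l by (intro smooth_partial_deriv sA i) auto
    then show "smooth_on_open d W (B l i)"
      unfolding B_def
      by (intro smooth_compose[OF W_open oV _ _ smooth_pair_ES[OF W_open smooth_coord[OF W_open] smooth_coord[OF W_open]]] diag(1))
  next
    fix f s q l assume f: "f \<in> C_inf M" and s: "s \<in> carrier G" and q: "q \<in> W" and l: "l < d"
    let ?Y = "\<lambda>w. f ((s \<otimes> \<kappa> q) \<otimes> \<kappa> w)"
    have sq: "s \<otimes> \<kappa> q \<in> carrier G" using s H_in_carrier[OF \<kappa>_H[OF q]] by simp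
    have sY: "smooth_on_open d W ?Y" by (rule G.smooth_translate_param[OF param_M sq f])
    let ?W = "{q' \<in> W. pair_ES d q q' \<in> ?V}"
    have oW: "open_ES d ?W"
      by (rule open_ES_preimage[OF W_open oV])
        (use pairQ[OF q] q WES in \<open>auto intro!: smooth_cont[OF W_open] smooth_pair_ES[OF W_open] smooth_const smooth_coord W_open simp: prod_ES_def\<close>)
    have qW: "q \<in> ?W" using q diag(1) by blast
    let ?g = "\<lambda>q'. \<psi> (m (pair_ES d q q'))"
    have "has_partial l (\<lambda>q'. ?Y (?g q')) (\<Sum>j<d. B l j q *\<^sub>R partial_deriv j ?Y (?g q)) q"
    proof (rule has_partial_compose[OF oW W_open _ _ _ _ qW l])
      show "has_partial k ?Y (partial_deriv k ?Y z) z" if "z \<in> W" "k < d" for z k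
        by (rule smooth_has_partial[OF sY that(2,1)])
      show "cont_ES d W (partial_deriv k ?Y)" if "k < d" for k
        by (rule smooth_cont[OF W_open smooth_partial_deriv[OF sY that]])
      show "has_partial l (\<lambda>q'. ?g q' j) (B l j q) q" if j: "j < d" for j
      proof -
        have "has_partial (d + l) (\<lambda>z. \<psi> (m z) j) (B l j q) (pair_ES d q q)"
          unfolding B_def by (rule smooth_has_partial[OF sA[OF j]]) (use l diag(1)[OF q] in auto)
        then show ?thesis unfolding pair_ES_upd_snd by (simp add: pair_ES_def)
      qed
      show "?g q' \<in> W" if "q' \<in> ?W" for q' using that by blast
    qed
    moreover have "?g q = p" using diag(2)[OF q] by simp
    moreover have "partial_deriv j ?Y p = X j (s \<otimes> \<kappa> q) f" for j
      using sq f by (simp add: coord_field_def)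
    ultimately have D: "has_partial l (\<lambda>q'. ?Y (?g q')) (\<Sum>j<d. B l j q *\<^sub>R X j (s \<otimes> \<kappa> q) f) q" by simp
    have eq: "?Y (?g q') = f (s \<otimes> \<kappa> q')" if q': "q' \<in> ?W" for q'
    proof -
      have q'W: "q' \<in> W" using q' by blast
      have "\<kappa> (?g q') = inv (\<kappa> q) \<otimes> \<kappa> q'"
        using q' m_pair[OF q q'W] N.chart_inv[OF U] by auto
      then have "(s \<otimes> \<kappa> q) \<otimes> \<kappa> (?g q') = s \<otimes> (\<kappa> q \<otimes> (inv (\<kappa> q) \<otimes> \<kappa> q'))"
        using s H_in_carrier[OF \<kappa>_H[OF q]] H_in_carrier[OF \<kappa>_H[OF q'W]] by (simp add: G.m_assoc)
      also have "\<kappa> q \<otimes> (inv (\<kappa> q) \<otimes> \<kappa> q') = \<kappa> q'"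
        using H_in_carrier[OF \<kappa>_H[OF q]] H_in_carrier[OF \<kappa>_H[OF q'W]] by (simp add: G.m_assoc[symmetric])
      finally show ?thesis by simp
    qed
    show "has_partial l (\<lambda>q. f (s \<otimes> \<kappa> q)) (\<Sum>i<d. B l i q *\<^sub>R X i (s \<otimes> \<kappa> q) f) q"
      by (rule iffD1[OF has_partial_cong[OF oW qW l] D]) (rule eq)
  qed
qed

definition increment_bounded :: "real \<Rightarrow> 'a \<Rightarrow> bool" where
  "increment_bounded c h \<longleftrightarrow> (\<forall>f\<in>C_inf M. \<forall>xs B. snd ` set xs \<subseteq> carrier G \<longrightarrow> 0 \<le> B \<longrightarrow>
     (\<forall>i<d. \<forall>k\<in>H. norm (lcomb xs (\<lambda>s. X i (s \<otimes> k) f)) \<le> B) \<longrightarrow>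
     norm (lcomb xs (\<lambda>s. f (s \<otimes> h) - f s)) \<le> c * B)"

lemma increment_boundedD:
  assumes "increment_bounded c h" "f \<in> C_inf M" "snd ` set xs \<subseteq> carrier G" "0 \<le> B"
    "\<And>i k. i < d \<Longrightarrow> k \<in> H \<Longrightarrow> norm (lcomb xs (\<lambda>s. X i (s \<otimes> k) f)) \<le> B"
  shows "norm (lcomb xs (\<lambda>s. f (s \<otimes> h) - f s)) \<le> c * B"
  using assms unfolding increment_bounded_def by blast

lemma increment_bounded_mono: "increment_bounded c h \<Longrightarrow> c \<le> c' \<Longrightarrow> increment_bounded c' h"
  unfolding increment_bounded_def by (meson mult_right_mono order_trans)

lemma increment_bounded_pointwise:
  assumes "increment_bounded c h" "f \<in> C_inf M" "s \<in> carrier G" "0 \<le> B" "\<And>i x. i < d \<Longrightarrow> x \<in> carrier G \<Longrightarrow> norm (X i x f) \<le> B"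
  shows "norm (f (s \<otimes> h) - f s) \<le> c * B"
  using increment_boundedD[OF assms(1,2), of "[(1, s)]" B] assms(3-5) H_in_carrier by simp

lemma increment_bounded_translate:
  assumes k: "k \<in> H" and e: "increment_bounded c h" and f: "f \<in> C_inf M" and xs: "snd ` set xs \<subseteq> carrier G" and B: "0 \<le> B"
    "\<And>i k. i < d \<Longrightarrow> k \<in> H \<Longrightarrow> norm (lcomb xs (\<lambda>s. X i (s \<otimes> k) f)) \<le> B"
    and h: "h \<in> H"
  shows "norm (lcomb xs (\<lambda>s. f (s \<otimes> (k \<otimes> h)) - f (s \<otimes> k))) \<le> c * B"
proof -
  let ?ys = "map (\<lambda>(c, s). (c, s \<otimes> k)) xs"
  have assoc: "lcomb xs (\<lambda>s. g ((s \<otimes> k) \<otimes> k')) = lcomb xs (\<lambda>s. g (s \<otimes> (k \<otimes> k')))" if "k' \<in> H" for g k'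
    by (rule lcomb_cong) (use xs H_in_carrier[OF k] H_in_carrier[OF that] in \<open>auto simp: G.m_assoc subset_iff\<close>)
  have "norm (lcomb ?ys (\<lambda>s. f (s \<otimes> h) - f s)) \<le> c * B"
  proof (rule increment_boundedD[OF e f _ B(1)])
    show "snd ` set ?ys \<subseteq> carrier G" using xs H_in_carrier[OF k] by auto
    show "norm (lcomb ?ys (\<lambda>s. X i (s \<otimes> k') f)) \<le> B" if "i < d" "k' \<in> H" for i k'
      using B(2)[OF that(1) mult_H[OF k that(2)]] by (simp only: lcomb_map assoc[OF that(2), of "\<lambda>x. X i x f"])
  qed
  moreover have "lcomb xs (\<lambda>s. f ((s \<otimes> k) \<otimes> h) - f (s \<otimes> k)) = lcomb xs (\<lambda>s. f (s \<otimes> (k \<otimes> h)) - f (s \<otimes> k))"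
    unfolding lcomb_diff by (simp add: assoc[OF h])
  ultimately show ?thesis unfolding lcomb_map by simp
qed

lemma increment_bounded_mult:
  assumes "h \<in> H" "k \<in> H" "increment_bounded c h" "increment_bounded c' k"
  shows "increment_bounded (c + c') (h \<otimes> k)"
  unfolding increment_bounded_def
proof (intro ballI allI impI)
  fix f xs B assume f: "f \<in> C_inf M" and xs: "snd ` set xs \<subseteq> carrier G" "0 \<le> B"
    "\<forall>i<d. \<forall>k\<in>H. norm (lcomb xs (\<lambda>s. X i (s \<otimes> k) f)) \<le> B"
  have 1: "norm (lcomb xs (\<lambda>s. f (s \<otimes> h) - f s)) \<le> c * B"
    by (rule increment_boundedD[OF assms(3) f xs(1,2)]) (use xs(3) in blast)
  have 2: "norm (lcomb xs (\<lambda>s. f (s \<otimes> (h \<otimes> k)) - f (s \<otimes> h))) \<le> c' * B"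
    by (rule increment_bounded_translate[OF assms(1,4) f xs(1,2) _ assms(2)]) (use xs(3) in blast)
  have "lcomb xs (\<lambda>s. f (s \<otimes> (h \<otimes> k)) - f s) =
     lcomb xs (\<lambda>s. f (s \<otimes> h) - f s) + lcomb xs (\<lambda>s. f (s \<otimes> (h \<otimes> k)) - f (s \<otimes> h))"
    by (simp add: lcomb_diff)
  then show "norm (lcomb xs (\<lambda>s. f (s \<otimes> (h \<otimes> k)) - f s)) \<le> (c + c') * B"
    using norm_triangle_mono[OF 1 2] by (simp add: distrib_right)
qed

lemma increment_bounded_cancel:
  assumes "h \<in> H" "k \<in> H" "increment_bounded c (h \<otimes> k)" "increment_bounded c' k"
  shows "increment_bounded (c + c') h"
  unfolding increment_bounded_def
proof (intro ballI allI impI)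
  fix f xs B assume f: "f \<in> C_inf M" and xs: "snd ` set xs \<subseteq> carrier G" "0 \<le> B"
    "\<forall>i<d. \<forall>k\<in>H. norm (lcomb xs (\<lambda>s. X i (s \<otimes> k) f)) \<le> B"
  have 1: "norm (lcomb xs (\<lambda>s. f (s \<otimes> (h \<otimes> k)) - f s)) \<le> c * B"
    by (rule increment_boundedD[OF assms(3) f xs(1,2)]) (use xs(3) in blast)
  have 2: "norm (lcomb xs (\<lambda>s. f (s \<otimes> (h \<otimes> k)) - f (s \<otimes> h))) \<le> c' * B"
    by (rule increment_bounded_translate[OF assms(1,4) f xs(1,2) _ assms(2)]) (use xs(3) in blast)
  have "lcomb xs (\<lambda>s. f (s \<otimes> h) - f s) =
     lcomb xs (\<lambda>s. f (s \<otimes> (h \<otimes> k)) - f s) - lcomb xs (\<lambda>s. f (s \<otimes> (h \<otimes> k)) - f (s \<otimes> h))"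
    by (simp add: lcomb_diff)
  then show "norm (lcomb xs (\<lambda>s. f (s \<otimes> h) - f s)) \<le> (c + c') * B"
    using order_trans[OF norm_triangle_ineq4 add_mono[OF 1 2]] by (simp add: distrib_right)
qed

lemma increment_bounded_cube:
  obtains K R where "0 \<le> K" "0 < R" "ecbox d p R \<subseteq> W"
    "\<And>r q. 0 \<le> r \<Longrightarrow> r < R \<Longrightarrow> q \<in> ecbox d p r \<Longrightarrow> increment_bounded (K * r) (\<kappa> q)"
proof -
  obtain B where B: "\<And>l i. l < d \<Longrightarrow> i < d \<Longrightarrow> smooth_on_open d W (B l i :: _ \<Rightarrow> real)"
    "\<And>f s q l. f \<in> C_inf M \<Longrightarrow> s \<in> carrier G \<Longrightarrow> q \<in> W \<Longrightarrow> l < d \<Longrightarrow>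
      has_partial l (\<lambda>q. f (s \<otimes> \<kappa> q)) (\<Sum>i<d. B l i q *\<^sub>R X i (s \<otimes> \<kappa> q) f) q"
    by (rule frame_change) (rule that)
  obtain R0 where R0: "0 < R0" "ebox d p R0 \<subseteq> W" using W_open p_in_W unfolding open_ES_iff by blast
  define R where "R = R0 / 2"
  have R: "0 < R" "ecbox d p R \<subseteq> W"
    using R0 ecbox_subset_ebox[of R R0 d p] by (auto simp: R_def)
  have "\<exists>b\<ge>0. \<forall>q\<in>ecbox d p R. norm (B l i q) \<le> b" if "l < d" "i < d" for l i
    by (rule cont_ES_bounded_on_compact[OF W_open smooth_cont[OF W_open B(1)[OF that]] compactin_ecbox R(2)]) blast
  then have "\<forall>li. \<exists>b. fst li < d \<and> snd li < d \<longrightarrow> 0 \<le> b \<and> (\<forall>q\<in>ecbox d p R. norm (B (fst li) (snd li) q) \<le> b)" by meson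
  then obtain b where b: "\<forall>li. fst li < d \<and> snd li < d \<longrightarrow> 0 \<le> b li \<and> (\<forall>q\<in>ecbox d p R. norm (B (fst li) (snd li) q) \<le> b li)"
    by (rule choice[THEN exE])
  define b0 where "b0 = (\<Sum>l<d. \<Sum>i<d. b (l, i))"
  have b_nonneg: "0 \<le> b (l, i)" if "l < d" "i < d" for l i using b that by auto
  have bb: "b (l, i) \<le> b0" if "l < d" "i < d" for l i
  proof -
    have "b (l, i) \<le> (\<Sum>i<d. b (l, i))" by (rule member_le_sum) (use that b_nonneg in auto)
    also have "\<dots> \<le> b0" unfolding b0_def
      by (rule member_le_sum[of l _ "\<lambda>l. \<Sum>i<d. b (l, i)"]) (use that b_nonneg in \<open>auto intro: sum_nonneg\<close>)
    finally show ?thesis .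
  qed
  have b0: "0 \<le> b0" unfolding b0_def by (intro sum_nonneg) (use b_nonneg in auto)
  have Bb: "\<bar>B l i q\<bar> \<le> b0" if "l < d" "i < d" "q \<in> ecbox d p R" for l i q
    using b[rule_format, of "(l, i)"] bb[OF that(1,2)] that by fastforce
  define K where "K = real d * b0 * real d"
  show thesis
  proof (rule that[of K R])
    show "0 \<le> K" using b0 by (simp add: K_def)
    fix r q assume r: "0 \<le> r" "r < R" and q: "q \<in> ecbox d p r"
    show "increment_bounded (K * r) (\<kappa> q)"
      unfolding increment_bounded_def
    proof (intro ballI allI impI)
      fix f xs B' assume f: "f \<in> C_inf M" and xs: "snd ` set xs \<subseteq> carrier G" and B': "0 \<le> B'"
        "\<forall>i<d. \<forall>k\<in>H. norm (lcomb xs (\<lambda>s. X i (s \<otimes> k) f)) \<le> B'"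
      let ?F = "\<lambda>q. lcomb xs (\<lambda>s. f (s \<otimes> \<kappa> q))"
      let ?F' = "\<lambda>l z. lcomb xs (\<lambda>s. \<Sum>i<d. B l i z *\<^sub>R X i (s \<otimes> \<kappa> z) f)"
      have qR: "q \<in> ebox d p R" using q ecbox_subset_ebox[OF r(2)] by blast
      have "norm (?F q - ?F p - (\<Sum>k<d. (q k - p k) *\<^sub>R 0)) \<le> (real d * (b0 * B')) * (\<Sum>k<d. \<bar>q k - p k\<bar>)"
      proof (rule partial_increment_bound[OF p_in_ES qR])
        fix z l assume z: "z \<in> ebox d p R" and l: "l < d"
        have zc: "z \<in> ecbox d p R" using z ebox_subset_ecbox by blast
        then have zW: "z \<in> W" using R(2) by blast
        show "has_partial l ?F (?F' l z) z"
          by (rule lcomb_has_partial) (use B(2)[OF f _ zW l] xs in blast)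
        have "norm (?F' l z) = norm (\<Sum>i<d. B l i z *\<^sub>R lcomb xs (\<lambda>s. X i (s \<otimes> \<kappa> z) f))"
          unfolding lcomb_sum lcomb_scaleR ..
        also have "\<dots> \<le> (\<Sum>i<d. b0 * B')"
        proof (rule sum_norm_le)
          fix i assume "i \<in> {..<d}"
          then have i: "i < d" by simp
          show "norm (B l i z *\<^sub>R lcomb xs (\<lambda>s. X i (s \<otimes> \<kappa> z) f)) \<le> b0 * B'"
            unfolding norm_scaleR by (rule mult_mono) (use Bb[OF l i zc] B' i \<kappa>_H[OF zW] b0 in auto)
        qed
        finally show "norm (?F' l z - 0) \<le> real d * (b0 * B')" by simp
      qed
      also have "\<dots> \<le> (real d * (b0 * B')) * (real d * r)"
      proof (rule mult_left_mono)
        show "(\<Sum>k<d. \<bar>q k - p k\<bar>) \<le> real d * r"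
          using sum_bounded_above[of "{..<d}" "\<lambda>k. \<bar>q k - p k\<bar>" r] q by (auto simp: ecbox_def)
      qed (use b0 B' in auto)
      also have "\<dots> = K * r * B'" by (simp add: K_def)
      finally have "norm (?F q - ?F p) \<le> K * r * B'" by simp
      moreover have "?F p = lcomb xs f"
        by (rule lcomb_cong) (use xs \<kappa>_p in auto)
      ultimately show "norm (lcomb xs (\<lambda>s. f (s \<otimes> \<kappa> q) - f s)) \<le> K * r * B'"
        by (simp add: lcomb_diff)
    qed
  qed (use R in auto)
qed

lemma openin_chart_cube:
  assumes "ecbox d p r \<subseteq> W" "0 < r"
  shows "openin (mtop N) (\<kappa> ` ebox d p r)" "\<one> \<in> \<kappa> ` ebox d p r"
proof -
  have sub: "ebox d p r \<subseteq> W" using assms ebox_subset_ecbox by blast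
  have "\<kappa> ` ebox d p r = {x \<in> U. \<psi> x \<in> ebox d p r}"
  proof (intro equalityI subsetI)
    fix x assume "x \<in> \<kappa> ` ebox d p r"
    then obtain q where q: "q \<in> ebox d p r" "x = \<kappa> q" by blast
    then have "q \<in> W" using sub by blast
    then show "x \<in> {x \<in> U. \<psi> x \<in> ebox d p r}" using q by (auto simp: inv_into_into f_inv_into_f)
  next
    fix x assume x: "x \<in> {x \<in> U. \<psi> x \<in> ebox d p r}"
    then have "x = \<kappa> (\<psi> x)" using N.chart_inv[OF U] by simp
    then show "x \<in> \<kappa> ` ebox d p r" using x by blast
  qed
  then show "openin (mtop N) (\<kappa> ` ebox d p r)" using N.chart_open_preimage[OF U open_ES_ebox] by simp
  show "\<one> \<in> \<kappa> ` ebox d p r" using centre_in_ebox[OF p_in_ES assms(2)] \<kappa>_p by (metis imageI)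
qed

lemma open_translate_N:
  assumes "h \<in> H" "openin (mtop N) T"
  shows "openin (mtop N) {y \<in> H. inv h \<otimes> y \<in> T}"
  using N.open_translate[of "inv h" T] inv_H[OF assms(1)] assms(2) by simp

lemma increment_bounded_exists:
  assumes h: "h \<in> H"
  shows "\<exists>c\<ge>0. increment_bounded c h"
proof -
  obtain K R where KR: "0 \<le> K" "0 < R" "ecbox d p R \<subseteq> W"
    "\<And>r q. 0 \<le> r \<Longrightarrow> r < R \<Longrightarrow> q \<in> ecbox d p r \<Longrightarrow> increment_bounded (K * r) (\<kappa> q)"
    by (rule increment_bounded_cube) (rule that)
  define r where "r = R / 2"
  have r: "0 < r" "r < R" using KR(2) by (auto simp: r_def)
  have rW: "ecbox d p r \<subseteq> W" using KR(3) r by (force simp: ecbox_def)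
  let ?O = "\<kappa> ` ebox d p r"
  have O: "u \<in> H" "increment_bounded (K * r) u" if "u \<in> ?O" for u
    using that KR(4)[of r] r rW ebox_subset_ecbox[of d p r] \<kappa>_H by auto
  define S where "S = {h \<in> H. \<exists>c\<ge>0. increment_bounded c h}"
  have Kr: "0 \<le> K * r" using KR(1) r by simp
  have dec: "h \<otimes> (inv h \<otimes> y) = y" if "h \<in> H" "y \<in> H" for h y
    using H_in_carrier[OF that(1)] H_in_carrier[OF that(2)] by (simp add: G.m_assoc[symmetric])
  have key: "h \<in> S \<longleftrightarrow> y \<in> S" if hy: "h \<in> H" "y \<in> H" "inv h \<otimes> y \<in> ?O" for h y
  proof
    let ?u = "inv h \<otimes> y"
    assume "h \<in> S"
    then obtain c where "0 \<le> c" "increment_bounded c h" by (auto simp: S_def)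
    then have "increment_bounded (c + K * r) (h \<otimes> ?u)" using O[OF hy(3)] hy by (intro increment_bounded_mult) auto
    then show "y \<in> S" using hy Kr \<open>0 \<le> c\<close> unfolding S_def dec[OF hy(1,2)] by (auto intro!: exI[of _ "c + K * r"])
  next
    let ?u = "inv h \<otimes> y"
    assume "y \<in> S"
    then obtain c where "0 \<le> c" "increment_bounded c (h \<otimes> ?u)" using dec[OF hy(1,2)] by (auto simp: S_def)
    then have "increment_bounded (c + K * r) h" using O[OF hy(3)] hy by (intro increment_bounded_cancel[of h ?u]) auto
    then show "h \<in> S" using hy Kr \<open>0 \<le> c\<close> unfolding S_def by (auto intro!: exI[of _ "c + K * r"])
  qed
  have nb: "openin (mtop N) {y \<in> H. inv h \<otimes> y \<in> ?O}" "h \<in> {y \<in> H. inv h \<otimes> y \<in> ?O}" if "h \<in> H" for h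
    using open_translate_N[OF that openin_chart_cube(1)[OF rW r(1)]] openin_chart_cube(2)[OF rW r(1)] that H_in_carrier[OF that] by auto
  have "openin (mtop N) S"
  proof (subst openin_subopen, rule ballI)
    fix h assume h: "h \<in> S"
    then have hH: "h \<in> H" by (simp add: S_def)
    have "{y \<in> H. inv h \<otimes> y \<in> ?O} \<subseteq> S" using key[OF hH] h by blast
    with nb[OF hH] show "\<exists>T. openin (mtop N) T \<and> h \<in> T \<and> T \<subseteq> S" by (intro exI conjI)
  qed
  moreover have "openin (mtop N) (H - S)"
  proof (subst openin_subopen, rule ballI)
    fix h assume h: "h \<in> H - S"
    then have hH: "h \<in> H" by simp
    have "{y \<in> H. inv h \<otimes> y \<in> ?O} \<subseteq> H - S" using key[OF hH] h by blast
    with nb[OF hH] show "\<exists>T. openin (mtop N) T \<and> h \<in> T \<and> T \<subseteq> H - S" by (intro exI conjI)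
  qed
  then have "closedin (mtop N) S" unfolding closedin_def topspace_N by (auto simp: S_def)
  ultimately have "S = {} \<or> S = H" using conn topspace_N unfolding connected_space_clopen_in by blast
  moreover have "\<one> \<in> S"
  proof -
    have "lcomb xs (\<lambda>s. f (s \<otimes> \<one>) - f s) = lcomb xs (\<lambda>s. 0)" if "snd ` set xs \<subseteq> carrier G" for xs and f :: "'a \<Rightarrow> complex"
      by (rule lcomb_cong) (use that in auto)
    moreover have "lcomb xs (\<lambda>s::'a. 0) = 0" for xs using lcomb_cmult[of xs 0 "\<lambda>s. 0"] by simp
    ultimately have "increment_bounded 0 \<one>" unfolding increment_bounded_def by simp
    then show ?thesis using one_H by (auto simp: S_def)
  qed
  ultimately show ?thesis using h by (auto simp: S_def)
qed

text \<open>
  The topology of \<open>N\<close> might be finer than that of \<open>H\<close>. Countably many translates of the cube cover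
  \<open>H\<close> as \<open>N\<close> is second countable; as \<open>H\<close> is closed, Baire's theorem gives one of them an interior
  point in \<open>H\<close>, and \<open>H\<close> is compact.
\<close>

lemma finite_net:
  assumes r: "0 < r" and rW: "ecbox d p r \<subseteq> W"
  shows "\<exists>A. finite A \<and> A \<subseteq> H \<and> (\<forall>h\<in>H. \<exists>a\<in>A. \<exists>u\<in>\<kappa> ` ecbox d p r. h = a \<otimes> u)"
proof -
  let ?O = "\<kappa> ` ebox d p r" and ?Q = "\<kappa> ` ecbox d p r"
  let ?T = "\<lambda>h. {y \<in> H. inv h \<otimes> y \<in> ?O}" and ?C = "\<lambda>h. (\<lambda>u. h \<otimes> u) ` ?Q"
  have dec: "h \<otimes> (inv h \<otimes> y) = y" if "h \<in> H" "y \<in> H" for h y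
    using H_in_carrier[OF that(1)] H_in_carrier[OF that(2)] by (simp add: G.m_assoc[symmetric])
  have nb: "openin (mtop N) (?T h)" "h \<in> ?T h" if "h \<in> H" for h
    using open_translate_N[OF that openin_chart_cube(1)[OF rW r]] openin_chart_cube(2)[OF rW r] that H_in_carrier[OF that] by auto
  have QH: "?Q \<subseteq> H" using rW \<kappa>_H by blast
  have TC: "?T h \<subseteq> ?C h" if "h \<in> H" for h
  proof
    fix y assume y: "y \<in> ?T h"
    then have "inv h \<otimes> y \<in> ?Q" using ebox_subset_ecbox[of d p r] by blast
    then show "y \<in> ?C h" using dec[OF that, of y] y by (metis (no_types, lifting) imageI mem_Collect_eq)
  qed
  have "\<exists>\<V>. countable \<V> \<and> \<V> \<subseteq> ?T ` H \<and> \<Union>\<V> = topspace (mtop N)"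
  proof (rule Lindelof_spaceD)
    show "Lindelof_space (mtop N)" by (rule second_countable_imp_Lindelof_space[OF N.second_countable])
    show "openin (mtop N) V" if "V \<in> ?T ` H" for V using nb(1) that by blast
    show "\<Union>(?T ` H) = topspace (mtop N)" unfolding topspace_N using nb(2) by blast
  qed
  then obtain \<V> where \<V>: "countable \<V>" "\<V> \<subseteq> ?T ` H" "\<Union>\<V> = H"
    unfolding topspace_N by (elim exE conjE) (rule that)
  obtain H' where H': "countable H'" "H' \<subseteq> H" "\<V> = ?T ` H'"
    using \<V>(1,2) countable_subset_image[of \<V> ?T H] by blast
  let ?Z = "subtopology (mtop M) H"
  have HM: "H \<subseteq> topspace (mtop M)" using H_carrier G.topspace_carrier by blast
  have topZ: "topspace ?Z = H" using HM by auto
  have Zc: "compact_space ?Z"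
    using closedin_compact_space[OF compact closed] by (simp add: compactin_subspace)
  have Zh: "Hausdorff_space ?Z" by (rule Hausdorff_space_subtopology[OF G.hausdorff])
  have QM: "compactin (mtop M) ?Q"
  proof -
    have "compactin (mtop N) ?Q" by (rule N.chart_compact_preimage[OF U compactin_ecbox rW])
    moreover have "continuous_map (mtop N) (mtop M) (\<lambda>x. x)" using incl by (simp add: smooth_map_def)
    ultimately show ?thesis using image_compactin by fastforce
  qed
  have Ccl: "closedin ?Z (?C h)" if h: "h \<in> H" for h
  proof -
    have "compactin (mtop M) (?C h)" by (rule image_compactin[OF QM G.continuous_left_mult[OF H_in_carrier[OF h]]])
    then have "closedin (mtop M) (?C h)" by (rule compactin_imp_closedin[OF G.hausdorff])
    moreover have "?C h \<subseteq> H" using QH mult_H[OF h] by blast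
    ultimately show ?thesis using closedin_subset_topspace by blast
  qed
  have "\<Union>(?C ` H') = H"
  proof
    show "\<Union>(?C ` H') \<subseteq> H" using QH H'(2) mult_H by blast
    show "H \<subseteq> \<Union>(?C ` H')"
    proof
      fix y assume "y \<in> H"
      then have "y \<in> \<Union>(?T ` H')" using \<V>(3) H'(3) by simp
      then have "\<exists>h\<in>H'. y \<in> ?T h" by (simp only: UN_iff)
      then obtain h where h: "h \<in> H'" "y \<in> ?T h" by (elim bexE)
      have "y \<in> ?C h" by (rule subsetD[OF TC[OF subsetD[OF H'(2) h(1)]] h(2)])
      with h(1) show "y \<in> \<Union>(?C ` H')" by (rule UN_I)
    qed
  qed
  moreover have "?Z interior_of H = H" using interior_of_topspace[of ?Z] topZ by simp
  ultimately have ne: "?Z interior_of (\<Union>(?C ` H')) \<noteq> {}" using one_H by auto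
  have "\<exists>h\<in>H'. ?Z interior_of ?C h \<noteq> {}"
  proof (rule ccontr)
    assume none: "\<not> (\<exists>h\<in>H'. ?Z interior_of ?C h \<noteq> {})"
    have "?Z interior_of (\<Union>(?C ` H')) = {}"
    proof (rule Baire_category_alt)
      show "completely_metrizable_space ?Z \<or> locally_compact_space ?Z \<and> regular_space ?Z"
        using compact_imp_locally_compact_space[OF Zc] compact_Hausdorff_imp_regular_space[OF Zc Zh] by simp
      show "countable (?C ` H')" using H'(1) by (rule countable_image)
      fix T assume "T \<in> ?C ` H'"
      then obtain h where h: "h \<in> H'" "T = ?C h" by (elim imageE)
      show "closedin ?Z T \<and> ?Z interior_of T = {}"
        unfolding h(2) using Ccl[OF subsetD[OF H'(2) h(1)]] none h(1) by (intro conjI) simp_all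
    qed
    then show False using ne by simp
  qed
  then obtain h0 y0 where h0: "h0 \<in> H'" "y0 \<in> ?Z interior_of ?C h0" by blast
  let ?I = "?Z interior_of ?C h0"
  have IH: "?I \<subseteq> H" using interior_of_subset_topspace[of ?Z "?C h0"] topZ by simp
  have y0H: "y0 \<in> H" using h0 IH by blast
  have h0H: "h0 \<in> H" using h0 H' by blast
  let ?S = "\<lambda>g. {y \<in> H. (y0 \<otimes> inv g) \<otimes> y \<in> ?I}"
  have S: "openin ?Z (?S g)" "g \<in> ?S g" if g: "g \<in> H" for g
  proof -
    have y0g: "y0 \<otimes> inv g \<in> H" using y0H g mult_H inv_H by blast
    have "continuous_map ?Z (mtop M) (\<lambda>y. (y0 \<otimes> inv g) \<otimes> y)"
      by (rule continuous_map_from_subtopology[OF G.continuous_left_mult[OF H_in_carrier[OF y0g]]])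
    then have c: "continuous_map ?Z ?Z (\<lambda>y. (y0 \<otimes> inv g) \<otimes> y)"
      using mult_H[OF y0g] topZ by (auto simp: continuous_map_in_subtopology)
    show "openin ?Z (?S g)" using openin_continuous_map_preimage[OF c openin_interior_of[of ?Z "?C h0"]] by (simp only: topZ)
    show "g \<in> ?S g" using g h0 H_in_carrier[OF g] H_in_carrier[OF y0H] by (simp add: G.m_assoc)
  qed
  have "\<exists>F. finite F \<and> F \<subseteq> ?S ` H \<and> \<Union>F = H"
    using Zc S unfolding compact_space_alt topZ
  proof -
    assume "\<forall>\<U>. Ball \<U> (openin ?Z) \<and> H \<subseteq> \<Union>\<U> \<longrightarrow> (\<exists>\<F>. finite \<F> \<and> \<F> \<subseteq> \<U> \<and> H \<subseteq> \<Union>\<F>)"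
    moreover have "Ball (?S ` H) (openin ?Z)" "H \<subseteq> \<Union>(?S ` H)" using S by blast+
    ultimately obtain F where "finite F" "F \<subseteq> ?S ` H" "H \<subseteq> \<Union>F" by meson
    then show ?thesis by (intro exI[of _ F]) blast
  qed
  then obtain F where F: "finite F" "F \<subseteq> ?S ` H" "\<Union>F = H" by blast
  obtain H2 where H2: "finite H2" "H2 \<subseteq> H" "F = ?S ` H2"
    using finite_subset_image[OF F(1,2)] by blast
  let ?A = "(\<lambda>g. g \<otimes> inv y0 \<otimes> h0) ` H2"
  have "\<exists>a\<in>?A. \<exists>u\<in>?Q. y = a \<otimes> u" if y: "y \<in> H" for y
  proof -
    obtain g where g: "g \<in> H2" "y \<in> ?S g" using F(3) H2(3) y by blast
    then have "(y0 \<otimes> inv g) \<otimes> y \<in> ?C h0" using interior_of_subset[of ?Z "?C h0"] by blast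
    then obtain u where u: "u \<in> ?Q" "(y0 \<otimes> inv g) \<otimes> y = h0 \<otimes> u" by blast
    have c: "g \<in> carrier G" "y0 \<in> carrier G" "h0 \<in> carrier G" "u \<in> carrier G" "y \<in> carrier G"
      using H_in_carrier g H2 y0H h0H u QH y by blast+
    have "y = (g \<otimes> inv y0) \<otimes> ((y0 \<otimes> inv g) \<otimes> y)"
    proof -
      have "(g \<otimes> inv y0) \<otimes> ((y0 \<otimes> inv g) \<otimes> y) = g \<otimes> ((inv y0 \<otimes> y0) \<otimes> (inv g \<otimes> y))"
        using c by (simp only: G.m_assoc G.m_closed G.inv_closed)
      also have "\<dots> = g \<otimes> (inv g \<otimes> y)" using c by simp
      also have "\<dots> = y" using c by (simp add: G.m_assoc[symmetric])
      finally show ?thesis by simp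
    qed
    also have "\<dots> = (g \<otimes> inv y0 \<otimes> h0) \<otimes> u" unfolding u(2) using c by (simp add: G.m_assoc)
    finally show ?thesis using g u by blast
  qed
  moreover have "finite ?A" "?A \<subseteq> H" using H2 y0H h0H mult_H inv_H by (auto simp: subset_iff)
  ultimately show ?thesis by blast
qed

lemma increment_bounded_uniform:
  obtains C where "0 \<le> C" "\<And>h. h \<in> H \<Longrightarrow> increment_bounded C h"
proof -
  obtain K R where KR: "0 \<le> K" "0 < R" "ecbox d p R \<subseteq> W"
    "\<And>r q. 0 \<le> r \<Longrightarrow> r < R \<Longrightarrow> q \<in> ecbox d p r \<Longrightarrow> increment_bounded (K * r) (\<kappa> q)"
    by (rule increment_bounded_cube) (rule that)
  define r where "r = R / 2"
  have r: "0 < r" "r < R" using KR(2) by (auto simp: r_def)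
  have rW: "ecbox d p r \<subseteq> W" using KR(3) r by (force simp: ecbox_def)
  obtain A where A0: "finite A \<and> A \<subseteq> H \<and> (\<forall>h\<in>H. \<exists>a\<in>A. \<exists>u\<in>\<kappa> ` ecbox d p r. h = a \<otimes> u)"
    using finite_net[OF r(1) rW] by (rule exE)
  then have A: "finite A" "A \<subseteq> H" by simp_all
  have "\<forall>a. \<exists>c. a \<in> A \<longrightarrow> 0 \<le> c \<and> increment_bounded c a"
    using increment_bounded_exists A(2) by (meson subsetD)
  then obtain c where c: "\<forall>a. a \<in> A \<longrightarrow> 0 \<le> c a \<and> increment_bounded (c a) a"
    by (rule choice[THEN exE])
  show thesis
  proof (rule that[of "(\<Sum>a\<in>A. c a) + K * r"])
    show "0 \<le> (\<Sum>a\<in>A. c a) + K * r" using c KR(1) r by (intro add_nonneg_nonneg sum_nonneg) simp_all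
    fix h assume "h \<in> H"
    then have "\<exists>a\<in>A. \<exists>u\<in>\<kappa> ` ecbox d p r. h = a \<otimes> u" using A0 by simp
    then obtain a q where a: "a \<in> A" "q \<in> ecbox d p r" "h = a \<otimes> \<kappa> q" by (elim bexE imageE) simp
    have "increment_bounded (c a) a" using c a(1) by simp
    moreover have "increment_bounded (K * r) (\<kappa> q)" by (rule KR(4)) (use r a in simp_all)
    ultimately have e: "increment_bounded (c a + K * r) (a \<otimes> \<kappa> q)"
      by (rule increment_bounded_mult[OF subsetD[OF A(2) a(1)] \<kappa>_H[OF subsetD[OF rW a(2)]]])
    have "c a \<le> (\<Sum>a\<in>A. c a)" by (rule member_le_sum[OF a(1) _ A(1)]) (use c in simp)
    then show "increment_bounded ((\<Sum>a\<in>A. c a) + K * r) h" unfolding a(3) by (intro increment_bounded_mono[OF e]) simp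
  qed
qed

end

section \<open>Limits of approximate solutions\<close>

lemma pointwise_cluster_point:
  fixes g :: "nat \<Rightarrow> 'a \<Rightarrow> complex"
  assumes "\<And>k x. x \<in> S \<Longrightarrow> norm (g k x) \<le> b"
  obtains g0 where "\<And>F e n. finite F \<Longrightarrow> F \<subseteq> S \<Longrightarrow> 0 < e \<Longrightarrow> \<exists>k\<ge>n. \<forall>s\<in>F. norm (g k s - g0 s) < e"
proof -
  let ?B = "top_of_set (cball (0::complex) b)"
  let ?X = "product_topology (\<lambda>_. ?B) S"
  have "compact_space ?B" by (simp add: compact_space_subtopology)
  then have X: "compact_space ?X" by (simp add: compact_space_product_topology)
  define z where "z = (\<lambda>k. restrict (g k) S)"
  have z: "z k \<in> topspace ?X" for k using assms by (auto simp: z_def)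
  let ?C = "\<lambda>n. ?X closure_of (z ` {n..})"
  have "(\<Inter>n. ?C n) \<noteq> {}"
  proof (rule compact_space_imp_nest[OF X])
    show "?C n \<noteq> {}" for n
    proof -
      have "z ` {n..} \<subseteq> topspace ?X" using z by (rule image_subsetI)
      then have "z ` {n..} \<subseteq> ?C n" by (rule closure_of_subset)
      then show ?thesis by (metis atLeast_iff empty_iff image_eqI order_refl subset_empty)
    qed
    show "decseq ?C" by (intro antimonoI closure_of_mono image_mono) auto
  qed auto
  then obtain g0 where g0: "\<And>n. g0 \<in> ?C n" by blast
  show thesis
  proof (rule that[of g0])
    fix F e n assume F: "finite F" "F \<subseteq> S" and e: "(0::real) < e"
    let ?T = "Pi\<^sub>E S (\<lambda>s. if s \<in> F then cball 0 b \<inter> ball (g0 s) e else cball 0 b)"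
    have "g0 \<in> topspace ?X" by (rule subsetD[OF closure_of_subset_topspace g0[of 0]])
    then have "g0 \<in> ?T" using e by (auto simp: PiE_iff split: if_splits)
    moreover have "openin ?X ?T"
    proof -
      have "{s \<in> S. (if s \<in> F then cball 0 b \<inter> ball (g0 s) e else cball 0 b) \<noteq> topspace ?B} \<subseteq> F" by auto
      then have "finite {s \<in> S. (if s \<in> F then cball 0 b \<inter> ball (g0 s) e else cball 0 b) \<noteq> topspace ?B}"
        using F(1) finite_subset by blast
      then show ?thesis unfolding openin_PiE_gen by (auto simp: openin_open_Int)
    qed
    ultimately obtain y where "y \<in> z ` {n..}" "y \<in> ?T" using g0[of n] unfolding in_closure_of by blast
    then obtain k where k: "n \<le> k" "z k \<in> ?T" by auto
    have "norm (g k s - g0 s) < e" if s: "s \<in> F" for s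
    proof -
      have "z k s \<in> cball 0 b \<inter> ball (g0 s) e" using PiE_mem[OF k(2), of s] F(2) s by auto
      then show ?thesis using F(2) s by (auto simp: z_def dist_norm norm_minus_commute)
    qed
    with k(1) show "\<exists>k\<ge>n. \<forall>s\<in>F. norm (g k s - g0 s) < e" by blast
  qed
qed

lemma (in smooth_manifold) C_inf_continuous_map:
  assumes f: "f \<in> C_inf M"
  shows "continuous_map (mtop M) euclidean f"
  unfolding continuous_map_def
proof (intro conjI allI impI)
  fix V :: "complex set" assume "openin euclidean V"
  then have V: "open V" by simp
  show "openin (mtop M) {x \<in> topspace (mtop M). f x \<in> V}"
  proof (subst openin_subopen, rule ballI)
    fix x assume x: "x \<in> {x \<in> topspace (mtop M). f x \<in> V}"
    then obtain U \<phi> where U: "(U, \<phi>) \<in> atlas M" "x \<in> U" using chart_exists by blast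
    obtain e where e: "0 < e" "ball (f x) e \<subseteq> V" using V x by (auto elim: openE)
    have c: "cont_ES (mdim M) (\<phi> ` U) (\<lambda>y. f (inv_into U \<phi> y))"
      by (rule smooth_cont[OF chart_image[OF U(1)] C_inf_chart[OF f U(1)]])
    obtain r where r: "0 < r" "\<And>y. y \<in> ebox (mdim M) (\<phi> x) r \<Longrightarrow> dist (f (inv_into U \<phi> y)) (f x) < e"
      using cont_ES_D[OF c imageI[OF U(2)] e(1)] chart_inv[OF U] by metis
    let ?T = "{z \<in> U. \<phi> z \<in> ebox (mdim M) (\<phi> x) r}"
    have "?T \<subseteq> {x \<in> topspace (mtop M). f x \<in> V}"
    proof
      fix z assume z: "z \<in> ?T"
      then have "dist (f z) (f x) < e" using r(2)[of "\<phi> z"] chart_inv[OF U(1)] by simp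
      then show "z \<in> {x \<in> topspace (mtop M). f x \<in> V}" using e(2) z chart_subset[OF U(1)] by (auto simp: dist_commute)
    qed
    moreover have "x \<in> ?T" using U r(1) chart_image_ES[OF U(1)] by (auto intro: centre_in_ebox)
    moreover have "openin (mtop M) ?T" by (rule chart_open_preimage[OF U(1) open_ES_ebox])
    ultimately show "\<exists>T. openin (mtop M) T \<and> x \<in> T \<and> T \<subseteq> {x \<in> topspace (mtop M). f x \<in> V}"
      by (intro exI[of _ ?T] conjI)
  qed
qed simp

lemma (in smooth_manifold) C_inf_bounded:
  assumes "compact_space (mtop M)" "f \<in> C_inf M"
  obtains b where "0 \<le> b" "\<And>x. x \<in> topspace (mtop M) \<Longrightarrow> norm (f x) \<le> b"
proof -
  have "compactin euclidean (f ` topspace (mtop M))"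
    by (rule image_compactin[OF _ C_inf_continuous_map[OF assms(2)]]) (use assms(1) in \<open>simp add: compact_space_def\<close>)
  then have "bounded (f ` topspace (mtop M))" by (simp add: compact_imp_bounded)
  then show thesis using that unfolding bounded_pos by (metis imageI less_imp_le)
qed

lemma locally_bounded_family_UN:
  assumes W: "open_ES d W" and I: "finite I" and BB: "\<And>i. i \<in> I \<Longrightarrow> locally_bounded_family d W (BB i)"
  shows "locally_bounded_family d W (\<Union>i\<in>I. BB i)"
  unfolding locally_bounded_family_def
proof (intro conjI ballI allI impI)
  show "smooth_on_open d W b" if "b \<in> (\<Union>i\<in>I. BB i)" for b
    using that BB unfolding locally_bounded_family_def by blast
  fix ks x assume ks: "set ks \<subseteq> {..<d}" and x: "x \<in> W"
  show "\<exists>r>0. \<exists>M. ebox d x r \<subseteq> W \<and> (\<forall>b\<in>\<Union>i\<in>I. BB i. \<forall>y\<in>ebox d x r. norm (iter_partial ks b y) \<le> M)"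
    using I BB
  proof (induction I rule: finite_induct)
    case empty
    then show ?case using W x unfolding open_ES_iff by auto
  next
    case (insert i I)
    obtain r1 M1 where 1: "0 < r1" "ebox d x r1 \<subseteq> W" "\<forall>b\<in>\<Union>i\<in>I. BB i. \<forall>y\<in>ebox d x r1. norm (iter_partial ks b y) \<le> M1"
      using insert.IH insert.prems by auto
    have "locally_bounded_family d W (BB i)" using insert.prems by simp
    from this[unfolded locally_bounded_family_def, THEN conjunct2, rule_format, OF ks x]
    obtain r2 M2 where 2: "0 < r2" "\<forall>b\<in>BB i. \<forall>y\<in>ebox d x r2. norm (iter_partial ks b y) \<le> M2" by blast
    have bd: "norm (iter_partial ks b y) \<le> max M1 M2" if "b \<in> (\<Union>i\<in>insert i I. BB i)" "y \<in> ebox d x (min r1 r2)" for b y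
    proof -
      have "y \<in> ebox d x r1" "y \<in> ebox d x r2" using that(2) by (auto simp: ebox_def)
      then show ?thesis using 1(3) 2(2) that(1) by (auto simp: le_max_iff_disj)
    qed
    have sub: "ebox d x (min r1 r2) \<subseteq> W" using 1(2) ebox_mono[of "min r1 r2" r1 d x] by auto
    show ?case
      by (rule exI[of _ "min r1 r2"], intro conjI, use 1 2 in simp, rule exI[of _ "max M1 M2"])
        (intro conjI ballI sub bd)
  qed
qed

lemma pair_in_ebox: "a \<in> ebox d a0 r \<Longrightarrow> b \<in> ebox e b0 r \<Longrightarrow> pair_ES d a b \<in> ebox (d + e) (pair_ES d a0 b0) r"
  by (auto simp: ebox_def pair_ES_in_ES) (auto simp: pair_ES_def)

lemma (in lie_group) locally_bounded_family_translates:
  assumes w: "w \<in> C_inf M" and U: "(U, \<phi>) \<in> atlas M" and K: "compactin (mtop M) K"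
  shows "locally_bounded_family (mdim M) (\<phi> ` U) ((\<lambda>h a. w (inv_into U \<phi> a \<otimes> h)) ` K)"
  unfolding locally_bounded_family_def
proof (intro conjI ballI allI impI)
  let ?D = "mdim M" and ?b = "\<lambda>h a. w (inv_into U \<phi> a \<otimes> h)"
  have Kc: "K \<subseteq> carrier G" using compactin_subset_topspace[OF K] topspace_carrier by simp
  fix b assume "b \<in> ?b ` K"
  then obtain h where h: "h \<in> K" "b = ?b h" by blast
  show "smooth_on_open ?D (\<phi> ` U) b"
    unfolding h(2)
    by (rule C_inf_param[OF w param_mult[OF param_chart[OF U] param_const[OF chart_image[OF U]]]])
      (use h(1) Kc topspace_carrier in blast)
next
  let ?D = "mdim M" and ?b = "\<lambda>h a. w (inv_into U \<phi> a \<otimes> h)"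
  fix ks a0 assume ks: "set ks \<subseteq> {..<?D}" and a0: "a0 \<in> \<phi> ` U"
  have a0ES: "a0 \<in> ES ?D" using a0 chart_image_ES[OF U] by blast
  have "\<exists>T r m. openin (mtop M) T \<and> h0 \<in> T \<and> 0 < r \<and>
     (\<forall>h\<in>T. \<forall>a\<in>ebox ?D a0 r. a \<in> \<phi> ` U \<and> norm (iter_partial ks (?b h) a) \<le> m)" if h0: "h0 \<in> K" for h0
  proof -
    obtain V \<psi> where V: "(V, \<psi>) \<in> atlas M" "h0 \<in> V" using chart_exists h0 compactin_subset_topspace[OF K] by blast
    let ?\<Psi> = "\<lambda>z. w (inv_into U \<phi> (fst_ES ?D z) \<otimes> inv_into V \<psi> (snd_ES ?D z))" and ?Q = "prod_ES ?D ?D (\<phi> ` U) (\<psi> ` V)"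
    have oQ: "open_ES (?D + ?D) ?Q" by (rule open_prod_ES[OF chart_image[OF U] chart_image[OF V(1)]])
    have "smooth_on_open (?D + ?D) ?Q (iter_partial ks ?\<Psi>)"
      by (rule smooth_iter_partial[OF smooth_translate_param_joint[OF U param_chart[OF V(1)] w]]) (use ks in auto)
    then have c: "cont_ES (?D + ?D) ?Q (iter_partial ks ?\<Psi>)" by (rule smooth_cont[OF oQ])
    let ?z0 = "pair_ES ?D a0 (\<psi> h0)"
    have z0: "?z0 \<in> ?Q"
      using a0 V(2) chart_image_ES[OF U] chart_image_ES[OF V(1)] by (intro pair_in_prod_ES) auto
    obtain r where r: "0 < r" "\<And>z. z \<in> ebox (?D + ?D) ?z0 r \<Longrightarrow> z \<in> ?Q"
      "\<And>z. z \<in> ebox (?D + ?D) ?z0 r \<Longrightarrow> dist (iter_partial ks ?\<Psi> z) (iter_partial ks ?\<Psi> ?z0) < 1"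
      by (rule cont_ES_D[OF c z0 zero_less_one]) (rule that)
    define T where "T = {h \<in> V. \<psi> h \<in> ebox ?D (\<psi> h0) r}"
    have bd: "a \<in> \<phi> ` U \<and> norm (iter_partial ks (?b h) a) \<le> norm (iter_partial ks ?\<Psi> ?z0) + 1"
      if h: "h \<in> T" and a: "a \<in> ebox ?D a0 r" for h a
    proof -
      have z: "pair_ES ?D a (\<psi> h) \<in> ebox (?D + ?D) ?z0 r" using h a by (intro pair_in_ebox) (auto simp: T_def)
      have aES: "a \<in> ES ?D" using a by (simp add: ebox_def)
      have aU: "a \<in> \<phi> ` U" using r(2)[OF z] aES by (simp add: prod_ES_def)
      have "iter_partial ks (?b h) a = iter_partial ks (\<lambda>a. ?\<Psi> (pair_ES ?D a (\<psi> h))) a"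
      proof (rule iter_partial_cong[OF chart_image[OF U] ks _ aU])
        fix y assume "y \<in> \<phi> ` U"
        then have "fst_ES ?D (pair_ES ?D y (\<psi> h)) = y" using chart_image_ES[OF U] by (intro fst_pair_ES) blast
        moreover have "inv_into V \<psi> (\<psi> h) = h" using h chart_inv[OF V(1)] by (simp add: T_def)
        ultimately show "?b h y = ?\<Psi> (pair_ES ?D y (\<psi> h))" by simp
      qed
      also have "\<dots> = iter_partial ks ?\<Psi> (pair_ES ?D a (\<psi> h))" by (rule iter_partial_pair_ES[OF ks])
      finally have "norm (iter_partial ks (?b h) a) \<le> norm (iter_partial ks ?\<Psi> ?z0) + 1"
        using r(3)[OF z] norm_triangle_sub[of "iter_partial ks ?\<Psi> (pair_ES ?D a (\<psi> h))" "iter_partial ks ?\<Psi> ?z0"]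
        by (simp add: dist_norm)
      with aU show ?thesis by blast
    qed
    have oT: "openin (mtop M) T" unfolding T_def by (rule chart_open_preimage[OF V(1) open_ES_ebox])
    have hT: "h0 \<in> T" using V r(1) chart_image_ES[OF V(1)] by (auto simp: T_def intro: centre_in_ebox)
    show ?thesis
      by (rule exI[of _ T], rule exI[of _ r], rule exI[of _ "norm (iter_partial ks ?\<Psi> ?z0) + 1"])
        (intro conjI ballI oT hT r(1); use bd in simp)
  qed
  then have "\<forall>h0. \<exists>q. h0 \<in> K \<longrightarrow> openin (mtop M) (fst q) \<and> h0 \<in> fst q \<and> 0 < fst (snd q) \<and>
     (\<forall>h\<in>fst q. \<forall>a\<in>ebox ?D a0 (fst (snd q)). a \<in> \<phi> ` U \<and> norm (iter_partial ks (?b h) a) \<le> snd (snd q))"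
    by (metis fst_conv snd_conv)
  then obtain q where q: "\<forall>h0. h0 \<in> K \<longrightarrow> openin (mtop M) (fst (q h0)) \<and> h0 \<in> fst (q h0) \<and> 0 < fst (snd (q h0)) \<and>
     (\<forall>h\<in>fst (q h0). \<forall>a\<in>ebox ?D a0 (fst (snd (q h0))). a \<in> \<phi> ` U \<and> norm (iter_partial ks (?b h) a) \<le> snd (snd (q h0)))"
    by (rule choice[THEN exE])
  have "\<exists>F. finite F \<and> F \<subseteq> (\<lambda>h. fst (q h)) ` K \<and> K \<subseteq> \<Union>F"
    by (rule compactinD[OF K]) (use q in blast)+
  then obtain F where F: "finite F" "F \<subseteq> (\<lambda>h. fst (q h)) ` K" "K \<subseteq> \<Union>F" by (elim exE conjE) (rule that)
  obtain J where J: "finite J" "J \<subseteq> K" "F = (\<lambda>h. fst (q h)) ` J"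
    using finite_subset_image[OF F(1,2)] by (elim exE conjE) (rule that)
  obtain r0 where r0: "0 < r0" "ebox ?D a0 r0 \<subseteq> \<phi> ` U" using chart_image[OF U] a0 unfolding open_ES_iff by meson
  obtain r where r: "0 < r" "\<And>h. h \<in> J \<Longrightarrow> r \<le> fst (snd (q h))"
    using finite_min_pos[OF J(1), of "\<lambda>h. fst (snd (q h))"] q J(2) by (metis subsetD)
  define m where "m = (\<Sum>h\<in>J. \<bar>snd (snd (q h))\<bar>)"
  have bd: "norm (iter_partial ks (?b h) a) \<le> m" if h: "h \<in> K" and a: "a \<in> ebox ?D a0 (min r0 r)" for h a
  proof -
    have "h \<in> \<Union>((\<lambda>h. fst (q h)) ` J)" using F(3) J(3) h by blast
    then obtain h0 where h0: "h0 \<in> J" "h \<in> fst (q h0)" unfolding UN_iff by (elim bexE)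
    have "a \<in> ebox ?D a0 (fst (snd (q h0)))" using a r(2)[OF h0(1)] by (auto simp: ebox_def intro: less_le_trans)
    then have "norm (iter_partial ks (?b h) a) \<le> snd (snd (q h0))" using q h0 J(2) by (metis subsetD)
    also have "\<dots> \<le> \<bar>snd (snd (q h0))\<bar>" by simp
    also have "\<dots> \<le> m" unfolding m_def by (rule member_le_sum[OF h0(1) _ J(1)]) simp
    finally show ?thesis .
  qed
  show "\<exists>r>0. \<exists>M. ebox ?D a0 r \<subseteq> \<phi> ` U \<and> (\<forall>b\<in>?b ` K. \<forall>y\<in>ebox ?D a0 r. norm (iter_partial ks b y) \<le> M)"
  proof (rule exI[of _ "min r0 r"], intro conjI, use r r0 in simp, rule exI[of _ m], intro conjI ballI)
    show "ebox ?D a0 (min r0 r) \<subseteq> \<phi> ` U" using r0(2) ebox_mono[of "min r0 r" r0 ?D a0] by auto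
    fix b y assume "b \<in> ?b ` K" and y: "y \<in> ebox ?D a0 (min r0 r)"
    then obtain h where h: "h \<in> K" "b = ?b h" by (elim imageE)
    show "norm (iter_partial ks b y) \<le> m" unfolding h(2) by (rule bd[OF h(1) y])
  qed
qed

context closed_lie_subgroup
begin

lemma H_compact: "compactin (mtop M) H"
  using closedin_compact_space[OF compact closed] .

lemma smooth_of_domination:
  assumes v: "\<And>i. i < d \<Longrightarrow> v i \<in> C_inf M" and C: "0 \<le> C"
    and dom: "\<And>xs B. snd ` set xs \<subseteq> carrier G \<Longrightarrow> 0 \<le> B \<Longrightarrow>
       (\<And>i h. i < d \<Longrightarrow> h \<in> H \<Longrightarrow> norm (lcomb xs (\<lambda>s. v i (s \<otimes> h))) \<le> B) \<Longrightarrow> norm (lcomb xs g) \<le> C * B"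
  shows "restrict0 (topspace (mtop M)) g \<in> C_inf M"
proof (rule G.C_inf_param_restrict0)
  fix V \<phi> assume V: "(V, \<phi>) \<in> atlas M"
  let ?b = "\<lambda>i h a. v i (inv_into V \<phi> a \<otimes> h)"
  let ?BB = "\<Union>i\<in>{..<d}. ?b i ` H"
  have V_in: "inv_into V \<phi> a \<in> carrier G" if "a \<in> \<phi> ` V" for a
    using paramD(2)[OF G.param_chart[OF V] that] by (simp add: G.topspace_carrier)
  have lb: "locally_bounded_family (mdim M) (\<phi> ` V) ?BB"
    by (rule locally_bounded_family_UN[OF G.chart_image[OF V] finite_lessThan])
      (use G.locally_bounded_family_translates[OF v V H_compact] in simp)
  show "smooth_on_open (mdim M) (\<phi> ` V) (\<lambda>y. g (inv_into V \<phi> y))"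
  proof (rule dominated_smooth[OF G.chart_image[OF V] lb C])
    show "dominated (\<phi> ` V) C ?BB (\<lambda>y. g (inv_into V \<phi> y))"
      unfolding dominated_def
    proof (intro allI impI)
      fix xs :: "(complex \<times> (nat \<Rightarrow> real)) list" and B :: real
      assume xs: "snd ` set xs \<subseteq> \<phi> ` V" and B: "0 \<le> B" "\<forall>b\<in>?BB. norm (lcomb xs b) \<le> B"
      let ?ys = "map (\<lambda>(c, a). (c, inv_into V \<phi> a)) xs"
      have ys: "snd ` set ?ys \<subseteq> carrier G" using xs V_in by force
      have "norm (lcomb ?ys g) \<le> C * B"
      proof (rule dom[OF ys B(1)])
        fix i h assume ih: "i < d" "h \<in> H"
        then have "?b i h \<in> ?BB" by blast
        then show "norm (lcomb ?ys (\<lambda>s. v i (s \<otimes> h))) \<le> B" unfolding lcomb_map using B(2) by blast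
      qed
      then show "norm (lcomb xs (\<lambda>y. g (inv_into V \<phi> y))) \<le> C * B" unfolding lcomb_map .
    qed
  qed
qed

definition net_average :: "'a set \<Rightarrow> ('a \<Rightarrow> complex) \<Rightarrow> 'a \<Rightarrow> complex" where
  "net_average A f x = (\<Sum>a\<in>A. f (x \<otimes> a)) / of_nat (card A)"

lemma minus_net_average:
  assumes "finite A" "A \<noteq> {}"
  shows "f x - net_average A f x = - (\<Sum>a\<in>A. f (x \<otimes> a) - f x) / of_nat (card A)"
  using assms by (simp add: net_average_def sum_subtractf field_simps)

lemma norm_average_le:
  fixes F :: "'a \<Rightarrow> complex"
  assumes "finite A" "A \<noteq> {}" "\<And>a. a \<in> A \<Longrightarrow> norm (F a) \<le> e"
  shows "norm ((\<Sum>a\<in>A. F a) / of_nat (card A)) \<le> e"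
proof -
  have c: "0 < real (card A)" using assms(1,2) by (simp add: card_gt_0_iff)
  have "norm (\<Sum>a\<in>A. F a) \<le> real (card A) * e" using sum_norm_le[of A F "\<lambda>_. e"] assms(3) by simp
  then show ?thesis using c by (simp add: norm_divide field_simps)
qed

lemma net_average_dominated:
  assumes A: "finite A" "A \<noteq> {}" "A \<subseteq> H" and increment_bounded: "\<And>h. h \<in> H \<Longrightarrow> increment_bounded C h" and f: "f \<in> C_inf M"
    and xs: "snd ` set xs \<subseteq> carrier G" "0 \<le> B" "\<And>i k. i < d \<Longrightarrow> k \<in> H \<Longrightarrow> norm (lcomb xs (\<lambda>s. X i (s \<otimes> k) f)) \<le> B"
  shows "norm (lcomb xs (\<lambda>x. f x - net_average A f x)) \<le> C * B"
proof -
  have "lcomb xs (\<lambda>x. f x - net_average A f x) = lcomb xs (\<lambda>x. (- 1 / of_nat (card A)) * (\<Sum>a\<in>A. f (x \<otimes> a) - f x))"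
    by (simp add: minus_net_average[OF A(1,2)])
  also have "\<dots> = (\<Sum>a\<in>A. - lcomb xs (\<lambda>x. f (x \<otimes> a) - f x)) / of_nat (card A)"
    unfolding lcomb_cmult lcomb_sum by (simp add: sum_negf)
  finally have eq: "lcomb xs (\<lambda>x. f x - net_average A f x) = (\<Sum>a\<in>A. - lcomb xs (\<lambda>x. f (x \<otimes> a) - f x)) / of_nat (card A)" .
  show ?thesis
    unfolding eq
  proof (rule norm_average_le[OF A(1,2)])
    fix a assume "a \<in> A"
    then have "increment_bounded C a" using increment_bounded A(3) by blast
    from increment_boundedD[OF this f xs] show "norm (- lcomb xs (\<lambda>x. f (x \<otimes> a) - f x)) \<le> C * B" by simp
  qed
qed

lemma net_average_invariant:
  assumes A: "finite A" "A \<noteq> {}" "A \<subseteq> H"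
    and match: "bij_betw \<pi> A ((\<lambda>a. h \<otimes> a) ` A)" "\<And>a. a \<in> A \<Longrightarrow> \<exists>u\<in>Q. \<exists>u'\<in>Q. a \<otimes> u = \<pi> a \<otimes> u'"
    and Q: "Q \<subseteq> H" "\<And>u. u \<in> Q \<Longrightarrow> increment_bounded e u" and f: "f \<in> C_inf M"
    and m: "0 \<le> m" "\<And>i x. i < d \<Longrightarrow> x \<in> carrier G \<Longrightarrow> norm (X i x f) \<le> m"
    and x: "x \<in> carrier G" and h: "h \<in> H"
  shows "norm (net_average A f (x \<otimes> h) - net_average A f x) \<le> 2 * e * m"
proof -
  have \<pi>H: "\<pi> a \<in> H" if "a \<in> A" for a
  proof -
    have "\<pi> a \<in> (\<lambda>a. h \<otimes> a) ` A" by (rule bspec[OF bij_betwE[OF match(1)] that])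
    then obtain a' where "a' \<in> A" "\<pi> a = h \<otimes> a'" by (elim imageE)
    then show ?thesis using mult_H[OF h subsetD[OF A(3)]] by simp
  qed
  have inj: "inj_on (\<lambda>a. h \<otimes> a) A"
  proof (rule inj_onI)
    fix a b assume "a \<in> A" "b \<in> A" "h \<otimes> a = h \<otimes> b"
    then show "a = b" using H_in_carrier[OF h] H_in_carrier subsetD[OF A(3)] by simp
  qed
  have "(\<Sum>a\<in>A. f ((x \<otimes> h) \<otimes> a)) = (\<Sum>a\<in>A. f (x \<otimes> (h \<otimes> a)))"
    using A(3) H_in_carrier H_in_carrier[OF h] x by (intro sum.cong) (auto simp: G.m_assoc subset_iff)
  also have "\<dots> = (\<Sum>b\<in>(\<lambda>a. h \<otimes> a) ` A. f (x \<otimes> b))" using sum.reindex[OF inj, of "\<lambda>b. f (x \<otimes> b)"] by simp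
  also have "\<dots> = (\<Sum>a\<in>A. f (x \<otimes> \<pi> a))" by (rule sum.reindex_bij_betw[OF match(1), symmetric])
  finally have "net_average A f (x \<otimes> h) - net_average A f x = (\<Sum>a\<in>A. f (x \<otimes> \<pi> a) - f (x \<otimes> a)) / of_nat (card A)"
    by (simp add: net_average_def sum_subtractf diff_divide_distrib)
  moreover have "norm (f (x \<otimes> \<pi> a) - f (x \<otimes> a)) \<le> 2 * e * m" if a: "a \<in> A" for a
  proof -
    obtain u u' where u: "u \<in> Q" "u' \<in> Q" "a \<otimes> u = \<pi> a \<otimes> u'" using match(2)[OF a] by blast
    have c: "a \<in> carrier G" "\<pi> a \<in> carrier G" "u \<in> carrier G" "u' \<in> carrier G"
      using a A(3) \<pi>H[OF a] u Q(1) H_in_carrier by blast+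
    have 1: "norm (f ((x \<otimes> a) \<otimes> u) - f (x \<otimes> a)) \<le> e * m"
      by (rule increment_bounded_pointwise[OF Q(2)[OF u(1)] f _ m]) (use x c in auto)
    have 2: "norm (f ((x \<otimes> \<pi> a) \<otimes> u') - f (x \<otimes> \<pi> a)) \<le> e * m"
      by (rule increment_bounded_pointwise[OF Q(2)[OF u(2)] f _ m]) (use x c in auto)
    have eq: "(x \<otimes> a) \<otimes> u = (x \<otimes> \<pi> a) \<otimes> u'" using x c u(3) by (simp add: G.m_assoc)
    have "f (x \<otimes> \<pi> a) - f (x \<otimes> a) = (f ((x \<otimes> a) \<otimes> u) - f (x \<otimes> a)) - (f ((x \<otimes> \<pi> a) \<otimes> u') - f (x \<otimes> \<pi> a))"
      unfolding eq by simp
    then show ?thesis using order_trans[OF norm_triangle_ineq4 add_mono[OF 1 2]] by simp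
  qed
  ultimately show ?thesis using norm_average_le[OF A(1,2), of "\<lambda>a. f (x \<otimes> \<pi> a) - f (x \<otimes> a)"] by simp
qed

lemma limit_increment:
  assumes f: "\<And>k. f k \<in> C_inf M" and v: "\<And>i. i < d \<Longrightarrow> v i \<in> C_inf M"
    and appr: "\<And>i k x. i < d \<Longrightarrow> x \<in> carrier G \<Longrightarrow> norm (X i x (f k) - v i x) \<le> 1 / (real k + 1)"
    and x: "x \<in> carrier G" and i: "i < d" and \<epsilon>: "0 < \<epsilon>"
  obtains \<delta> b where "0 < \<delta>" "0 \<le> b" "\<And>t. \<bar>t - p i\<bar> < \<delta> \<Longrightarrow> p(i := t) \<in> W"
    "\<And>t k. \<bar>t - p i\<bar> < \<delta> \<Longrightarrow>
       norm (f k (x \<otimes> \<kappa> (p(i := t))) - f k x - (t - p i) *\<^sub>R v i x) \<le> (\<epsilon> + b / (real k + 1)) * \<bar>t - p i\<bar>"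
proof -
  obtain B where B: "\<And>l i. l < d \<Longrightarrow> i < d \<Longrightarrow> smooth_on_open d W (B l i :: _ \<Rightarrow> real)"
    "\<And>f s q l. f \<in> C_inf M \<Longrightarrow> s \<in> carrier G \<Longrightarrow> q \<in> W \<Longrightarrow> l < d \<Longrightarrow>
      has_partial l (\<lambda>q. f (s \<otimes> \<kappa> q)) (\<Sum>i<d. B l i q *\<^sub>R X i (s \<otimes> \<kappa> q) f) q"
    by (rule frame_change) (rule that)
  define E where "E = (\<lambda>q. \<Sum>j<d. B i j q *\<^sub>R v j (x \<otimes> \<kappa> q))"
  define S where "S = (\<lambda>q. \<Sum>j<d. \<bar>B i j q\<bar>)"
  have E_smooth: "smooth_on_open d W E"
    unfolding E_def
    by (intro smooth_sum smooth_scaleR W_open finite_lessThan B(1) i G.smooth_translate_param[OF param_M x] v) auto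
  obtain R0 where R0: "0 < R0" "ebox d p R0 \<subseteq> W" using W_open p_in_W unfolding open_ES_iff by meson
  have cS: "cont_ES d W S"
  proof -
    have cj: "cont_ES d W (\<lambda>q. \<bar>B i j q\<bar>)" if "j < d" for j
      using smooth_cont[OF W_open B(1)[OF i that]] unfolding cont_ES_tendsto using tendsto_rabs by blast
    have "cont_ES d W (\<lambda>q. \<Sum>j\<in>J. \<bar>B i j q\<bar>)" if "finite J" "J \<subseteq> {..<d}" for J
      using that by (induction J rule: finite_induct) (auto intro!: cont_ES_const[OF W_open] cont_ES_add cj)
    then show ?thesis unfolding S_def by blast
  qed
  have Ep: "E p = v i x"
  proof -
    have lim: "(\<lambda>k. X j x (f k)) \<longlonglongrightarrow> v j x" if j: "j < d" for j
    proof (rule LIMSEQ_I)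
      fix r :: real assume "0 < r"
      then obtain n where n: "1 / (real n + 1) < r"
        using reals_Archimedean[of r] by (auto simp: inverse_eq_divide add.commute)
      show "\<exists>n. \<forall>k\<ge>n. norm (X j x (f k) - v j x) < r"
      proof (intro exI[of _ n] allI impI)
        fix k assume "n \<le> k"
        then have "1 / (real k + 1) \<le> 1 / (real n + 1)" by (intro divide_left_mono) auto
        then show "norm (X j x (f k) - v j x) < r" using appr[OF j x, of k] n by linarith
      qed
    qed
    have eq: "X i x (f k) = (\<Sum>j<d. B i j p *\<^sub>R X j x (f k))" for k
    proof -
      have "has_partial i (\<lambda>q. f k (x \<otimes> \<kappa> q)) (\<Sum>j<d. B i j p *\<^sub>R X j (x \<otimes> \<kappa> p) (f k)) p"
        by (rule B(2)[OF f x p_in_W i])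
      from G.coord_field_eqI[OF param_M p_in_W \<kappa>_p i x f this] show ?thesis using x by (simp add: \<kappa>_p)
    qed
    have "(\<lambda>k. X i x (f k)) \<longlonglongrightarrow> (\<Sum>j<d. B i j p *\<^sub>R v j x)"
      unfolding eq[abs_def] by (intro tendsto_sum tendsto_scaleR tendsto_const lim) auto
    then have "v i x = (\<Sum>j<d. B i j p *\<^sub>R v j x)" using LIMSEQ_unique lim[OF i] by blast
    then show ?thesis using x by (simp add: E_def \<kappa>_p)
  qed
  obtain r1 where r1: "0 < r1" "\<And>y. y \<in> ebox d p r1 \<Longrightarrow> y \<in> W" "\<And>y. y \<in> ebox d p r1 \<Longrightarrow> dist (E y) (E p) < \<epsilon>"
    by (rule cont_ES_D[OF smooth_cont[OF W_open E_smooth] p_in_W \<epsilon>]) (rule that)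
  obtain r2 where r2: "0 < r2" "\<And>y. y \<in> ebox d p r2 \<Longrightarrow> y \<in> W" "\<And>y. y \<in> ebox d p r2 \<Longrightarrow> dist (S y) (S p) < 1"
    by (rule cont_ES_D[OF cS p_in_W zero_less_one]) (rule that)
  define \<delta> where "\<delta> = min r1 r2"
  define b where "b = \<bar>S p\<bar> + 1"
  have \<delta>: "0 < \<delta>" using r1 r2 by (simp add: \<delta>_def)
  have box: "p(i := t) \<in> ebox d p r1" "p(i := t) \<in> ebox d p r2" if "\<bar>t - p i\<bar> < \<delta>" for t
    using that \<delta> r1(1) r2(1) by (auto intro!: upd_in_ebox p_in_ES i simp: \<delta>_def simp del: fun_upd_apply)
  have pt: "norm ((\<Sum>j<d. B i j q *\<^sub>R X j (x \<otimes> \<kappa> q) (f k)) - v i x) \<le> \<epsilon> + b / (real k + 1)"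
    if q: "q \<in> ebox d p r1" "q \<in> ebox d p r2" for q k
  proof -
    have xq: "x \<otimes> \<kappa> q \<in> carrier G" using x H_in_carrier[OF \<kappa>_H[OF r1(2)[OF q(1)]]] by simp
    have "norm ((\<Sum>j<d. B i j q *\<^sub>R X j (x \<otimes> \<kappa> q) (f k)) - E q) =
        norm (\<Sum>j<d. B i j q *\<^sub>R (X j (x \<otimes> \<kappa> q) (f k) - v j (x \<otimes> \<kappa> q)))"
      by (simp add: E_def sum_subtractf scaleR_diff_right)
    also have "\<dots> \<le> (\<Sum>j<d. \<bar>B i j q\<bar> * (1 / (real k + 1)))"
      by (rule sum_norm_le, unfold norm_scaleR, rule mult_left_mono) (use appr[OF _ xq] in auto)
    also have "\<dots> = S q * (1 / (real k + 1))" unfolding S_def sum_distrib_right ..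
    also have "\<dots> \<le> b * (1 / (real k + 1))"
      using r2(3)[OF q(2)] by (intro mult_right_mono) (auto simp: b_def dist_real_def)
    finally have 1: "norm ((\<Sum>j<d. B i j q *\<^sub>R X j (x \<otimes> \<kappa> q) (f k)) - E q) \<le> b / (real k + 1)" by simp
    have 2: "norm (E q - v i x) \<le> \<epsilon>" using r1(3)[OF q(1)] by (simp add: Ep dist_norm)
    have "(\<Sum>j<d. B i j q *\<^sub>R X j (x \<otimes> \<kappa> q) (f k)) - v i x =
       ((\<Sum>j<d. B i j q *\<^sub>R X j (x \<otimes> \<kappa> q) (f k)) - E q) + (E q - v i x)" by simp
    then show ?thesis using norm_triangle_mono[OF 1 2] by simp
  qed
  show thesis
  proof (rule that[of \<delta> b])
    show "0 \<le> b" by (simp add: b_def)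
    show "p(i := t) \<in> W" if "\<bar>t - p i\<bar> < \<delta>" for t by (rule r1(2)[OF box(1)[OF that]])
    fix t k assume t: "\<bar>t - p i\<bar> < \<delta>"
    let ?S = "{s. \<bar>s - p i\<bar> < \<delta>}"
    have "?S = ball (p i) \<delta>" by (auto simp: dist_real_def)
    then have cvx: "convex ?S" by simp
    let ?F = "\<lambda>s. f k (x \<otimes> \<kappa> (p(i := s))) - s *\<^sub>R v i x"
    let ?F' = "\<lambda>s. (\<Sum>j<d. B i j (p(i := s)) *\<^sub>R X j (x \<otimes> \<kappa> (p(i := s))) (f k)) - v i x"
    have "norm (?F t - ?F (p i)) \<le> (\<epsilon> + b / (real k + 1)) * norm (t - p i)"
    proof (rule differentiable_bound[OF cvx])
      fix s assume s: "s \<in> ?S"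
      then have s': "\<bar>s - p i\<bar> < \<delta>" by simp
      have "has_partial i (\<lambda>q. f k (x \<otimes> \<kappa> q)) (\<Sum>j<d. B i j (p(i := s)) *\<^sub>R X j (x \<otimes> \<kappa> (p(i := s))) (f k)) (p(i := s))"
        by (rule B(2)[OF f x r1(2)[OF box(1)[OF s']] i])
      then have "((\<lambda>s. f k (x \<otimes> \<kappa> (p(i := s)))) has_vector_derivative (\<Sum>j<d. B i j (p(i := s)) *\<^sub>R X j (x \<otimes> \<kappa> (p(i := s))) (f k))) (at s)"
        by simp
      then have "(?F has_vector_derivative ?F' s) (at s)"
        by (intro has_vector_derivative_diff) (auto intro!: derivative_eq_intros)
      then show "(?F has_derivative (\<lambda>h. h *\<^sub>R ?F' s)) (at s within ?S)"
        unfolding has_vector_derivative_def by (rule has_derivative_at_withinI)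
      have "norm (?F' s) \<le> \<epsilon> + b / (real k + 1)" by (rule pt[OF box[OF s']])
      then show "onorm (\<lambda>h. h *\<^sub>R ?F' s) \<le> \<epsilon> + b / (real k + 1)"
        by (subst onorm_scaleR_left) (auto simp: onorm_id bounded_linear_ident)
    qed (use t \<delta> in auto)
    then show "norm (f k (x \<otimes> \<kappa> (p(i := t))) - f k x - (t - p i) *\<^sub>R v i x) \<le> (\<epsilon> + b / (real k + 1)) * \<bar>t - p i\<bar>"
      using x by (simp add: \<kappa>_p algebra_simps)
  qed (rule \<delta>)
qed

theorem approximate_solutions:
  assumes f: "\<And>k. f k \<in> C_inf M" and v: "\<And>i. i < d \<Longrightarrow> v i \<in> C_inf M"
    and appr: "\<And>i k x. i < d \<Longrightarrow> x \<in> carrier G \<Longrightarrow> norm (X i x (f k) - v i x) \<le> 1 / (real k + 1)"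
  obtains g where "g \<in> C_inf M" "\<And>i x. i < d \<Longrightarrow> x \<in> carrier G \<Longrightarrow> X i x g = v i x"
proof -
  have "\<forall>i. \<exists>b. i < d \<longrightarrow> 0 \<le> b \<and> (\<forall>x\<in>carrier G. norm (v i x) \<le> b)"
    using G.C_inf_bounded[OF compact v] unfolding G.topspace_carrier by metis
  then obtain b where b: "\<forall>i. i < d \<longrightarrow> 0 \<le> b i \<and> (\<forall>x\<in>carrier G. norm (v i x) \<le> b i)" by (rule choice[THEN exE])
  define m where "m = (\<Sum>i<d. b i) + 1"
  have m: "0 \<le> m" using b by (auto simp: m_def intro!: add_nonneg_nonneg sum_nonneg)
  have Xm: "norm (X i x (f k)) \<le> m" if "i < d" "x \<in> carrier G" for i x k
  proof -
    have "norm (X i x (f k)) \<le> norm (v i x) + norm (X i x (f k) - v i x)" by (rule norm_triangle_sub)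
    also have "\<dots> \<le> b i + 1"
      using b that appr[OF that, of k] by (intro add_mono) (auto intro: order_trans)
    also have "b i \<le> (\<Sum>i<d. b i)" by (rule member_le_sum) (use b that in auto)
    finally show ?thesis by (simp add: m_def)
  qed
  obtain C where C: "0 \<le> C" "\<And>h. h \<in> H \<Longrightarrow> increment_bounded C h" by (rule increment_bounded_uniform) (rule that)
  obtain K R where KR: "0 \<le> K" "0 < R" "ecbox d p R \<subseteq> W"
    "\<And>r q. 0 \<le> r \<Longrightarrow> r < R \<Longrightarrow> q \<in> ecbox d p r \<Longrightarrow> increment_bounded (K * r) (\<kappa> q)"
    by (rule increment_bounded_cube) (rule that)
  define r where "r = (\<lambda>k. R / (real k + 2))"
  have r: "0 < r k" "r k < R" for k
  proof -
    show "0 < r k" using KR(2) by (simp add: r_def add_nonneg_pos)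
    have "r k \<le> R / 2" unfolding r_def using KR(2) by (intro divide_left_mono) auto
    then show "r k < R" using KR(2) by simp
  qed
  have rW: "ecbox d p (r k) \<subseteq> W" for k using KR(3) r[of k] by (force simp: ecbox_def)
  have QH: "\<kappa> ` ecbox d p (r k) \<subseteq> H" for k using rW[of k] \<kappa>_H by blast
  have "\<exists>A. finite A \<and> A \<subseteq> H \<and> A \<noteq> {} \<and> (\<forall>h\<in>H. \<exists>\<pi>. bij_betw \<pi> A ((\<lambda>a. h \<otimes> a) ` A) \<and>
     (\<forall>a\<in>A. \<exists>u\<in>\<kappa> ` ecbox d p (r k). \<exists>u'\<in>\<kappa> ` ecbox d p (r k). a \<otimes> u = \<pi> a \<otimes> u'))" for k
  proof -
    obtain A where A': "finite A" "A \<subseteq> H" "A \<noteq> {}" "\<And>h. h \<in> H \<Longrightarrow> \<exists>\<pi>. bij_betw \<pi> A ((\<lambda>a. h \<otimes> a) ` A) \<and>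
       (\<forall>a\<in>A. \<exists>u\<in>\<kappa> ` ecbox d p (r k). \<exists>u'\<in>\<kappa> ` ecbox d p (r k). a \<otimes> u = \<pi> a \<otimes> u')"
      by (rule G.net_matching[OF sub QH[of k] finite_net[OF r(1)[of k] rW[of k]]]) (rule that)
    show ?thesis by (rule exI[of _ A]) (intro conjI ballI A')
  qed
  then obtain A where A: "\<And>k. finite (A k)" "\<And>k. A k \<subseteq> H" "\<And>k. A k \<noteq> {}"
    "\<And>k h. h \<in> H \<Longrightarrow> \<exists>\<pi>. bij_betw \<pi> (A k) ((\<lambda>a. h \<otimes> a) ` A k) \<and>
       (\<forall>a\<in>A k. \<exists>u\<in>\<kappa> ` ecbox d p (r k). \<exists>u'\<in>\<kappa> ` ecbox d p (r k). a \<otimes> u = \<pi> a \<otimes> u')"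
    by metis
  define g where "g = (\<lambda>k x. f k x - net_average (A k) (f k) x)"
  define \<delta> where "\<delta> = (\<lambda>k. 2 * (K * r k) * m)"
  have \<delta>0: "\<delta> \<longlonglongrightarrow> 0"
  proof -
    have "(\<lambda>k. 2 * (K * (R / real (k + 2))) * m) \<longlonglongrightarrow> 2 * (K * 0) * m"
      by (intro tendsto_intros LIMSEQ_ignore_initial_segment[OF lim_const_over_n])
    then show ?thesis by (simp add: \<delta>_def r_def add.commute)
  qed
  have g_bound: "norm (g k x) \<le> C * m" if x: "x \<in> carrier G" for k x
  proof -
    have "norm (lcomb [(1, x)] (\<lambda>x. f k x - net_average (A k) (f k) x)) \<le> C * m"
      by (rule net_average_dominated[OF A(1,3,2) C(2) f _ m]) (use x Xm H_in_carrier in auto)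
    then show ?thesis by (simp add: g_def)
  qed
  have g_dom: "norm (lcomb xs (g k)) \<le> C * (B + (\<Sum>(c, s)\<leftarrow>xs. norm c) * (1 / (real k + 1)))"
    if xs: "snd ` set xs \<subseteq> carrier G" "0 \<le> B" "\<And>i h. i < d \<Longrightarrow> h \<in> H \<Longrightarrow> norm (lcomb xs (\<lambda>s. v i (s \<otimes> h))) \<le> B"
    for xs B k
    unfolding g_def
  proof (rule net_average_dominated[OF A(1,3,2) C(2) f xs(1)])
    let ?l = "(\<Sum>(c, s)\<leftarrow>xs. norm c)"
    have "0 \<le> ?l" by (intro sum_list_nonneg) auto
    then show "0 \<le> B + ?l * (1 / (real k + 1))" using xs(2) by simp
    fix i h assume ih: "i < d" "h \<in> H"
    have "norm (lcomb xs (\<lambda>s. X i (s \<otimes> h) (f k) - v i (s \<otimes> h))) \<le> ?l * (1 / (real k + 1))"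
      by (rule norm_lcomb_le, rule appr[OF ih(1)]) (use xs(1) H_in_carrier[OF ih(2)] in auto)
    then have "norm (lcomb xs (\<lambda>s. X i (s \<otimes> h) (f k)) - lcomb xs (\<lambda>s. v i (s \<otimes> h))) \<le> ?l * (1 / (real k + 1))"
      by (simp only: lcomb_diff)
    then show "norm (lcomb xs (\<lambda>s. X i (s \<otimes> h) (f k))) \<le> B + ?l * (1 / (real k + 1))"
      using xs(3)[OF ih] norm_triangle_sub[of "lcomb xs (\<lambda>s. X i (s \<otimes> h) (f k))" "lcomb xs (\<lambda>s. v i (s \<otimes> h))"] by linarith
  qed
  have g_inv: "norm ((g k (x \<otimes> h) - g k x) - (f k (x \<otimes> h) - f k x)) \<le> \<delta> k" if x: "x \<in> carrier G" and h: "h \<in> H" for k x h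
  proof -
    obtain \<pi> where \<pi>: "bij_betw \<pi> (A k) ((\<lambda>a. h \<otimes> a) ` A k)"
       "\<And>a. a \<in> A k \<Longrightarrow> \<exists>u\<in>\<kappa> ` ecbox d p (r k). \<exists>u'\<in>\<kappa> ` ecbox d p (r k). a \<otimes> u = \<pi> a \<otimes> u'" using A(4)[OF h] by metis
    have "norm (net_average (A k) (f k) (x \<otimes> h) - net_average (A k) (f k) x) \<le> 2 * (K * r k) * m"
    proof (rule net_average_invariant[OF A(1,3,2) \<pi> QH _ f m Xm x h])
      fix u assume "u \<in> \<kappa> ` ecbox d p (r k)"
      then show "increment_bounded (K * r k) u" using KR(4)[of "r k"] r[of k] by auto
    qed
    then show ?thesis by (simp add: g_def \<delta>_def norm_minus_commute algebra_simps)
  qed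
  obtain g0 where g0: "\<And>F e n. finite F \<Longrightarrow> F \<subseteq> carrier G \<Longrightarrow> 0 < e \<Longrightarrow> \<exists>k\<ge>n. \<forall>s\<in>F. norm (g k s - g0 s) < e"
    by (rule pointwise_cluster_point[of "carrier G" g, OF g_bound]) (assumption, rule that)
  let ?g = "restrict0 (topspace (mtop M)) g0"
  have g_C: "?g \<in> C_inf M"
  proof (rule smooth_of_domination[OF v C(1)])
    fix xs B assume xs: "snd ` set xs \<subseteq> carrier G" "0 \<le> B"
      "\<And>i h. i < d \<Longrightarrow> h \<in> H \<Longrightarrow> norm (lcomb xs (\<lambda>s. v i (s \<otimes> h))) \<le> B"
    let ?l = "(\<Sum>(c, s)\<leftarrow>xs. norm c)"
    have l: "0 \<le> ?l" by (intro sum_list_nonneg) auto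
    have step: "norm (lcomb xs g0) \<le> C * (B + ?l * (1 / (real n + 1))) + ?l * (1 / (real n + 1))" for n
    proof -
      have "\<exists>k\<ge>n. \<forall>s\<in>snd ` set xs. norm (g k s - g0 s) < 1 / (real n + 1)"
        by (rule g0) (use xs(1) in auto)
      then obtain k where k: "n \<le> k" "\<forall>s\<in>snd ` set xs. norm (g k s - g0 s) < 1 / (real n + 1)" by blast
      have "norm (lcomb xs (\<lambda>s. g k s - g0 s)) \<le> ?l * (1 / (real n + 1))"
        by (rule norm_lcomb_le) (use k(2) in \<open>auto intro: less_imp_le\<close>)
      then have 1: "norm (lcomb xs g0 - lcomb xs (g k)) \<le> ?l * (1 / (real n + 1))"
        by (simp only: lcomb_diff norm_minus_commute)
      have "norm (lcomb xs (g k)) \<le> C * (B + ?l * (1 / (real k + 1)))" by (rule g_dom[OF xs])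
      also have "\<dots> \<le> C * (B + ?l * (1 / (real n + 1)))"
        using k(1) l C(1) by (intro mult_left_mono add_left_mono divide_left_mono) auto
      finally show ?thesis using 1 norm_triangle_sub[of "lcomb xs g0" "lcomb xs (g k)"] by linarith
    qed
    show "norm (lcomb xs g0) \<le> C * B"
    proof (rule LIMSEQ_le_const)
      have "(\<lambda>n. C * (B + ?l * (1 / real (n + 1))) + ?l * (1 / real (n + 1))) \<longlonglongrightarrow> C * (B + ?l * 0) + ?l * 0"
        by (intro tendsto_intros LIMSEQ_ignore_initial_segment[OF lim_const_over_n])
      then show "(\<lambda>n. C * (B + ?l * (1 / (real n + 1))) + ?l * (1 / (real n + 1))) \<longlonglongrightarrow> C * B" by (simp add: add.commute)
      show "\<exists>N. \<forall>n\<ge>N. norm (lcomb xs g0) \<le> C * (B + ?l * (1 / (real n + 1))) + ?l * (1 / (real n + 1))"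
        using step by blast
    qed
  qed
  have g_eq: "?g x = g0 x" if "x \<in> carrier G" for x using that by (simp add: restrict0_def G.topspace_carrier)
  have Xg: "X i x ?g = v i x" if i: "i < d" and x: "x \<in> carrier G" for i x
  proof (rule G.coord_field_eqI[OF param_M p_in_W \<kappa>_p i x g_C])
    show "has_partial i (\<lambda>q. ?g (x \<otimes> \<kappa> q)) (v i x) p"
      unfolding has_vector_derivative_def has_derivative_at_alt
    proof (intro conjI allI impI)
      fix \<epsilon> :: real assume \<epsilon>: "0 < \<epsilon>"
      obtain \<rho> b' where \<rho>: "0 < \<rho>" "0 \<le> b'" "\<And>t. \<bar>t - p i\<bar> < \<rho> \<Longrightarrow> p(i := t) \<in> W"
        "\<And>t k. \<bar>t - p i\<bar> < \<rho> \<Longrightarrow>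
          norm (f k (x \<otimes> \<kappa> (p(i := t))) - f k x - (t - p i) *\<^sub>R v i x) \<le> (\<epsilon> + b' / (real k + 1)) * \<bar>t - p i\<bar>"
        by (rule limit_increment[OF f v appr x i \<epsilon>]) (assumption+, rule that)
      show "\<exists>d>0. \<forall>y. norm (y - p i) < d \<longrightarrow>
          norm (?g (x \<otimes> \<kappa> (p(i := y))) - ?g (x \<otimes> \<kappa> (p(i := p i))) - (y - p i) *\<^sub>R v i x) \<le> \<epsilon> * norm (y - p i)"
      proof (intro exI[of _ \<rho>] conjI allI impI \<rho>(1))
        fix t assume "norm (t - p i) < \<rho>"
        then have t: "\<bar>t - p i\<bar> < \<rho>" by simp
        let ?h = "\<kappa> (p(i := t))"
        have h: "?h \<in> H" by (rule \<kappa>_H[OF \<rho>(3)[OF t]])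
        have xh: "x \<otimes> ?h \<in> carrier G" using x H_in_carrier[OF h] by simp
        have step: "norm (g0 (x \<otimes> ?h) - g0 x - (t - p i) *\<^sub>R v i x) \<le> (\<epsilon> + b' * (1 / (real n + 1))) * \<bar>t - p i\<bar> + 2 * (K * R) * m * (1 / (real n + 1)) + 2 * (1 / (real n + 1))" for n
        proof -
          have "\<exists>k\<ge>n. \<forall>s\<in>{x, x \<otimes> ?h}. norm (g k s - g0 s) < 1 / (real n + 1)"
            by (rule g0) (use x xh in auto)
          then obtain k where k: "n \<le> k" "norm (g k x - g0 x) < 1 / (real n + 1)" "norm (g k (x \<otimes> ?h) - g0 (x \<otimes> ?h)) < 1 / (real n + 1)"
            by auto
          have kn: "1 / (real k + 1) \<le> 1 / (real n + 1)" using k(1) by (intro divide_left_mono) auto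
          have "r k \<le> R * (1 / (real n + 1))" unfolding r_def using KR(2) k(1) by (simp add: divide_left_mono)
          then have \<delta>k: "\<delta> k \<le> 2 * (K * R) * m * (1 / (real n + 1))"
            using mult_left_mono[of "r k" "R * (1 / (real n + 1))" "2 * K * m"] KR(1) m by (simp add: \<delta>_def mult_ac)
          have 3: "norm (f k (x \<otimes> ?h) - f k x - (t - p i) *\<^sub>R v i x) \<le> (\<epsilon> + b' * (1 / (real n + 1))) * \<bar>t - p i\<bar>"
          proof (rule order_trans[OF \<rho>(4)[OF t]], rule mult_right_mono)
            show "\<epsilon> + b' / (real k + 1) \<le> \<epsilon> + b' * (1 / (real n + 1))"
              using mult_left_mono[OF kn \<rho>(2)] by simp
          qed simp
          have 2: "norm ((g k (x \<otimes> ?h) - g k x) - (f k (x \<otimes> ?h) - f k x)) \<le> 2 * (K * R) * m * (1 / (real n + 1))"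
            using g_inv[OF x h, of k] \<delta>k by linarith
          have eq: "g0 (x \<otimes> ?h) - g0 x - (t - p i) *\<^sub>R v i x =
            (f k (x \<otimes> ?h) - f k x - (t - p i) *\<^sub>R v i x) + ((g k (x \<otimes> ?h) - g k x) - (f k (x \<otimes> ?h) - f k x))
              + ((g k x - g0 x) - (g k (x \<otimes> ?h) - g0 (x \<otimes> ?h)))" by simp
          have 1: "norm ((g k x - g0 x) - (g k (x \<otimes> ?h) - g0 (x \<otimes> ?h))) \<le> 1 / (real n + 1) + 1 / (real n + 1)"
            by (rule order_trans[OF norm_triangle_ineq4 add_mono[OF less_imp_le[OF k(2)] less_imp_le[OF k(3)]]])
          show ?thesis
            unfolding eq by (rule order_trans[OF norm_triangle_mono[OF norm_triangle_mono[OF 3 2] 1]]) simp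
        qed
        have "norm (g0 (x \<otimes> ?h) - g0 x - (t - p i) *\<^sub>R v i x) \<le> \<epsilon> * \<bar>t - p i\<bar>"
        proof (rule LIMSEQ_le_const)
          have "(\<lambda>n. (\<epsilon> + b' * (1 / real (n + 1))) * \<bar>t - p i\<bar> + 2 * (K * R) * m * (1 / real (n + 1)) + 2 * (1 / real (n + 1)))
              \<longlonglongrightarrow> (\<epsilon> + b' * 0) * \<bar>t - p i\<bar> + 2 * (K * R) * m * 0 + 2 * 0"
            by (intro tendsto_intros LIMSEQ_ignore_initial_segment[OF lim_const_over_n])
          then show "(\<lambda>n. (\<epsilon> + b' * (1 / (real n + 1))) * \<bar>t - p i\<bar> + 2 * (K * R) * m * (1 / (real n + 1)) + 2 * (1 / (real n + 1)))
              \<longlonglongrightarrow> \<epsilon> * \<bar>t - p i\<bar>" by (simp add: add.commute)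
          show "\<exists>N. \<forall>n\<ge>N. norm (g0 (x \<otimes> ?h) - g0 x - (t - p i) *\<^sub>R v i x) \<le>
              (\<epsilon> + b' * (1 / (real n + 1))) * \<bar>t - p i\<bar> + 2 * (K * R) * m * (1 / (real n + 1)) + 2 * (1 / (real n + 1))"
            using step by blast
        qed
        then show "norm (?g (x \<otimes> \<kappa> (p(i := t))) - ?g (x \<otimes> \<kappa> (p(i := p i))) - (t - p i) *\<^sub>R v i x) \<le> \<epsilon> * norm (t - p i)"
          using x g_eq[OF x] g_eq[OF xh] by (simp add: \<kappa>_p)
      qed
    qed (simp add: bounded_linear_scaleR_left)
  qed
  show thesis by (rule that[OF g_C Xg])
qed

end

lemma (in smooth_manifold) finite_chart_cover:
  assumes "compact_space (mtop M)"
  obtains \<K> where "finite \<K>"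
    "\<And>U \<phi> K. (U, \<phi>, K) \<in> \<K> \<Longrightarrow> (U, \<phi>) \<in> atlas M \<and> compactin (Euclidean_space (mdim M)) K \<and> K \<subseteq> \<phi> ` U"
    "topspace (mtop M) \<subseteq> (\<Union>(U, \<phi>, K)\<in>\<K>. inv_into U \<phi> ` K)"
proof -
  let ?good = "\<lambda>(U, \<phi>, K). (U, \<phi>) \<in> atlas M \<and> compactin (Euclidean_space (mdim M)) K \<and> K \<subseteq> \<phi> ` U"
  let ?im = "\<lambda>(U, \<phi>, K). inv_into U \<phi> ` K"
  have nb: "\<exists>T c. openin (mtop M) T \<and> x \<in> T \<and> ?good c \<and> T \<subseteq> ?im c" if x: "x \<in> topspace (mtop M)" for x
  proof -
    obtain U \<phi> where U: "(U, \<phi>) \<in> atlas M" "x \<in> U" using chart_exists[OF x] by blast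
    obtain R where R: "0 < R" "ebox (mdim M) (\<phi> x) R \<subseteq> \<phi> ` U"
      using chart_image[OF U(1)] U(2) unfolding open_ES_iff by blast
    let ?K = "ecbox (mdim M) (\<phi> x) (R / 2)" and ?T = "{z \<in> U. \<phi> z \<in> ebox (mdim M) (\<phi> x) (R / 2)}"
    have "?K \<subseteq> \<phi> ` U" using ecbox_subset_ebox[of "R / 2" R] R by fastforce
    then have "?good (U, \<phi>, ?K)" using U(1) compactin_ecbox by simp
    moreover have "?T \<subseteq> ?im (U, \<phi>, ?K)"
    proof
      fix z assume z: "z \<in> ?T"
      then have "z = inv_into U \<phi> (\<phi> z)" using chart_inv[OF U(1)] by simp
      moreover have "\<phi> z \<in> ?K" using z ebox_subset_ecbox by blast
      ultimately show "z \<in> ?im (U, \<phi>, ?K)" unfolding prod.case by (rule image_eqI)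
    qed
    moreover have "openin (mtop M) ?T" by (rule chart_open_preimage[OF U(1) open_ES_ebox])
    moreover have "\<phi> x \<in> ES (mdim M)" using chart_image_ES[OF U(1)] U(2) by blast
    then have "x \<in> ?T" using U R(1) by (simp add: centre_in_ebox)
    ultimately show ?thesis by (intro exI[of _ ?T] exI[of _ "(U, \<phi>, ?K)"] conjI)
  qed
  have "\<forall>x. \<exists>q. x \<in> topspace (mtop M) \<longrightarrow> openin (mtop M) (fst q) \<and> x \<in> fst q \<and> ?good (snd q) \<and> fst q \<subseteq> ?im (snd q)"
  proof
    fix x
    show "\<exists>q. x \<in> topspace (mtop M) \<longrightarrow> openin (mtop M) (fst q) \<and> x \<in> fst q \<and> ?good (snd q) \<and> fst q \<subseteq> ?im (snd q)"
    proof (cases "x \<in> topspace (mtop M)")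
      case True
      obtain T c where "openin (mtop M) T \<and> x \<in> T \<and> ?good c \<and> T \<subseteq> ?im c"
        using nb[OF True] by (elim exE) (rule that)
      then show ?thesis by (intro exI[of _ "(T, c)"] impI) (simp only: fst_conv snd_conv)
    qed simp
  qed
  then obtain q where q: "\<forall>x. x \<in> topspace (mtop M) \<longrightarrow> openin (mtop M) (fst (q x)) \<and> x \<in> fst (q x) \<and> ?good (snd (q x)) \<and> fst (q x) \<subseteq> ?im (snd (q x))"
    by (rule choice[THEN exE])
  have "compactin (mtop M) (topspace (mtop M))" using assms by (simp add: compact_space_def)
  then have "\<exists>F. finite F \<and> F \<subseteq> (\<lambda>x. fst (q x)) ` topspace (mtop M) \<and> topspace (mtop M) \<subseteq> \<Union>F"
    by (rule compactinD) (use q in blast)+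
  then obtain F where F: "finite F" "F \<subseteq> (\<lambda>x. fst (q x)) ` topspace (mtop M)" "topspace (mtop M) \<subseteq> \<Union>F"
    by (elim exE conjE) (rule that)
  obtain J where J: "finite J" "J \<subseteq> topspace (mtop M)" "F = (\<lambda>x. fst (q x)) ` J"
    using finite_subset_image[OF F(1,2)] by (elim exE conjE) (rule that)
  show thesis
  proof (rule that[of "(\<lambda>x. snd (q x)) ` J"])
    show "finite ((\<lambda>x. snd (q x)) ` J)" using J(1) by simp
    fix U \<phi> K assume "(U, \<phi>, K) \<in> (\<lambda>x. snd (q x)) ` J"
    then obtain x where x: "x \<in> J" "snd (q x) = (U, \<phi>, K)" by (elim imageE) simp
    then show "(U, \<phi>) \<in> atlas M \<and> compactin (Euclidean_space (mdim M)) K \<and> K \<subseteq> \<phi> ` U"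
      using q[rule_format, OF subsetD[OF J(2) x(1)]] by simp
  next
    show "topspace (mtop M) \<subseteq> (\<Union>(U, \<phi>, K)\<in>(\<lambda>x. snd (q x)) ` J. inv_into U \<phi> ` K)"
    proof
      fix z assume "z \<in> topspace (mtop M)"
      then have "z \<in> \<Union>((\<lambda>x. fst (q x)) ` J)" using F(3) J(3) by blast
      then obtain x where x: "x \<in> J" "z \<in> fst (q x)" unfolding UN_iff by (elim bexE)
      have "fst (q x) \<subseteq> ?im (snd (q x))"
        using q[rule_format, OF subsetD[OF J(2) x(1)]] by (elim conjE)
      then have "z \<in> ?im (snd (q x))" using x(2) by (rule subsetD)
      then show "z \<in> (\<Union>(U, \<phi>, K)\<in>(\<lambda>x. snd (q x)) ` J. inv_into U \<phi> ` K)"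
        by (rule UN_I[OF imageI[OF x(1)]])
    qed
  qed
qed

lemma (in smooth_manifold) openin_C_inf_ball:
  assumes "u \<in> C_inf M" "(U, \<phi>) \<in> atlas M" "compactin (Euclidean_space (mdim M)) K" "K \<subseteq> \<phi> ` U" "0 < e"
  shows "openin (C_inf_topology M) {g \<in> C_inf M. \<forall>y\<in>K. norm (g (inv_into U \<phi> y) - u (inv_into U \<phi> y)) < e}"
  unfolding C_inf_topology_def
  by (rule topology_generated_by_Basis, rule CollectI, rule exI[of _ u], rule exI[of _ U], rule exI[of _ \<phi>],
      rule exI[of _ K], rule exI[of _ "[]"], rule exI[of _ e]) (use assms in simp)

lemma (in smooth_manifold) C_inf_subset_topspace:
  assumes "topspace (mtop M) \<noteq> {}" "f \<in> C_inf M"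
  shows "f \<in> topspace (C_inf_topology M)"
proof -
  obtain x where "x \<in> topspace (mtop M)" using assms(1) by blast
  then obtain U \<phi> where U: "(U, \<phi>) \<in> atlas M" using chart_exists by blast
  have "f \<in> {g \<in> C_inf M. \<forall>y\<in>{}. norm (g (inv_into U \<phi> y) - f (inv_into U \<phi> y)) < 1}"
    using assms(2) by simp
  then show ?thesis
    using openin_subset[OF openin_C_inf_ball[OF assms(2) U _ _ zero_less_one, of "{}"]] by auto
qed

lemma (in smooth_manifold) openin_C_inf_uniform:
  assumes "compact_space (mtop M)" "topspace (mtop M) \<noteq> {}" and u: "u \<in> C_inf M" and e: "0 < e"
  obtains T where "openin (C_inf_topology M) T" "u \<in> T"
    "\<And>g x. g \<in> T \<Longrightarrow> x \<in> topspace (mtop M) \<Longrightarrow> norm (g x - u x) < e"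
proof -
  obtain \<K> where \<K>: "finite \<K>"
    "\<And>U \<phi> K. (U, \<phi>, K) \<in> \<K> \<Longrightarrow> (U, \<phi>) \<in> atlas M \<and> compactin (Euclidean_space (mdim M)) K \<and> K \<subseteq> \<phi> ` U"
    "topspace (mtop M) \<subseteq> (\<Union>(U, \<phi>, K)\<in>\<K>. inv_into U \<phi> ` K)"
    by (rule finite_chart_cover[OF assms(1)]) (rule that)
  let ?B = "\<lambda>(U, \<phi>, K). {g \<in> C_inf M. \<forall>y\<in>K. norm (g (inv_into U \<phi> y) - u (inv_into U \<phi> y)) < e}"
  have ne: "\<K> \<noteq> {}" using \<K>(3) assms(2) by auto
  have B: "openin (C_inf_topology M) (?B c)" if "c \<in> \<K>" for c
  proof -
    obtain U \<phi> K where c: "c = (U, \<phi>, K)" by (cases c)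
    show ?thesis
      unfolding c prod.case using \<K>(2)[OF that[unfolded c]] by (intro openin_C_inf_ball u e) auto
  qed
  show thesis
  proof (rule that[of "\<Inter>(?B ` \<K>)"])
    show "openin (C_inf_topology M) (\<Inter>(?B ` \<K>))"
      using \<K>(1) ne B by (intro openin_Inter) auto
    show "u \<in> \<Inter>(?B ` \<K>)" using u e by auto
    fix g x assume g: "g \<in> \<Inter>(?B ` \<K>)" and "x \<in> topspace (mtop M)"
    then obtain c where c: "c \<in> \<K>" "x \<in> (case c of (U, \<phi>, K) \<Rightarrow> inv_into U \<phi> ` K)" using \<K>(3) by blast
    obtain U \<phi> K where c': "c = (U, \<phi>, K)" by (cases c)
    have "g \<in> ?B (U, \<phi>, K)" using g c(1) unfolding c' by blast
    then show "norm (g x - u x) < e" using c(2) unfolding c' by auto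
  qed
qed

lemma sum_vfield_apply: "(\<Sum>v\<in>A. g v) x f = (\<Sum>v\<in>A. g v x f)" for g :: "'i \<Rightarrow> 'a vfield"
  by (induction A rule: infinite_finite_induct) auto

lemma span_vfields:
  fixes L :: "nat \<Rightarrow> 'a vfield"
  assumes "Z \<in> module.span vscale (L ` {..<n})" "inj_on L {..<n}"
  obtains c where "\<And>x f. Z x f = (\<Sum>j<n. c j * L j x f)"
proof -
  interpret V: vector_space vscale by (rule vector_space_vscale)
  have "Z \<in> range (\<lambda>u. \<Sum>v\<in>L ` {..<n}. vscale (u v) v)"
    using assms(1) V.span_finite[OF finite_imageI[OF finite_lessThan], of L n] by simp
  then obtain u where "Z = (\<Sum>v\<in>L ` {..<n}. vscale (u v) v)" by (elim imageE)
  also have "\<dots> = (\<Sum>j<n. vscale (u (L j)) (L j))" using sum.reindex[OF assms(2)] by simp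
  finally have "Z x f = (\<Sum>j<n. u (L j) * L j x f)" for x f
    by (simp add: sum_vfield_apply vscale_def)
  then show thesis by (rule that)
qed

context closed_lie_subgroup
begin

lemma restrict_C_inf:
  assumes f: "f \<in> C_inf M"
  shows "restrict0 (topspace (mtop N)) f \<in> C_inf N"
proof (rule N.C_inf_param_restrict0)
  fix V \<phi> assume V: "(V, \<phi>) \<in> atlas N"
  show "smooth_on_open (mdim N) (\<phi> ` V) (\<lambda>y. f (inv_into V \<phi> y))"
    by (rule G.C_inf_param[OF f param_smooth_map[OF N.smooth_manifold_axioms G.smooth_manifold_axioms incl N.param_chart[OF V]]])
qed

lemma coord_field_extends:
  assumes i: "i < d" and x: "x \<in> H"
  shows "pushforward N M (\<lambda>x. x) (coord_field (G\<lparr>carrier := H\<rparr>) N \<kappa> p i x) = X i x"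
proof
  fix f
  show "pushforward N M (\<lambda>x. x) (coord_field (G\<lparr>carrier := H\<rparr>) N \<kappa> p i x) f = X i x f"
  proof (cases "f \<in> C_inf M")
    case True
    have "partial_deriv i (\<lambda>q. restrict0 (topspace (mtop N)) f (x \<otimes> \<kappa> q)) p = partial_deriv i (\<lambda>q. f (x \<otimes> \<kappa> q)) p"
      by (rule partial_deriv_cong[OF W_open p_in_W i]) (use x \<kappa>_H mult_H topspace_N in \<open>auto simp: restrict0_def\<close>)
    then show ?thesis
      using True x H_in_carrier[OF x] restrict_C_inf[OF True] by (simp add: pushforward_def coord_field_def)
  qed (simp add: pushforward_def coord_field_def)
qed

lemma integral_field_span:
  assumes Z: "Z \<in> lie_algebra G M" and Y: "Y \<in> lie_algebra (G\<lparr>carrier := H\<rparr>) N"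
    and YZ: "\<And>x. x \<in> H \<Longrightarrow> pushforward N M (\<lambda>x. x) (Y x) = Z x"
  obtains c where "\<And>x f. x \<in> carrier G \<Longrightarrow> f \<in> C_inf M \<Longrightarrow> Z x f = (\<Sum>i<d. c i * X i x f)"
proof -
  have "Y \<one> \<in> ctangent_space N \<one>"
    using Y one_H topspace_N unfolding lie_algebra_def complex_lie_algebra_def vfields_def smooth_vfield_on_def by blast
  then obtain c where c: "\<And>w. w \<in> C_inf N \<Longrightarrow> Y \<one> w = (\<Sum>i<d. c i * partial_deriv i (\<lambda>q. w (\<kappa> q)) p)"
    by (rule N.ctangent_space_partials[OF U oneU]) (rule that)
  show thesis
  proof (rule that[of c])
    fix x f assume x: "x \<in> carrier G" and f: "f \<in> C_inf M"
    let ?f = "restrict0 (topspace (mtop M)) (\<lambda>y. f (x \<otimes> y))"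
    have f': "?f \<in> C_inf M" by (rule G.left_translate_C_inf[OF x f])
    have "Z x f = Z \<one> ?f" by (rule G.lie_algebra_apply[OF Z x f])
    also have "\<dots> = Y \<one> (restrict0 (topspace (mtop N)) ?f)"
      using YZ[OF one_H, symmetric] f' by (simp add: pushforward_def)
    also have "\<dots> = (\<Sum>i<d. c i * partial_deriv i (\<lambda>q. restrict0 (topspace (mtop N)) ?f (\<kappa> q)) p)"
      by (rule c[OF restrict_C_inf[OF f']])
    also have "\<dots> = (\<Sum>i<d. c i * X i x f)"
    proof (rule sum.cong[OF refl])
      fix i assume "i \<in> {..<d}"
      then have i: "i < d" by simp
      have "partial_deriv i (\<lambda>q. restrict0 (topspace (mtop N)) ?f (\<kappa> q)) p = partial_deriv i (\<lambda>q. f (x \<otimes> \<kappa> q)) p"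
        by (rule partial_deriv_cong[OF W_open p_in_W i])
          (use \<kappa>_H topspace_N H_in_carrier in \<open>auto simp: restrict0_def G.topspace_carrier\<close>)
      then show "c i * partial_deriv i (\<lambda>q. restrict0 (topspace (mtop N)) ?f (\<kappa> q)) p = c i * X i x f"
        using x f by (simp add: coord_field_def)
    qed
    finally show "Z x f = (\<Sum>i<d. c i * X i x f)" .
  qed
qed

lemma solve_limit_equation:
  fixes n :: nat
  assumes u: "\<And>j. j < n \<Longrightarrow> u j \<in> C_inf M"
    and XL: "\<And>i x f. i < d \<Longrightarrow> X i x f = (\<Sum>j<n. c i j * L j x f)"
    and LX: "\<And>j x f. j < n \<Longrightarrow> x \<in> carrier G \<Longrightarrow> f \<in> C_inf M \<Longrightarrow> L j x f = (\<Sum>i<d. y j i * X i x f)"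
    and appr: "\<And>e. 0 < e \<Longrightarrow> \<exists>f\<in>C_inf M. \<forall>j<n. \<forall>x\<in>carrier G. norm (L j x f - u j x) < e"
  obtains g where "g \<in> C_inf M" "\<And>j x. j < n \<Longrightarrow> x \<in> carrier G \<Longrightarrow> L j x g = u j x"
proof -
  define s where "s = (\<Sum>i<d. \<Sum>j<n. norm (c i j)) + 1"
  have s: "1 \<le> s" unfolding s_def by (auto intro!: sum_nonneg)
  have cs: "(\<Sum>j<n. norm (c i j)) \<le> s" if "i < d" for i
  proof -
    have "(\<Sum>j<n. norm (c i j)) \<le> (\<Sum>i<d. \<Sum>j<n. norm (c i j))"
      by (rule member_le_sum[of i _ "\<lambda>i. \<Sum>j<n. norm (c i j)"]) (use that in \<open>auto intro: sum_nonneg\<close>)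
    then show ?thesis by (simp add: s_def)
  qed
  have "\<forall>k. \<exists>f. f \<in> C_inf M \<and> (\<forall>j<n. \<forall>x\<in>carrier G. norm (L j x f - u j x) < 1 / (real k + 1) / s)"
  proof
    fix k
    have "0 < 1 / (real k + 1) / s" using s by (simp add: add_nonneg_pos)
    from appr[OF this] show "\<exists>f. f \<in> C_inf M \<and> (\<forall>j<n. \<forall>x\<in>carrier G. norm (L j x f - u j x) < 1 / (real k + 1) / s)"
      by (elim bexE) (intro exI conjI)
  qed
  then obtain f where f: "\<forall>k. f k \<in> C_inf M \<and> (\<forall>j<n. \<forall>x\<in>carrier G. norm (L j x (f k) - u j x) < 1 / (real k + 1) / s)"
    by (rule choice[THEN exE])
  define v where "v = (\<lambda>i x. \<Sum>j<n. c i j * u j x)"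
  have v: "v i \<in> C_inf M" for i
    unfolding v_def by (rule G.C_inf_sum) (use u in \<open>auto intro: G.C_inf_cmult\<close>)
  have Xv: "norm (X i x (f k) - v i x) \<le> 1 / (real k + 1)" if i: "i < d" and x: "x \<in> carrier G" for i k x
  proof -
    have "X i x (f k) - v i x = (\<Sum>j<n. c i j * (L j x (f k) - u j x))"
      unfolding XL[OF i] v_def by (simp add: sum_subtractf right_diff_distrib)
    also have "norm \<dots> \<le> (\<Sum>j<n. norm (c i j) * (1 / (real k + 1) / s))"
      by (rule sum_norm_le, unfold norm_mult, rule mult_left_mono) (use f x in \<open>auto intro: less_imp_le\<close>)
    also have "\<dots> = (\<Sum>j<n. norm (c i j)) * (1 / (real k + 1) / s)" by (rule sum_distrib_right[symmetric])
    also have "\<dots> \<le> s * (1 / (real k + 1) / s)" using cs[OF i] s by (intro mult_right_mono) auto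
    also have "\<dots> = 1 / (real k + 1)" using s by simp
    finally show ?thesis .
  qed
  have fC: "f k \<in> C_inf M" for k using f by simp
  obtain g where g: "g \<in> C_inf M" "\<And>i x. i < d \<Longrightarrow> x \<in> carrier G \<Longrightarrow> X i x g = v i x"
  proof (rule approximate_solutions[where f = f and v = v])
    show "f k \<in> C_inf M" for k by (rule fC)
    show "v i \<in> C_inf M" for i by (rule v)
    show "norm (X i x (f k) - v i x) \<le> 1 / (real k + 1)" if "i < d" "x \<in> carrier G" for i k x by (rule Xv[OF that])
  qed (rule that)
  have lim1: "(\<lambda>k::nat. 1 / (real k + 1)) \<longlonglongrightarrow> 0"
    using LIMSEQ_ignore_initial_segment[OF lim_const_over_n[of "1::real"], of 1] by (simp add: add.commute)
  show thesis
  proof (rule that[OF g(1)])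
    fix j x assume j: "j < n" and x: "x \<in> carrier G"
    have Xlim: "(\<lambda>k. X i x (f k)) \<longlonglongrightarrow> v i x" if "i < d" for i
    proof (rule LIM_zero_cancel, rule Lim_null_comparison[OF _ lim1])
      show "\<forall>\<^sub>F k in sequentially. norm (X i x (f k) - v i x) \<le> 1 / (real k + 1)"
        by (rule always_eventually) (use Xv[OF that x] in blast)
    qed
    have "(\<lambda>k. \<Sum>i<d. y j i * X i x (f k)) \<longlonglongrightarrow> (\<Sum>i<d. y j i * v i x)"
      by (intro tendsto_sum tendsto_mult tendsto_const Xlim) simp
    then have "(\<lambda>k. L j x (f k)) \<longlonglongrightarrow> L j x g"
      using LX[OF j x] f g(1) g(2)[OF _ x] by simp
    moreover have "(\<lambda>k. L j x (f k)) \<longlonglongrightarrow> u j x"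
    proof (rule LIM_zero_cancel, rule Lim_null_comparison[OF _ lim1], rule always_eventually, rule allI)
      fix k
      have "1 / (real k + 1) / s \<le> 1 / (real k + 1) / 1"
        using s by (intro divide_left_mono) auto
      then show "norm (L j x (f k) - u j x) \<le> 1 / (real k + 1)"
        using f[rule_format, of k] j x by fastforce
    qed
    ultimately show "L j x g = u j x" using LIMSEQ_unique by blast
  qed
qed

end

theorem theorem6p1:
  fixes G :: "('a, 'b) monoid_scheme" and M :: "'a manifold"
    and V :: "'a \<Rightarrow> 'a ctangent set" and h :: "'a vfield set" and H :: "'a set"
    and n m :: nat
    and L P :: "nat \<Rightarrow> 'a vfield" and \<tau> \<zeta> :: "nat \<Rightarrow> 'a form1"
  assumes "lie_group G M" and "compact_space (mtop M)" and "connected_space (mtop M)"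
    and "subbundle M n V" and "involutive M V" and "essentially_real M V"
    and "left_invariant_bundle G M V"
    and "real_lie_subalgebra G M h"
    and "complexification h = left_invariant_sections G M V"
    and "connected_integral_subgroup G M h H"
    and "\<forall>j<n. L j \<in> lie_algebra G M"
    and "is_basis vscale n L (left_invariant_sections G M V)"
    and "is_basis vscale (n + m) (\<lambda>k. if k < n then L k else P (k - n)) (complex_lie_algebra G M)"
    and "dual_frame G M n m L P \<tau> \<zeta>"
    and "closedin (mtop M) H"
  shows "closedin (underline_topology M n L \<tau>) (d_prime n L \<tau> ` C_inf M)"
proof -
  interpret G: lie_group G M by fact
  obtain N where sub: "subgroup H G" and N: "lie_group (G\<lparr>carrier := H\<rparr>) N" "connected_space (mtop N)"
      "smooth_map N M (\<lambda>x. x)"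
    and h: "h = {X \<in> lie_algebra G M. \<exists>Y\<in>lie_algebra (G\<lparr>carrier := H\<rparr>) N. \<forall>x\<in>H. pushforward N M (\<lambda>x. x) (Y x) = X x}"
    using assms(10) unfolding connected_integral_subgroup_def by blast
  interpret N: lie_group "G\<lparr>carrier := H\<rparr>" N by fact
  have "\<one>\<^bsub>G\<^esub> \<in> topspace (mtop N)" using N.one_closed N.topspace_carrier by simp
  then obtain U \<psi> where U: "(U, \<psi>) \<in> atlas N" "\<one>\<^bsub>G\<^esub> \<in> U" using N.chart_exists by blast
  interpret closed_lie_subgroup G M H N U \<psi>
    by (rule closed_lie_subgroup.intro[OF assms(1) N(1)], rule closed_lie_subgroup_axioms.intro)
      (fact sub assms(2,15) N(2,3) U)+
  have L: "L j \<in> vfields M" if "j < n" for j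
    using assms(11) that by (auto simp: lie_algebra_def complex_lie_algebra_def)
  have LC: "(\<lambda>x. L j x f) \<in> C_inf M" if "j < n" "f \<in> C_inf M" for j f
    using L[OF that(1)] that(2) unfolding vfields_def smooth_vfield_on_def C_inf_def by auto
  have L0: "L j x f = 0" if "j < n" "x \<notin> carrier G" for j x f
    using L[OF that(1)] that(2) by (simp add: vfields_def G.topspace_carrier)
  have span: "module.span vscale (L ` {..<n}) = complexification h" and inj: "inj_on L {..<n}"
    using assms(9,12) by (auto simp: is_basis_def)
  have "\<exists>c. \<forall>x f. X i x f = (\<Sum>j<n. c j * L j x f)" if i: "i < d" for i
  proof -
    have "\<one>\<^bsub>G\<lparr>carrier := H\<rparr>\<^esub> = \<one>\<^bsub>G\<^esub>" by simp
    then have "coord_field (G\<lparr>carrier := H\<rparr>) N \<kappa> p i \<in> lie_algebra (G\<lparr>carrier := H\<rparr>) N"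
      using N.coord_field_lie_algebra[OF param_N p_in_W _ i] \<kappa>_p by simp
    then have "X i \<in> h"
      unfolding h using G.coord_field_lie_algebra[OF param_M p_in_W \<kappa>_p i] coord_field_extends[OF i] by blast
    moreover have "0 \<in> h" using assms(8) by (simp add: real_lie_subalgebra_def)
    moreover have "X i = X i + vscale \<i> 0" by (simp add: vscale_def fun_eq_iff)
    ultimately have "X i \<in> module.span vscale (L ` {..<n})"
      unfolding span complexification_def by blast
    then obtain c where "\<And>x f. X i x f = (\<Sum>j<n. c j * L j x f)" by (rule span_vfields[OF _ inj]) (rule that)
    then show ?thesis by blast
  qed
  then obtain c where XL: "\<And>i x f. i < d \<Longrightarrow> X i x f = (\<Sum>j<n. c i j * L j x f)" by metis
  have "\<exists>y. \<forall>x\<in>carrier G. \<forall>f\<in>C_inf M. L j x f = (\<Sum>i<d. y i * X i x f)" if j: "j < n" for j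
  proof -
    have field_span: "\<exists>c. \<forall>x\<in>carrier G. \<forall>f\<in>C_inf M. Z x f = (\<Sum>i<d. c i * X i x f)" if Z: "Z \<in> h" for Z
    proof -
      obtain Y where Y: "Z \<in> lie_algebra G M" "Y \<in> lie_algebra (G\<lparr>carrier := H\<rparr>) N" "\<And>x. x \<in> H \<Longrightarrow> pushforward N M (\<lambda>x. x) (Y x) = Z x"
        using Z unfolding h by blast
      show ?thesis by (rule integral_field_span[OF Y]) blast+
    qed
    interpret V: vector_space vscale by (rule vector_space_vscale)
    have "L j \<in> complexification h" unfolding span[symmetric] using j by (intro V.span_base) auto
    then obtain A B where AB: "L j = A + vscale \<i> B" "A \<in> h" "B \<in> h" unfolding complexification_def by blast
    obtain a where a: "\<And>x f. x \<in> carrier G \<Longrightarrow> f \<in> C_inf M \<Longrightarrow> A x f = (\<Sum>i<d. a i * X i x f)" using field_span[OF AB(2)] by blast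
    obtain b where b: "\<And>x f. x \<in> carrier G \<Longrightarrow> f \<in> C_inf M \<Longrightarrow> B x f = (\<Sum>i<d. b i * X i x f)" using field_span[OF AB(3)] by blast
    have "L j x f = (\<Sum>i<d. (a i + \<i> * b i) * X i x f)" if "x \<in> carrier G" "f \<in> C_inf M" for x f
      unfolding AB(1) using a[OF that] b[OF that]
      by (simp add: vscale_def sum_distrib_left sum.distrib distrib_right mult.assoc)
    then show ?thesis by (intro exI[of _ "\<lambda>i. a i + \<i> * b i"] ballI)
  qed
  then have "\<forall>j. \<exists>y. j < n \<longrightarrow> (\<forall>x\<in>carrier G. \<forall>f\<in>C_inf M. L j x f = (\<Sum>i<d. y i * X i x f))"
    by (intro allI) (simp only: ex_simps, intro impI)
  then obtain y where y: "\<forall>j. j < n \<longrightarrow> (\<forall>x\<in>carrier G. \<forall>f\<in>C_inf M. L j x f = (\<Sum>i<d. y j i * X i x f))"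
    by (rule choice[THEN exE])
  have LX: "L j x f = (\<Sum>i<d. y j i * X i x f)" if "j < n" "x \<in> carrier G" "f \<in> C_inf M" for j x f
    using y that by simp
  let ?T = "underline_topology M n L \<tau>" and ?S = "d_prime n L \<tau> ` C_inf M"
  let ?\<Theta> = "\<lambda>\<omega>. \<lambda>j\<in>{..<n}. \<lambda>x. \<omega> x (L j x)"
  have \<tau>: "\<tau> k x (L j x) = (if k = j then 1 else 0)" if "j < n" "k < n" "x \<in> carrier G" for j k x
    using assms(14) that unfolding dual_frame_def by blast
  have coeff: "combine_forms n \<tau> w x (L j x) = w j x" if w: "\<And>j. j < n \<Longrightarrow> w j \<in> C_inf M" and j: "j < n" for w j x
  proof (cases "x \<in> carrier G")
    case True
    then show ?thesis using j by (simp add: combine_forms_def \<tau> if_distrib[of "\<lambda>t. _ * t"] cong: if_cong)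
  next
    case False
    then show ?thesis using w j by (simp add: combine_forms_def G.C_inf_outside G.topspace_carrier)
  qed
  have dcoeff: "d_prime n L \<tau> f x (L j x) = L j x f" if "f \<in> C_inf M" "j < n" for f j x
    unfolding d_prime_def by (rule coeff[of "\<lambda>j x. L j x f"]) (use LC that in simp_all)
  have ne: "topspace (mtop M) \<noteq> {}" using G.one_closed G.topspace_carrier by blast
  have S_forms: "?S \<subseteq> underline_forms M n \<tau>"
    unfolding d_prime_def underline_forms_def using LC by blast
  have S_top: "?S \<subseteq> topspace ?T"
  proof
    fix \<omega> assume "\<omega> \<in> ?S"
    then obtain f where f: "f \<in> C_inf M" "\<omega> = d_prime n L \<tau> f" by blast
    have "?\<Theta> \<omega> \<in> topspace (product_topology (\<lambda>_. C_inf_topology M) {..<n})"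
    proof -
      have "(\<lambda>x. \<omega> x (L j x)) \<in> topspace (C_inf_topology M)" if "j < n" for j
        unfolding f(2) dcoeff[OF f(1) that]
        by (rule G.C_inf_subset_topspace[OF ne LC[OF that f(1)]])
      then show ?thesis by simp
    qed
    then show "\<omega> \<in> topspace ?T"
      unfolding underline_topology_def topspace_pullback_topology using S_forms f by blast
  qed
  have "?T closure_of ?S \<subseteq> ?S"
  proof
    fix \<omega> assume \<omega>: "\<omega> \<in> ?T closure_of ?S"
    then have "\<omega> \<in> underline_forms M n \<tau>"
      using closure_of_subset_topspace[of ?T ?S] unfolding underline_topology_def topspace_pullback_topology by blast
    then obtain u where u: "\<And>j. j < n \<Longrightarrow> u j \<in> C_inf M" "\<omega> = combine_forms n \<tau> u" unfolding underline_forms_def by blast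
    have appr: "\<exists>f\<in>C_inf M. \<forall>j<n. \<forall>x\<in>carrier G. norm (L j x f - u j x) < e" if e: "0 < e" for e
    proof -
      have "\<forall>j. \<exists>T. j < n \<longrightarrow> openin (C_inf_topology M) T \<and> u j \<in> T \<and> (\<forall>g\<in>T. \<forall>x\<in>topspace (mtop M). norm (g x - u j x) < e)"
        using G.openin_C_inf_uniform[OF assms(2) ne u(1) e] by metis
      then obtain B where B: "\<forall>j. j < n \<longrightarrow> openin (C_inf_topology M) (B j) \<and> u j \<in> B j \<and> (\<forall>g\<in>B j. \<forall>x\<in>topspace (mtop M). norm (g x - u j x) < e)"
        by (rule choice[THEN exE])
      let ?O = "?\<Theta> -` (Pi\<^sub>E {..<n} B) \<inter> underline_forms M n \<tau>"
      have "openin ?T ?O"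
        unfolding underline_topology_def openin_pullback_topology
        by (intro exI[of _ "Pi\<^sub>E {..<n} B"] conjI refl) (use B in \<open>auto simp: openin_PiE\<close>)
      moreover have "\<omega> \<in> ?O"
      proof -
        have "(\<lambda>x. \<omega> x (L j x)) = u j" if "j < n" for j
          unfolding u(2) by (rule ext) (rule coeff[OF u(1) that])
        then have "?\<Theta> \<omega> \<in> Pi\<^sub>E {..<n} B" using B by (simp add: restrict_PiE_iff)
        then show ?thesis using \<open>\<omega> \<in> underline_forms M n \<tau>\<close> by (intro IntI vimageI2)
      qed
      ultimately have "\<exists>\<omega>'. \<omega>' \<in> ?S \<and> \<omega>' \<in> ?O"
        using \<omega>[unfolded in_closure_of, THEN conjunct2, THEN spec, of ?O] by simp
      then obtain f where f: "f \<in> C_inf M" "d_prime n L \<tau> f \<in> ?O" by (elim exE conjE imageE) simp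
      have "norm (L j x f - u j x) < e" if j: "j < n" and x: "x \<in> carrier G" for j x
      proof -
        have "?\<Theta> (d_prime n L \<tau> f) \<in> Pi\<^sub>E {..<n} B" using f(2) by blast
        then have "?\<Theta> (d_prime n L \<tau> f) j \<in> B j" using j by (meson PiE_mem lessThan_iff)
        then have "(\<lambda>x. L j x f) \<in> B j"
          using j by (simp add: dcoeff[OF f(1) j])
        moreover have "\<forall>g\<in>B j. \<forall>x\<in>carrier G. norm (g x - u j x) < e"
          using B j G.topspace_carrier by simp
        ultimately show ?thesis using x by fastforce
      qed
      then show ?thesis using f(1) by blast
    qed
    obtain g where g: "g \<in> C_inf M" "\<And>j x. j < n \<Longrightarrow> x \<in> carrier G \<Longrightarrow> L j x g = u j x"
    proof (rule solve_limit_equation[of n u c L y])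
      show "u j \<in> C_inf M" if "j < n" for j by (rule u(1)[OF that])
      show "X i x f = (\<Sum>j<n. c i j * L j x f)" if "i < d" for i x f by (rule XL[OF that])
      show "L j x f = (\<Sum>i<d. y j i * X i x f)" if "j < n" "x \<in> carrier G" "f \<in> C_inf M" for j x f
        by (rule LX[OF that])
      show "\<exists>f\<in>C_inf M. \<forall>j<n. \<forall>x\<in>carrier G. norm (L j x f - u j x) < e" if "0 < e" for e
        by (rule appr[OF that])
    qed (rule that)
    have "L j x g = u j x" if "j < n" for j x
      using g(2)[OF that] L0[OF that] G.C_inf_outside[OF u(1)[OF that]] G.topspace_carrier by (cases "x \<in> carrier G") auto
    then have "d_prime n L \<tau> g = \<omega>" unfolding u(2) d_prime_def combine_forms_def by simp
    then show "\<omega> \<in> ?S" using g(1) by blast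
  qed
  with S_top show ?thesis using closure_of_subset_eq by blast
qed

end
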